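(* Let $\Gamma$ be a countable discrete group and $\Lambda$ a finitely generated Abelian group. Let $m_\Gamma\in\ell^1(\Gamma)$, $m_\Lambda\in\ell^1(\Lambda)$ be finite complex measures such that the convolution operators $A=L_{m_\Gamma}$ and $B=L_{m_\Lambda}$ are self-adjoint, and let $M=L_{m_{\Lambda\wr\Gamma}}$ be the convolution operator on $\ell^2(\Lambda\wr\Gamma)$ with $m_{\Lambda\wr\Gamma}=\hat m_\Gamma+\hat m_\Lambda$. Consider the random Schrödinger operator $H(\omega)=A+V(\omega)$ on $\ell^2(\Gamma)$, where $V(\omega)=\operatorname{Diag}(v(x,\omega))_{x\in\Gamma}$ and the random potential $(v(x,\omega))_{x\in\Gamma}$ is i.i.d. following the spectral measure $\mu_B^{e_\Lambda}$. There is a natural construction of the probability space $(\Omega,\mathbb{P})$ on which $H(\omega)=A+V(\omega)$ is defined, such that $M$ is unitarily equivalent to the direct integral of $H(\omega)$ over $(\Omega,\mathbb{P})$. More precisely, for some explicit unitary transform $\mathcal{F}:L^2(\Omega,\mathbb{P};\ell^2(\Gamma))\to\ell^2(\Lambda\wr\Gamma)$, one has $$\int_\Omega^{\oplus}H(\omega)\,\mathbb{P}(\mathrm{d}\omega)=\mathcal{F}^*M\mathcal{F}.$$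
   Context: For a countable discrete group $G$ with identity $e_G$, $\delta_x$ ($x\in G$) is the canonical basis of $\ell^2(G)$. The left regular representation is $(L_xf)(y)=f(x^{-1}y)$. For a finite complex measure $m\in\ell^1(G)$, the convolution operator is $L_m=\sum_{x\in G}m(x)L_x$; it is self-adjoint iff $m(g^{-1})=\overline{m(g)}$ for all $g$. For a bounded self-adjoint operator $L$ with spectral resolution $E_L$, $\mu_L^x(\cdot)=\langle\delta_x,E_L(\cdot)\delta_x\rangle$. $\operatorname{Diag}(v_x)_{x\in\Gamma}$ is the multiplication operator $\delta_x\mapsto v_x\delta_x$. Wreath product: $\Lambda\wr\Gamma=(\bigoplus_\Gamma\Lambda)\rtimes\Gamma$ is the set of pairs $(f,g)$ with $g\in\Gamma$ and $f:\Gamma\to\Lambda$ finitely supported, with product $(f,g)(f',g')=(f\cdot(f'\circ g^{-1}),gg')$, where $(f'\circ g^{-1})(h)=f'(g^{-1}h)$. The groups embed by $g\mapsto\hat g=(e,g)$, with $e$ the constant function $e_\Lambda$, and $l\mapsto\hat l=(1_l,e_\Gamma)$, with $1_l(e_\Gamma)=l$ and $1_l(x)=e_\Lambda$ for $x\neq e_\Gamma$. For a measure $m$ on $\Gamma$ or $\Lambda$, $\hat m$ denotes its push-forward to $\Lambda\wr\Gamma$ under the corresponding embedding. The probability space $(\Omega,\mathbb{P})$ corresponds to the Pontryagin dual of the Abelian group $\bigoplus_\Gamma\Lambda$ of lamp configurations. Direct integral: for a uniformly bounded measurable operator-valued map $\omega\mapsto H(\omega)$ on $\ell^2(\Gamma)$,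 $\int_\Omega^\oplus H(\omega)\mathbb{P}(\mathrm{d}\omega)$ is the operator on $L^2(\Omega,\mathbb{P};\ell^2(\Gamma))$ defined by $\varphi\mapsto(\omega\mapsto H(\omega)\varphi(\omega))$. *)

theory Defs
  imports "HOL-Probability.Probability" "HOL-Algebra.Product_Groups"
begin

section \<open>The Hilbert space of square-summable functions on a set\<close>

text \<open>
  Functions on a carrier set are represented by functions on the whole type that vanish off
  the carrier.  The inner product is conjugate linear in its first argument.
\<close>

definition ell2 :: "'a set \<Rightarrow> ('a \<Rightarrow> complex) set" where
  "ell2 X = {u. (\<forall>x. x \<notin> X \<longrightarrow> u x = 0) \<and> (\<lambda>x. (cmod (u x))\<^sup>2) summable_on X}"

definition ell2_inner :: "'a set \<Rightarrow> ('a \<Rightarrow> complex) \<Rightarrow> ('a \<Rightarrow> complex) \<Rightarrow> complex" where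
  "ell2_inner X u w = (\<Sum>\<^sub>\<infinity>x\<in>X. cnj (u x) * w x)"

definition ell2_norm :: "'a set \<Rightarrow> ('a \<Rightarrow> complex) \<Rightarrow> real" where
  "ell2_norm X u = sqrt (\<Sum>\<^sub>\<infinity>x\<in>X. (cmod (u x))\<^sup>2)"

definition delta :: "'a \<Rightarrow> 'a \<Rightarrow> complex" where
  "delta x = (\<lambda>y. if y = x then 1 else 0)"

type_synonym 'a op = "('a \<Rightarrow> complex) \<Rightarrow> 'a \<Rightarrow> complex"

definition bounded_op :: "'a set \<Rightarrow> real \<Rightarrow> 'a op \<Rightarrow> bool" where
  "bounded_op X K L \<longleftrightarrow>
     (\<forall>u\<in>ell2 X. L u \<in> ell2 X \<and> ell2_norm X (L u) \<le> K * ell2_norm X u) \<and>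
     (\<forall>u\<in>ell2 X. \<forall>w\<in>ell2 X. L (\<lambda>x. u x + w x) = (\<lambda>x. L u x + L w x)) \<and>
     (\<forall>c. \<forall>u\<in>ell2 X. L (\<lambda>x. c * u x) = (\<lambda>x. c * L u x))"

definition self_adjoint_op :: "'a set \<Rightarrow> 'a op \<Rightarrow> bool" where
  "self_adjoint_op X L \<longleftrightarrow>
     (\<exists>K. bounded_op X K L) \<and>
     (\<forall>u\<in>ell2 X. \<forall>w\<in>ell2 X. ell2_inner X (L u) w = ell2_inner X u (L w))"

definition orthogonal_projection :: "'a set \<Rightarrow> 'a op \<Rightarrow> bool" where
  "orthogonal_projection X Q \<longleftrightarrow> self_adjoint_op X Q \<and> (\<forall>u\<in>ell2 X. Q (Q u) = Q u)"

definition Diag :: "('a \<Rightarrow> complex) \<Rightarrow> 'a op" where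
  "Diag v u = (\<lambda>x. v x * u x)"


section \<open>Spectral resolutions and spectral measures\<close>

definition projection_valued_measure :: "'a set \<Rightarrow> (real set \<Rightarrow> 'a op) \<Rightarrow> bool" where
  "projection_valued_measure X E \<longleftrightarrow>
     (\<forall>S\<in>sets borel. orthogonal_projection X (E S)) \<and>
     (\<forall>u\<in>ell2 X. E UNIV u = u) \<and>
     (\<forall>S\<in>sets borel. \<forall>T\<in>sets borel. \<forall>u\<in>ell2 X. E (S \<inter> T) u = E S (E T u)) \<and>
     (\<forall>S :: nat \<Rightarrow> real set. range S \<subseteq> sets borel \<and> disjoint_family S \<longrightarrow>
        (\<forall>u\<in>ell2 X. \<forall>w\<in>ell2 X.
           (\<lambda>n. ell2_inner X u (E (S n) w)) sums ell2_inner X u (E (\<Union>n. S n) w)))"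

definition diagonal_measure ::
    "'a set \<Rightarrow> (real set \<Rightarrow> 'a op) \<Rightarrow> ('a \<Rightarrow> complex) \<Rightarrow> real measure" where
  "diagonal_measure X E u =
     measure_of UNIV (sets borel) (\<lambda>S. ennreal (Re (ell2_inner X u (E S u))))"

text \<open>
  The identity \<open>L = \<integral> t dE(t)\<close> is read through its quadratic form, which determines the operator
  by polarization.  The resolution of a bounded operator lives on a bounded set.
\<close>

definition is_spectral_resolution :: "'a set \<Rightarrow> 'a op \<Rightarrow> (real set \<Rightarrow> 'a op) \<Rightarrow> bool" where
  "is_spectral_resolution X L E \<longleftrightarrow>
     projection_valued_measure X E \<and>
     (\<exists>R. \<forall>u\<in>ell2 X. E {-R..R} u = u) \<and>
     (\<forall>u\<in>ell2 X. ell2_inner X u (L u) =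
        complex_of_real (integral\<^sup>L (diagonal_measure X E u) (\<lambda>t. t)))"

text \<open>
  By the spectral theorem, the resolution of a bounded self-adjoint operator exists and is unique
  as a family of operators on \<open>\<ell>\<^sup>2\<close> indexed by Borel sets; the choice operator only fixes
  irrelevant values elsewhere.
\<close>

definition spectral_resolution :: "'a set \<Rightarrow> 'a op \<Rightarrow> real set \<Rightarrow> 'a op" where
  "spectral_resolution X L = (SOME E. is_spectral_resolution X L E)"

definition spectral_measure :: "'a set \<Rightarrow> 'a op \<Rightarrow> 'a \<Rightarrow> real measure" where
  "spectral_measure X L x = diagonal_measure X (spectral_resolution X L) (delta x)"


section \<open>Convolution operators\<close>

definition finitely_generated :: "('a, 'b) monoid_scheme \<Rightarrow> bool" where
  "finitely_generated G \<longleftrightarrow> (\<exists>S. finite S \<and> S \<subseteq> carrier G \<and> generate G S = carrier G)"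

definition ell1 :: "'a set \<Rightarrow> ('a \<Rightarrow> complex) set" where
  "ell1 X = {m. (\<lambda>x. cmod (m x)) summable_on X}"

definition left_regular :: "('a, 'b) monoid_scheme \<Rightarrow> 'a \<Rightarrow> 'a op" where
  "left_regular G x u = (\<lambda>y. if y \<in> carrier G then u (inv\<^bsub>G\<^esub> x \<otimes>\<^bsub>G\<^esub> y) else 0)"

text \<open>
  The series of operators converges absolutely in norm for \<open>m\<close> in \<open>\<ell>\<^sup>1\<close>, so it can be
  evaluated pointwise.
\<close>

definition conv_op :: "('a, 'b) monoid_scheme \<Rightarrow> ('a \<Rightarrow> complex) \<Rightarrow> 'a op" where
  "conv_op G m u = (\<lambda>y. \<Sum>\<^sub>\<infinity>x\<in>carrier G. m x * left_regular G x u y)"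

definition push_forward :: "'a set \<Rightarrow> ('a \<Rightarrow> 'b) \<Rightarrow> ('a \<Rightarrow> complex) \<Rightarrow> 'b \<Rightarrow> complex" where
  "push_forward X h m = (\<lambda>w. \<Sum>\<^sub>\<infinity>x\<in>{x\<in>X. h x = w}. m x)"


section \<open>Wreath products\<close>

abbreviation lamps :: "('l, 'b) monoid_scheme \<Rightarrow> ('g, 'c) monoid_scheme \<Rightarrow> ('g \<Rightarrow> 'l) monoid" where
  "lamps \<Lambda> \<Gamma> \<equiv> sum_group (carrier \<Gamma>) (\<lambda>_. \<Lambda>)"

definition wreath ::
    "('l, 'b) monoid_scheme \<Rightarrow> ('g, 'c) monoid_scheme \<Rightarrow> (('g \<Rightarrow> 'l) \<times> 'g) monoid" where
  "wreath \<Lambda> \<Gamma> =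
     \<lparr>carrier = carrier (lamps \<Lambda> \<Gamma>) \<times> carrier \<Gamma>,
      mult = (\<lambda>(f, g) (f', g').
        (f \<otimes>\<^bsub>lamps \<Lambda> \<Gamma>\<^esub> (\<lambda>h\<in>carrier \<Gamma>. f' (inv\<^bsub>\<Gamma>\<^esub> g \<otimes>\<^bsub>\<Gamma>\<^esub> h)), g \<otimes>\<^bsub>\<Gamma>\<^esub> g')),
      one = (\<one>\<^bsub>lamps \<Lambda> \<Gamma>\<^esub>, \<one>\<^bsub>\<Gamma>\<^esub>)\<rparr>"

definition lamp_at ::
    "('l, 'b) monoid_scheme \<Rightarrow> ('g, 'c) monoid_scheme \<Rightarrow> 'g \<Rightarrow> 'l \<Rightarrow> 'g \<Rightarrow> 'l" where
  "lamp_at \<Lambda> \<Gamma> x l = (\<lambda>y\<in>carrier \<Gamma>. if y = x then l else \<one>\<^bsub>\<Lambda>\<^esub>)"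

definition embed_base ::
    "('l, 'b) monoid_scheme \<Rightarrow> ('g, 'c) monoid_scheme \<Rightarrow> 'g \<Rightarrow> ('g \<Rightarrow> 'l) \<times> 'g" where
  "embed_base \<Lambda> \<Gamma> g = (\<one>\<^bsub>lamps \<Lambda> \<Gamma>\<^esub>, g)"

definition embed_lamp ::
    "('l, 'b) monoid_scheme \<Rightarrow> ('g, 'c) monoid_scheme \<Rightarrow> 'l \<Rightarrow> ('g \<Rightarrow> 'l) \<times> 'g" where
  "embed_lamp \<Lambda> \<Gamma> l = (lamp_at \<Lambda> \<Gamma> \<one>\<^bsub>\<Gamma>\<^esub> l, \<one>\<^bsub>\<Gamma>\<^esub>)"

definition wreath_measure ::
    "('l, 'b) monoid_scheme \<Rightarrow> ('g, 'c) monoid_scheme \<Rightarrow> ('l \<Rightarrow> complex) \<Rightarrow> ('g \<Rightarrow> complex) \<Rightarrow>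
     ('g \<Rightarrow> 'l) \<times> 'g \<Rightarrow> complex" where
  "wreath_measure \<Lambda> \<Gamma> m\<^sub>\<Lambda> m\<^sub>\<Gamma> = (\<lambda>w.
     push_forward (carrier \<Gamma>) (embed_base \<Lambda> \<Gamma>) m\<^sub>\<Gamma> w +
     push_forward (carrier \<Lambda>) (embed_lamp \<Lambda> \<Gamma>) m\<^sub>\<Lambda> w)"


lemma group_wreath:
  assumes "group \<Gamma>" "group \<Lambda>" shows "group (wreath \<Lambda> \<Gamma>)"
proof -
  interpret G: group \<Gamma> by fact
  interpret L: group \<Lambda> by fact
  have car: "carrier (lamps \<Lambda> \<Gamma>) = {x \<in> carrier \<Gamma> \<rightarrow>\<^sub>E carrier \<Lambda>. finite {i \<in> carrier \<Gamma>. x i \<noteq> \<one>\<^bsub>\<Lambda>\<^esub>}}"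
    by (rule carrier_sum_group) (rule assms)
  have fin: "finite {h \<in> carrier \<Gamma>. f (inv\<^bsub>\<Gamma>\<^esub> g \<otimes>\<^bsub>\<Gamma>\<^esub> h) \<noteq> \<one>\<^bsub>\<Lambda>\<^esub>}"
    if "finite {i \<in> carrier \<Gamma>. f i \<noteq> \<one>\<^bsub>\<Lambda>\<^esub>}" "g \<in> carrier \<Gamma>" for f g
  proof (rule finite_subset[OF _ finite_imageI[OF that(1), of "\<lambda>i. g \<otimes>\<^bsub>\<Gamma>\<^esub> i"]])
    show "{h \<in> carrier \<Gamma>. f (inv\<^bsub>\<Gamma>\<^esub> g \<otimes>\<^bsub>\<Gamma>\<^esub> h) \<noteq> \<one>\<^bsub>\<Lambda>\<^esub>} \<subseteq> (\<lambda>i. g \<otimes>\<^bsub>\<Gamma>\<^esub> i) ` {i \<in> carrier \<Gamma>. f i \<noteq> \<one>\<^bsub>\<Lambda>\<^esub>}"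
      using that(2) by (force simp: G.m_assoc[symmetric] intro!: image_eqI[where x="inv\<^bsub>\<Gamma>\<^esub> g \<otimes>\<^bsub>\<Gamma>\<^esub> _"])
  qed
  have sh: "(\<lambda>h\<in>carrier \<Gamma>. f (inv\<^bsub>\<Gamma>\<^esub> g \<otimes>\<^bsub>\<Gamma>\<^esub> h)) \<in> carrier (lamps \<Lambda> \<Gamma>)"
    if "f \<in> carrier (lamps \<Lambda> \<Gamma>)" "g \<in> carrier \<Gamma>" for f g
    using that fin[of f g] by (auto simp: car PiE_iff cong: conj_cong)
  interpret S: group "lamps \<Lambda> \<Gamma>" by (rule sum_group) (rule assms)
  have cl: "f \<otimes>\<^bsub>lamps \<Lambda> \<Gamma>\<^esub> f' \<in> carrier (lamps \<Lambda> \<Gamma>)" if "f \<in> carrier (lamps \<Lambda> \<Gamma>)" "f' \<in> carrier (lamps \<Lambda> \<Gamma>)" for f f'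
    using that by (rule S.m_closed)
  have li: "\<exists>y\<in>carrier (wreath \<Lambda> \<Gamma>). y \<otimes>\<^bsub>wreath \<Lambda> \<Gamma>\<^esub> (f, g) = \<one>\<^bsub>wreath \<Lambda> \<Gamma>\<^esub>"
    if "f \<in> carrier (lamps \<Lambda> \<Gamma>)" "g \<in> carrier \<Gamma>" for f g
  proof -
    let ?f = "inv\<^bsub>lamps \<Lambda> \<Gamma>\<^esub> (\<lambda>h\<in>carrier \<Gamma>. f (inv\<^bsub>\<Gamma>\<^esub> (inv\<^bsub>\<Gamma>\<^esub> g) \<otimes>\<^bsub>\<Gamma>\<^esub> h))"
    have c: "?f \<in> carrier (lamps \<Lambda> \<Gamma>)" by (rule S.inv_closed[OF sh]) (use that in auto)
    have "?f \<otimes>\<^bsub>lamps \<Lambda> \<Gamma>\<^esub> (\<lambda>h\<in>carrier \<Gamma>. f (inv\<^bsub>\<Gamma>\<^esub> (inv\<^bsub>\<Gamma>\<^esub> g) \<otimes>\<^bsub>\<Gamma>\<^esub> h)) = \<one>\<^bsub>lamps \<Lambda> \<Gamma>\<^esub>"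
      by (rule S.l_inv[OF sh]) (use that in auto)
    then show ?thesis using c that
      by (intro bexI[where x="(?f, inv\<^bsub>\<Gamma>\<^esub> g)"]) (auto simp: wreath_def simp del: mult_sum_group one_sum_group inv_sum_group)
  qed
  show ?thesis
  proof (rule groupI)
    show "x \<otimes>\<^bsub>wreath \<Lambda> \<Gamma>\<^esub> y \<in> carrier (wreath \<Lambda> \<Gamma>)" if "x \<in> carrier (wreath \<Lambda> \<Gamma>)" "y \<in> carrier (wreath \<Lambda> \<Gamma>)" for x y
      using that cl sh by (auto simp: wreath_def simp del: mult_sum_group)
    show "\<one>\<^bsub>wreath \<Lambda> \<Gamma>\<^esub> \<in> carrier (wreath \<Lambda> \<Gamma>)"
      using S.one_closed by (auto simp: wreath_def simp del: one_sum_group)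
    show "x \<otimes>\<^bsub>wreath \<Lambda> \<Gamma>\<^esub> y \<otimes>\<^bsub>wreath \<Lambda> \<Gamma>\<^esub> z = x \<otimes>\<^bsub>wreath \<Lambda> \<Gamma>\<^esub> (y \<otimes>\<^bsub>wreath \<Lambda> \<Gamma>\<^esub> z)"
      if "x \<in> carrier (wreath \<Lambda> \<Gamma>)" "y \<in> carrier (wreath \<Lambda> \<Gamma>)" "z \<in> carrier (wreath \<Lambda> \<Gamma>)" for x y z
      using that by (auto simp: wreath_def car G.m_assoc L.m_assoc G.inv_mult_group PiE_iff intro!: restrict_ext)
    show "\<one>\<^bsub>wreath \<Lambda> \<Gamma>\<^esub> \<otimes>\<^bsub>wreath \<Lambda> \<Gamma>\<^esub> x = x" if "x \<in> carrier (wreath \<Lambda> \<Gamma>)" for x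
      using that by (auto simp: wreath_def car PiE_iff intro!: extensionalityI[where A="carrier \<Gamma>"])
    show "\<exists>y\<in>carrier (wreath \<Lambda> \<Gamma>). y \<otimes>\<^bsub>wreath \<Lambda> \<Gamma>\<^esub> x = \<one>\<^bsub>wreath \<Lambda> \<Gamma>\<^esub>" if "x \<in> carrier (wreath \<Lambda> \<Gamma>)" for x
      using that li[of "fst x" "snd x"] by (auto simp: wreath_def)
  qed
qed


section \<open>Pontryagin duals of discrete groups\<close>

definition circle_group :: "complex monoid" where
  "circle_group = \<lparr>carrier = {z. cmod z = 1}, mult = (*), one = 1\<rparr>"

definition pontryagin_dual :: "('a, 'b) monoid_scheme \<Rightarrow> ('a \<Rightarrow> complex) set" where
  "pontryagin_dual G = hom G circle_group \<inter> extensional (carrier G)"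

text \<open>For a discrete group the compact-open topology is that of pointwise convergence.\<close>

definition dual_topology :: "('a, 'b) monoid_scheme \<Rightarrow> ('a \<Rightarrow> complex) topology" where
  "dual_topology G =
     subtopology (product_topology (\<lambda>_. euclidean) (carrier G)) (pontryagin_dual G)"

definition haar_probability ::
    "('a, 'b) monoid_scheme \<Rightarrow> ('a \<Rightarrow> complex) measure \<Rightarrow> bool" where
  "haar_probability G P \<longleftrightarrow>
     prob_space P \<and>
     space P = pontryagin_dual G \<and>
     sets P = sigma_sets (pontryagin_dual G) {U. openin (dual_topology G) U} \<and>
     (\<forall>\<xi>\<in>pontryagin_dual G. distr P P (\<lambda>\<omega>. \<lambda>x\<in>carrier G. \<xi> x * \<omega> x) = P)"


section \<open>Direct integrals\<close>

text \<open>
  Elements of \<open>L\<^sup>2(P; \<ell>\<^sup>2(X))\<close> are given by representatives, to be compared almost everywhere.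
  For countable \<open>X\<close> the space \<open>\<ell>\<^sup>2(X)\<close> is separable, so measurability can be tested on
  coordinates.
\<close>

definition L2 :: "'w measure \<Rightarrow> 'a set \<Rightarrow> ('w \<Rightarrow> 'a \<Rightarrow> complex) set" where
  "L2 P X = {\<phi>. (\<forall>\<omega>\<in>space P. \<phi> \<omega> \<in> ell2 X) \<and>
                (\<forall>x\<in>X. (\<lambda>\<omega>. \<phi> \<omega> x) \<in> borel_measurable P) \<and>
                integrable P (\<lambda>\<omega>. (ell2_norm X (\<phi> \<omega>))\<^sup>2)}"

definition L2_inner ::
    "'w measure \<Rightarrow> 'a set \<Rightarrow> ('w \<Rightarrow> 'a \<Rightarrow> complex) \<Rightarrow> ('w \<Rightarrow> 'a \<Rightarrow> complex) \<Rightarrow> complex" where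
  "L2_inner P X \<phi> \<psi> = integral\<^sup>L P (\<lambda>\<omega>. ell2_inner X (\<phi> \<omega>) (\<psi> \<omega>))"

definition bounded_measurable_field :: "'w measure \<Rightarrow> 'a set \<Rightarrow> ('w \<Rightarrow> 'a op) \<Rightarrow> bool" where
  "bounded_measurable_field P X H \<longleftrightarrow>
     (\<exists>K. \<forall>\<omega>\<in>space P. bounded_op X K (H \<omega>)) \<and>
     (\<forall>u\<in>ell2 X. \<forall>w\<in>ell2 X. (\<lambda>\<omega>. ell2_inner X u (H \<omega> w)) \<in> borel_measurable P)"

definition direct_integral ::
    "('w \<Rightarrow> 'a op) \<Rightarrow> ('w \<Rightarrow> 'a \<Rightarrow> complex) \<Rightarrow> 'w \<Rightarrow> 'a \<Rightarrow> complex" where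
  "direct_integral H \<phi> = (\<lambda>\<omega>. H \<omega> (\<phi> \<omega>))"

text \<open>
  An isometry identifies representatives that agree almost everywhere, so a unitary on
  representatives is the same as a unitary on the quotient Hilbert space.
\<close>

definition unitary_transform ::
    "'w measure \<Rightarrow> 'a set \<Rightarrow> 'b set \<Rightarrow> (('w \<Rightarrow> 'a \<Rightarrow> complex) \<Rightarrow> 'b \<Rightarrow> complex) \<Rightarrow> bool" where
  "unitary_transform P X Y F \<longleftrightarrow>
     (\<forall>\<phi>\<in>L2 P X. \<forall>\<psi>\<in>L2 P X. F (\<lambda>\<omega> x. \<phi> \<omega> x + \<psi> \<omega> x) = (\<lambda>y. F \<phi> y + F \<psi> y)) \<and>
     (\<forall>c. \<forall>\<phi>\<in>L2 P X. F (\<lambda>\<omega> x. c * \<phi> \<omega> x) = (\<lambda>y. c * F \<phi> y)) \<and>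
     (\<forall>\<phi>\<in>L2 P X. \<forall>\<psi>\<in>L2 P X. ell2_inner Y (F \<phi>) (F \<psi>) = L2_inner P X \<phi> \<psi>) \<and>
     F ` L2 P X = ell2 Y"

text \<open>A representative of \<open>F\<^sup>* u\<close>, which is unique up to a null set.\<close>

definition adjoint_transform ::
    "'w measure \<Rightarrow> 'a set \<Rightarrow> 'b set \<Rightarrow> (('w \<Rightarrow> 'a \<Rightarrow> complex) \<Rightarrow> 'b \<Rightarrow> complex) \<Rightarrow>
     ('b \<Rightarrow> complex) \<Rightarrow> 'w \<Rightarrow> 'a \<Rightarrow> complex" where
  "adjoint_transform P X Y F u =
     (SOME \<psi>. \<psi> \<in> L2 P X \<and> (\<forall>\<phi>\<in>L2 P X. L2_inner P X \<phi> \<psi> = ell2_inner Y (F \<phi>) u))"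


section \<open>The random potential and the Fourier transform\<close>

text \<open>
  A walker at \<open>g\<close> in configuration \<open>f\<close> sees the lamps \<open>f \<circ> g\<close>; in these coordinates left
  multiplication by \<open>\<Gamma>\<close> only moves the walker, and left multiplication by \<open>\<Lambda>\<close> acts on the
  lamp at \<open>inv g\<close>.  Hence the potential at \<open>x\<close> is the Fourier transform of the lamp measure at the
  component of the character \<open>\<omega>\<close> with index \<open>inv x\<close>.  That sum is real when the convolution
  operator of the lamp measure is self-adjoint.
\<close>

definition lamp_potential ::
    "('l, 'b) monoid_scheme \<Rightarrow> ('g, 'c) monoid_scheme \<Rightarrow> ('l \<Rightarrow> complex) \<Rightarrow>
     'g \<Rightarrow> (('g \<Rightarrow> 'l) \<Rightarrow> complex) \<Rightarrow> real" where
  "lamp_potential \<Lambda> \<Gamma> m x \<omega> =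
     Re (\<Sum>\<^sub>\<infinity>l\<in>carrier \<Lambda>. m l * \<omega> (lamp_at \<Lambda> \<Gamma> (inv\<^bsub>\<Gamma>\<^esub> x) l))"

definition lamp_transform ::
    "('l, 'b) monoid_scheme \<Rightarrow> ('g, 'c) monoid_scheme \<Rightarrow> (('g \<Rightarrow> 'l) \<Rightarrow> complex) measure \<Rightarrow>
     ((('g \<Rightarrow> 'l) \<Rightarrow> complex) \<Rightarrow> 'g \<Rightarrow> complex) \<Rightarrow> ('g \<Rightarrow> 'l) \<times> 'g \<Rightarrow> complex" where
  "lamp_transform \<Lambda> \<Gamma> P \<phi> = (\<lambda>(f, g).
     if (f, g) \<in> carrier (wreath \<Lambda> \<Gamma>)
     then integral\<^sup>L P (\<lambda>\<omega>. cnj (\<omega> (\<lambda>h\<in>carrier \<Gamma>. f (g \<otimes>\<^bsub>\<Gamma>\<^esub> h))) * \<phi> \<omega> g)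
     else 0)"

definition random_schroedinger ::
    "('g, 'c) monoid_scheme \<Rightarrow> ('g \<Rightarrow> complex) \<Rightarrow> ('g \<Rightarrow> 'w \<Rightarrow> real) \<Rightarrow> 'w \<Rightarrow> 'g op" where
  "random_schroedinger \<Gamma> m v \<omega> = (\<lambda>u x.
     conv_op \<Gamma> m u x + Diag (\<lambda>x. complex_of_real (v x \<omega>)) u x)"

definition iid_with_law ::
    "'w measure \<Rightarrow> 'i set \<Rightarrow> ('i \<Rightarrow> 'w \<Rightarrow> real) \<Rightarrow> real measure \<Rightarrow> bool" where
  "iid_with_law P I v \<mu> \<longleftrightarrow>
     prob_space.indep_vars P (\<lambda>_. borel) v I \<and> (\<forall>i\<in>I. distr P borel (v i) = \<mu>)"

end

theory Submission
  imports Defs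
begin

text \<open>
  Write \<open>N\<close> for the group of lamp configurations.  The wreath product acts on \<open>\<ell>\<^sup>2(N \<times> \<Gamma>)\<close>; the
  coordinates \<open>(f, g) \<mapsto> (h \<mapsto> f (g h), g)\<close> record the configuration as the walker at \<open>g\<close> sees it.  In
  these coordinates left translation by \<open>\<Gamma>\<close> moves the walker and leaves the configuration alone, and
  left translation by a lamp \<open>l\<close> multiplies the configuration by \<open>l\<close> at the site \<open>inv g\<close> and leaves
  the walker alone (\<open>translate_base\<close>, \<open>translate_lamp\<close>).  The second action is by translations of the
  Abelian group \<open>N\<close>, so the Fourier transform in the configuration variable diagonalizes it: at every
  character \<open>\<omega>\<close> of \<open>N\<close>, convolution by the lamp measure \<open>m\<close> becomes multiplication by
  \<open>\<Sum>l. m l * \<omega> (l at inv g)\<close>, which is the potential at \<open>g\<close>.  The first action does not involve \<open>\<omega>\<close>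
  and is \<open>A\<close> in every fibre.  Hence the convolution operator turns into the field of operators
  \<open>A + V(\<omega>)\<close> (\<open>lamp_transform_intertwines\<close>).

  It remains to justify the Fourier transform and to identify the law of the potential.

  The Fourier analysis rests on one property of a probability measure on the dual: nontrivial group
  elements, regarded as functions of the character, have mean zero.  It says that these functions
  are orthonormal.  They are complete because, by the Weierstrass theorem, a functional that vanishes
  on all of them vanishes on indicators of measurable sets (\<open>dual_functional\<close>); with the
  Riesz--Fischer construction this gives the Parseval identity and surjectivity, first for scalar
  functions and then fibre by fibre.  The same uniqueness argument shows that the measure is
  translation invariant.

  A measure with the mean zero property is built by hand.  For a finitely generated Abelian group one
  adds generators one at a time and extends a random character of the smaller group by a random value
  at the new generator (\<open>dual_probability_exists\<close>).  For the group of lamp configurations one takes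
  an independent family of such random characters of \<open>\<Lambda>\<close>, one for each site.  The components of the
  random character of \<open>N\<close> at single sites are then independent by construction, and the potential at
  each site is a fixed function of one of them, the symbol of the lamp measure.

  Finally, the Fourier transform turns convolution by \<open>m\<close> on \<open>\<Lambda>\<close> into multiplication by its
  symbol, so a spectral resolution exists and consists of indicators of the symbol.  The spectral
  measure refers to an arbitrary resolution; but for every resolution its \<open>k\<close>-th moment is
  \<open>\<langle>\<delta>, L\<^sup>k \<delta>\<rangle>\<close>, which is the \<open>k\<close>-th moment of the symbol, and measures with bounded support are
  determined by their moments (\<open>spectral_measure_conv_op\<close>).
\<close>

section \<open>Square-integrable functions\<close>

definition square_integrable :: "'x measure \<Rightarrow> ('x \<Rightarrow> complex) \<Rightarrow> bool" where
  "square_integrable M f \<longleftrightarrow>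
     f \<in> borel_measurable M \<and> integrable M (\<lambda>x. (cmod (f x))\<^sup>2)"

lemma borel_measurable_cnj [measurable]:
  "f \<in> borel_measurable M \<Longrightarrow> (\<lambda>x. cnj (f x)) \<in> borel_measurable M"
  using measurable_compose[of f M borel cnj borel] by (simp add: borel_measurable_continuous_onI continuous_on_cnj)

lemma square_integrable_measurable [measurable_dest]:
  "square_integrable M f \<Longrightarrow> f \<in> borel_measurable M"
  by (simp add: square_integrable_def)

lemma square_integrable_norm_sq: "square_integrable M f \<Longrightarrow> integrable M (\<lambda>x. (cmod (f x))\<^sup>2)"
  by (simp add: square_integrable_def)

lemma cmod_add_sq_le: "(cmod (a + b))\<^sup>2 \<le> 2 * (cmod a)\<^sup>2 + 2 * (cmod b)\<^sup>2"
proof -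
  have "(cmod (a + b))\<^sup>2 \<le> (cmod a + cmod b)\<^sup>2"
    by (intro power_mono norm_triangle_ineq) auto
  also have "\<dots> \<le> 2 * (cmod a)\<^sup>2 + 2 * (cmod b)\<^sup>2"
    using sum_squares_bound[of "cmod a" "cmod b"] by (simp add: power2_sum)
  finally show ?thesis .
qed

lemma square_integrable_mult_bounded:
  assumes "square_integrable M f" "b \<in> borel_measurable M" "\<And>x. x \<in> space M \<Longrightarrow> cmod (b x) \<le> C"
  shows "square_integrable M (\<lambda>x. b x * f x)"
  unfolding square_integrable_def
proof
  note [measurable] = assms(2) square_integrable_measurable[OF assms(1)]
  show "(\<lambda>x. b x * f x) \<in> borel_measurable M" by measurable
  show "integrable M (\<lambda>x. (cmod (b x * f x))\<^sup>2)"
  proof (rule Bochner_Integration.integrable_bound)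
    show "integrable M (\<lambda>x. C\<^sup>2 * (cmod (f x))\<^sup>2)"
      using assms(1) by (simp add: square_integrable_def)
    show "AE x in M. norm ((cmod (b x * f x))\<^sup>2) \<le> norm (C\<^sup>2 * (cmod (f x))\<^sup>2)"
      using assms(3) by (intro AE_I2)
        (auto simp: norm_mult power_mult_distrib intro!: mult_right_mono power_mono)
  qed measurable
qed

lemma square_integrable_cmult:
  "square_integrable M f \<Longrightarrow> square_integrable M (\<lambda>x. c * f x)"
  by (rule square_integrable_mult_bounded[where C = "cmod c"]) auto

lemma square_integrable_add:
  assumes "square_integrable M f" "square_integrable M g"
  shows "square_integrable M (\<lambda>x. f x + g x)"
  unfolding square_integrable_def
proof
  note [measurable] = square_integrable_measurable[OF assms(1)] square_integrable_measurable[OF assms(2)]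
  show "(\<lambda>x. f x + g x) \<in> borel_measurable M" by measurable
  show "integrable M (\<lambda>x. (cmod (f x + g x))\<^sup>2)"
  proof (rule Bochner_Integration.integrable_bound)
    show "integrable M (\<lambda>x. 2 * (cmod (f x))\<^sup>2 + 2 * (cmod (g x))\<^sup>2)"
      using assms by (simp add: square_integrable_def)
    show "AE x in M. norm ((cmod (f x + g x))\<^sup>2) \<le> norm (2 * (cmod (f x))\<^sup>2 + 2 * (cmod (g x))\<^sup>2)"
      using cmod_add_sq_le by (intro AE_I2) auto
  qed measurable
qed

lemma square_integrable_diff:
  assumes "square_integrable M f" "square_integrable M g"
  shows "square_integrable M (\<lambda>x. f x - g x)"
  using square_integrable_add[OF assms(1) square_integrable_cmult[OF assms(2), of "-1"]] by simp

lemma square_integrable_sum: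
  assumes "\<And>i. i \<in> I \<Longrightarrow> square_integrable M (f i)"
  shows "square_integrable M (\<lambda>x. \<Sum>i\<in>I. f i x)"
  using assms
  by (induction I rule: infinite_finite_induct)
    (auto simp: square_integrable_def[of _ "\<lambda>_. 0"] intro: square_integrable_add)

lemma square_integrable_inner:
  assumes "square_integrable M f" "square_integrable M g"
  shows "integrable M (\<lambda>x. cnj (f x) * g x)"
proof (rule Bochner_Integration.integrable_bound)
  note [measurable] = square_integrable_measurable[OF assms(1)] square_integrable_measurable[OF assms(2)]
  show "(\<lambda>x. cnj (f x) * g x) \<in> borel_measurable M" by measurable
  show "integrable M (\<lambda>x. (cmod (f x))\<^sup>2 + (cmod (g x))\<^sup>2)"
    using assms by (simp add: square_integrable_def)
  have "cmod (f x) * cmod (g x) \<le> (cmod (f x))\<^sup>2 + (cmod (g x))\<^sup>2" for x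
    using sum_squares_bound[of "cmod (f x)" "cmod (g x)"]
      mult_nonneg_nonneg[of "cmod (f x)" "cmod (g x)"] by (simp del: mult_nonneg_nonneg)
  then show "AE x in M. norm (cnj (f x) * g x) \<le> norm ((cmod (f x))\<^sup>2 + (cmod (g x))\<^sup>2)"
    by (intro AE_I2) (auto simp: norm_mult)
qed

lemma (in finite_measure) square_integrable_imp_integrable_complex:
  assumes "square_integrable M f" shows "integrable M f"
  using square_integrable_inner[of M "\<lambda>_. 1" f] assms by (simp add: square_integrable_def)

lemma square_integrable_cong_AE:
  assumes "square_integrable M f" "g \<in> borel_measurable M" "AE x in M. f x = g x"
  shows "square_integrable M g"
proof -
  note [measurable] = square_integrable_measurable[OF assms(1)] assms(2)
  have "integrable M (\<lambda>x. (cmod (g x))\<^sup>2) \<longleftrightarrow> integrable M (\<lambda>x. (cmod (f x))\<^sup>2)"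
    by (intro integrable_cong_AE) (use assms(3) in auto)
  then show ?thesis using assms by (simp add: square_integrable_def)
qed

lemma cmod_sq_eq: "complex_of_real ((cmod z)\<^sup>2) = cnj z * z"
  by (metis complex_norm_square mult.commute of_real_power)

lemma cmod_polarization:
  "cnj a * b = complex_of_real (((cmod (a + b))\<^sup>2 - (cmod (a - b))\<^sup>2) / 4) -
     \<i> * complex_of_real (((cmod (a + \<i> * b))\<^sup>2 - (cmod (a - \<i> * b))\<^sup>2) / 4)"
  by (simp add: complex_eq_iff cmod_power2) (simp add: power2_eq_square field_simps)

lemma integral_polarization:
  assumes "square_integrable M f" "square_integrable M g"
  shows "(\<integral>x. cnj (f x) * g x \<partial>M) =
     complex_of_real (((\<integral>x. (cmod (f x + g x))\<^sup>2 \<partial>M) - (\<integral>x. (cmod (f x - g x))\<^sup>2 \<partial>M)) / 4) -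
     \<i> * complex_of_real (((\<integral>x. (cmod (f x + \<i> * g x))\<^sup>2 \<partial>M) - (\<integral>x. (cmod (f x - \<i> * g x))\<^sup>2 \<partial>M)) / 4)"
proof -
  note gi = square_integrable_cmult[OF assms(2), of \<i>]
  note I = square_integrable_add[OF assms, THEN square_integrable_norm_sq]
    square_integrable_diff[OF assms, THEN square_integrable_norm_sq]
    square_integrable_add[OF assms(1) gi, THEN square_integrable_norm_sq]
    square_integrable_diff[OF assms(1) gi, THEN square_integrable_norm_sq]
  show ?thesis
    unfolding cmod_polarization[of "f _" "g _"] using I
    by (subst Bochner_Integration.integral_diff) (auto simp del: of_real_divide of_real_diff)
qed

text \<open>
  Polarization expresses an inner product by four norms, so it is enough to control norms.
\<close>

lemma isometry_preserves_inner:
  assumes f: "square_integrable M f" and g: "square_integrable M g"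
    and T: "\<And>h. square_integrable M h \<Longrightarrow> square_integrable N (T h)"
    and add: "\<And>h k. square_integrable M h \<Longrightarrow> square_integrable M k \<Longrightarrow>
        T (\<lambda>x. h x + k x) = (\<lambda>y. T h y + T k y)"
    and scale: "\<And>c h. square_integrable M h \<Longrightarrow> T (\<lambda>x. c * h x) = (\<lambda>y. c * T h y)"
    and norm: "\<And>h. square_integrable M h \<Longrightarrow>
        (\<integral>y. (cmod (T h y))\<^sup>2 \<partial>N) = (\<integral>x. (cmod (h x))\<^sup>2 \<partial>M)"
  shows "(\<integral>y. cnj (T f y) * T g y \<partial>N) = (\<integral>x. cnj (f x) * g x \<partial>M)"
proof -
  have *: "(\<integral>y. (cmod (T f y + c * T g y))\<^sup>2 \<partial>N) = (\<integral>x. (cmod (f x + c * g x))\<^sup>2 \<partial>M)" for c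
    using norm[OF square_integrable_add[OF f square_integrable_cmult[OF g, of c]]]
    by (simp add: add scale f g square_integrable_cmult)
  show ?thesis
    using *[of 1] *[of "-1"] *[of \<i>] *[of "-\<i>"]
    by (simp add: integral_polarization f g T)
qed

section \<open>Sums over a countable set as integrals\<close>

lemma infsum_eq_integral_complex:
  fixes f :: "'a \<Rightarrow> complex"
  shows "(\<Sum>\<^sub>\<infinity>x\<in>X. f x) = (\<integral>x. f x \<partial>count_space X)"
proof (cases "f summable_on X")
  case True
  then have "Infinite_Sum.abs_summable_on f X"
    by (simp add: summable_on_iff_abs_summable_on_complex)
  then show ?thesis
    using infsetsum_infsum[of f X] by (simp add: abs_summable_equivalent infsetsum_def)
next
  case False
  then have "\<not> integrable (count_space X) f"
    by (simp add: summable_on_iff_abs_summable_on_complex abs_summable_equivalent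
        abs_summable_on_def)
  then show ?thesis using False by (simp add: infsum_not_exists not_integrable_integral_eq)
qed

lemma summable_on_iff_integrable_real:
  fixes f :: "'a \<Rightarrow> real"
  shows "f summable_on X \<longleftrightarrow> integrable (count_space X) f"
  unfolding abs_summable_on_def[symmetric] abs_summable_equivalent[symmetric]
  by (rule summable_on_iff_abs_summable_on_real)

lemma infsum_eq_integral_real:
  fixes f :: "'a \<Rightarrow> real"
  shows "(\<Sum>\<^sub>\<infinity>x\<in>X. f x) = (\<integral>x. f x \<partial>count_space X)"
proof (cases "f summable_on X")
  case True
  then have "Infinite_Sum.abs_summable_on f X"
    by (rule summable_on_iff_abs_summable_on_real[THEN iffD1])
  then show ?thesis
    using infsetsum_infsum[of f X] by (simp add: abs_summable_equivalent[symmetric] infsetsum_def)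
next
  case False
  then show ?thesis
    by (simp add: summable_on_iff_integrable_real infsum_not_exists not_integrable_integral_eq)
qed

lemma ell2_iff:
  "u \<in> ell2 X \<longleftrightarrow> (\<forall>x. x \<notin> X \<longrightarrow> u x = 0) \<and> square_integrable (count_space X) u"
  by (simp add: ell2_def square_integrable_def summable_on_iff_integrable_real)

lemma ell2D: "u \<in> ell2 X \<Longrightarrow> square_integrable (count_space X) u"
  by (simp add: ell2_iff)

lemma ell2_inner_eq_integral:
  "ell2_inner X u w = (\<integral>x. cnj (u x) * w x \<partial>count_space X)"
  by (simp add: ell2_inner_def infsum_eq_integral_complex)

lemma ell2_norm_sq: "(ell2_norm X u)\<^sup>2 = (\<integral>x. (cmod (u x))\<^sup>2 \<partial>count_space X)"
  by (simp add: ell2_norm_def infsum_eq_integral_real)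

lemma ell2_norm_nonneg: "0 \<le> ell2_norm X u"
  by (simp add: ell2_norm_def infsum_nonneg)

lemma ell2_inner_self: "ell2_inner X u u = complex_of_real ((ell2_norm X u)\<^sup>2)"
  unfolding ell2_norm_sq ell2_inner_eq_integral cmod_sq_eq[symmetric] by (simp del: of_real_power)

lemma ell2_add: "u \<in> ell2 X \<Longrightarrow> w \<in> ell2 X \<Longrightarrow> (\<lambda>x. u x + w x) \<in> ell2 X"
  by (simp add: ell2_iff square_integrable_add)

lemma ell2_cmult: "u \<in> ell2 X \<Longrightarrow> (\<lambda>x. c * u x) \<in> ell2 X"
  by (simp add: ell2_iff square_integrable_cmult)

lemma ell2_inner_add_right:
  "u \<in> ell2 X \<Longrightarrow> w \<in> ell2 X \<Longrightarrow> z \<in> ell2 X \<Longrightarrow>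
   ell2_inner X u (\<lambda>x. w x + z x) = ell2_inner X u w + ell2_inner X u z"
  unfolding ell2_inner_eq_integral
  by (simp add: distrib_left Bochner_Integration.integral_add square_integrable_inner ell2D)

lemma ell2_inner_add_left:
  "u \<in> ell2 X \<Longrightarrow> w \<in> ell2 X \<Longrightarrow> z \<in> ell2 X \<Longrightarrow>
   ell2_inner X (\<lambda>x. u x + w x) z = ell2_inner X u z + ell2_inner X w z"
  unfolding ell2_inner_eq_integral
  by (simp add: distrib_right Bochner_Integration.integral_add square_integrable_inner ell2D)

lemma ell2_inner_cmult_right: "ell2_inner X u (\<lambda>x. c * w x) = c * ell2_inner X u w"
  by (simp add: ell2_inner_eq_integral mult.left_commute)

lemma ell2_inner_cmult_left: "ell2_inner X (\<lambda>x. c * u x) w = cnj c * ell2_inner X u w"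
  by (simp add: ell2_inner_eq_integral mult.assoc)

lemma ell2_inner_commute: "ell2_inner X w u = cnj (ell2_inner X u w)"
  unfolding ell2_inner_eq_integral Bochner_Integration.integral_cnj[symmetric]
  by (simp add: mult.commute)

lemma delta_ell2: "x \<in> X \<Longrightarrow> delta x \<in> ell2 X"
proof -
  assume "x \<in> X"
  have "(\<lambda>y. (cmod (delta x y))\<^sup>2) summable_on X \<longleftrightarrow> (\<lambda>y. (cmod (delta x y))\<^sup>2) summable_on {x}"
    by (rule summable_on_cong_neutral) (use \<open>x \<in> X\<close> in \<open>auto simp: delta_def\<close>)
  then show ?thesis using \<open>x \<in> X\<close> by (simp add: ell2_def) (auto simp: delta_def)
qed

lemma ell2_inner_delta_left:
  assumes "x \<in> X" shows "ell2_inner X (delta x) u = u x"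
proof -
  have "ell2_inner X (delta x) u = (\<Sum>\<^sub>\<infinity>y\<in>{x}. u y)"
    unfolding ell2_inner_def
    by (rule infsum_cong_neutral) (use assms in \<open>auto simp: delta_def\<close>)
  then show ?thesis by simp
qed

lemma ell2_pointwise_bound:
  assumes "u \<in> ell2 X" shows "cmod (u x) \<le> ell2_norm X u"
proof (cases "x \<in> X")
  case True
  have "(cmod (u x))\<^sup>2 = (\<Sum>\<^sub>\<infinity>y\<in>{x}. (cmod (u y))\<^sup>2)" by simp
  also have "\<dots> \<le> (\<Sum>\<^sub>\<infinity>y\<in>X. (cmod (u y))\<^sup>2)"
    by (rule infsum_mono_neutral) (use assms True in \<open>auto simp: ell2_def\<close>)
  finally have "sqrt ((cmod (u x))\<^sup>2) \<le> ell2_norm X u"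
    unfolding ell2_norm_def by (rule real_sqrt_le_mono)
  then show ?thesis by simp
qed (use assms in \<open>auto simp: ell2_iff ell2_norm_nonneg\<close>)

lemma ell2_norm_eq_0:
  assumes "u \<in> ell2 X" "ell2_norm X u = 0" shows "u = (\<lambda>_. 0)"
  using ell2_pointwise_bound[OF assms(1)] assms(2) by auto

section \<open>Characters of a discrete group\<close>

lemma dual_iff:
  "\<omega> \<in> pontryagin_dual G \<longleftrightarrow> \<omega> \<in> extensional (carrier G) \<and>
     (\<forall>x\<in>carrier G. cmod (\<omega> x) = 1) \<and>
     (\<forall>x\<in>carrier G. \<forall>y\<in>carrier G. \<omega> (x \<otimes>\<^bsub>G\<^esub> y) = \<omega> x * \<omega> y)"
  by (auto simp: pontryagin_dual_def hom_def circle_group_def Pi_iff)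

lemma dual_norm: "\<omega> \<in> pontryagin_dual G \<Longrightarrow> x \<in> carrier G \<Longrightarrow> cmod (\<omega> x) = 1"
  by (simp add: dual_iff)

lemma dual_mult:
  "\<omega> \<in> pontryagin_dual G \<Longrightarrow> x \<in> carrier G \<Longrightarrow> y \<in> carrier G \<Longrightarrow>
   \<omega> (x \<otimes>\<^bsub>G\<^esub> y) = \<omega> x * \<omega> y"
  by (simp add: dual_iff)

lemma (in group) dual_one:
  assumes "\<omega> \<in> pontryagin_dual G" shows "\<omega> \<one> = 1"
proof -
  have "\<omega> \<one> * \<omega> \<one> = \<omega> \<one>" using dual_mult[OF assms, of \<one> \<one>] by simp
  moreover have "\<omega> \<one> \<noteq> 0" using dual_norm[OF assms, of \<one>] by auto
  ultimately show ?thesis by simp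
qed

lemma (in group) dual_inv:
  assumes "\<omega> \<in> pontryagin_dual G" "x \<in> carrier G" shows "\<omega> (inv x) = cnj (\<omega> x)"
proof -
  have "\<omega> (inv x) * \<omega> x = 1"
    using dual_mult[OF assms(1), of "inv x" x] assms(2) by (simp add: dual_one[OF assms(1)])
  moreover have "cnj (\<omega> x) * \<omega> x = 1"
    using dual_norm[OF assms] cmod_sq_eq[of "\<omega> x"] by simp
  ultimately show ?thesis
    using dual_norm[OF assms] by (metis mult_cancel_right zero_neq_one norm_zero)
qed

lemma dual_translate:
  assumes "\<omega> \<in> pontryagin_dual G" "\<xi> \<in> pontryagin_dual G" "group G"
  shows "(\<lambda>x\<in>carrier G. \<xi> x * \<omega> x) \<in> pontryagin_dual G"
  using assms by (auto simp: dual_iff norm_mult group.is_monoid monoid.m_closed)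

definition char_space :: "('a, 'b) monoid_scheme \<Rightarrow> ('a \<Rightarrow> complex) measure" where
  "char_space G = sigma (pontryagin_dual G)
     {{\<omega> \<in> pontryagin_dual G. \<omega> x \<in> C} | x C. x \<in> carrier G \<and> closed C}"

lemma space_char_space [simp]: "space (char_space G) = pontryagin_dual G"
  by (simp add: char_space_def space_measure_of_conv)

lemma sets_char_space:
  "sets (char_space G) = sigma_sets (pontryagin_dual G)
     {{\<omega> \<in> pontryagin_dual G. \<omega> x \<in> C} | x C. x \<in> carrier G \<and> closed C}"
  unfolding char_space_def by (rule sets_measure_of) auto

lemma measurable_char_space_eval [measurable]:
  assumes "x \<in> carrier G" shows "(\<lambda>\<omega>. \<omega> x) \<in> borel_measurable (char_space G)"
proof (rule borel_measurableI)
  fix U :: "complex set" assume "open U"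
  then have "{\<omega> \<in> pontryagin_dual G. \<omega> x \<in> - U} \<in> sets (char_space G)"
    using assms unfolding sets_char_space by (intro sigma_sets.Basic) blast
  then have "space (char_space G) - {\<omega> \<in> pontryagin_dual G. \<omega> x \<in> - U} \<in> sets (char_space G)"
    by (rule sets.compl_sets)
  also have "space (char_space G) - {\<omega> \<in> pontryagin_dual G. \<omega> x \<in> - U} =
      (\<lambda>\<omega>. \<omega> x) -` U \<inter> space (char_space G)" by auto
  finally show "(\<lambda>\<omega>. \<omega> x) -` U \<inter> space (char_space G) \<in> sets (char_space G)" .
qed

lemma measurable_char_spaceI:
  assumes "\<And>w. w \<in> space M \<Longrightarrow> f w \<in> pontryagin_dual G"
    and "\<And>x. x \<in> carrier G \<Longrightarrow> (\<lambda>w. f w x) \<in> borel_measurable M"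
  shows "f \<in> measurable M (char_space G)"
  unfolding char_space_def
proof (rule measurable_measure_of)
  show "f \<in> space M \<rightarrow> pontryagin_dual G" using assms(1) by auto
  fix A assume "A \<in> {{\<omega> \<in> pontryagin_dual G. \<omega> x \<in> C} | x C. x \<in> carrier G \<and> closed C}"
  then obtain x C where A: "A = {\<omega> \<in> pontryagin_dual G. \<omega> x \<in> C}" "x \<in> carrier G" "closed C"
    by auto
  have "f -` A \<inter> space M = (\<lambda>w. f w x) -` C \<inter> space M" using A assms(1) by auto
  also have "\<dots> \<in> sets M" by (rule measurable_sets[OF assms(2)]) (use A in auto)
  finally show "f -` A \<inter> space M \<in> sets M" .
qed auto

text \<open>
  On a countable group the evaluations generate the Borel sets of the dual: every open set is the
  union of those finite intersections of evaluation preimages of basic open sets that it contains,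
  and there are only countably many such intersections.
\<close>

lemma sets_char_space_eq_borel:
  assumes "countable (carrier G)"
  shows "sets (char_space G) =
    sigma_sets (pontryagin_dual G) {U. openin (dual_topology G) U}"
proof (rule antisym)
  let ?D = "pontryagin_dual G" and ?I = "carrier G"
  let ?T = "product_topology (\<lambda>_. euclidean :: complex topology) ?I"
  have sub: "?D \<subseteq> topspace ?T" by (auto simp: dual_iff PiE_def)
  have eval: "openin (dual_topology G) {\<omega> \<in> ?D. \<omega> x \<in> U}" if "x \<in> ?I" "open U" for x and U :: "complex set"
  proof -
    have "openin ?T {\<omega> \<in> topspace ?T. \<omega> x \<in> U}"
      using that by (intro openin_continuous_map_preimage[OF continuous_map_product_projection]) auto
    then have "openin (dual_topology G) ({\<omega> \<in> topspace ?T. \<omega> x \<in> U} \<inter> ?D)"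
      unfolding dual_topology_def by (rule openin_subtopology_Int)
    also have "{\<omega> \<in> topspace ?T. \<omega> x \<in> U} \<inter> ?D = {\<omega> \<in> ?D. \<omega> x \<in> U}" using sub by blast
    finally show ?thesis .
  qed
  show "sets (char_space G) \<subseteq> sigma_sets ?D {U. openin (dual_topology G) U}"
    unfolding sets_char_space
  proof (rule sigma_sets_mono, clarify)
    fix x and C :: "complex set" assume x: "x \<in> ?I" "closed C"
    then have "?D - {\<omega> \<in> ?D. \<omega> x \<in> - C} \<in> sigma_sets ?D {U. openin (dual_topology G) U}"
      by (intro sigma_sets.Compl sigma_sets.Basic CollectI eval) auto
    also have "?D - {\<omega> \<in> ?D. \<omega> x \<in> - C} = {\<omega> \<in> ?D. \<omega> x \<in> C}" by auto
    finally show "{\<omega> \<in> ?D. \<omega> x \<in> C} \<in> sigma_sets ?D {U. openin (dual_topology G) U}" .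
  qed
  obtain B :: "complex set set" where B: "countable B" "topological_basis B"
    using ex_countable_basis by blast
  define box where "box F = {\<omega> \<in> ?D. \<forall>(x, V)\<in>F. \<omega> x \<in> V}" for F :: "('a \<times> complex set) set"
  have box_sets: "box F \<in> sets (char_space G)" if "finite F" "F \<subseteq> ?I \<times> B" for F
  proof -
    have "{\<omega> \<in> space (char_space G). \<forall>p\<in>F. \<omega> (fst p) \<in> snd p} \<in> sets (char_space G)"
    proof (rule sets.sets_Collect_finite_All[OF _ that(1)])
      fix p assume "p \<in> F"
      with that(2) B have [measurable]: "fst p \<in> ?I" "snd p \<in> sets borel"
        using topological_basis_open[OF B(2)] by auto
      show "{\<omega> \<in> space (char_space G). \<omega> (fst p) \<in> snd p} \<in> sets (char_space G)"
        by measurable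
    qed
    also have "{\<omega> \<in> space (char_space G). \<forall>p\<in>F. \<omega> (fst p) \<in> snd p} = box F"
      by (auto simp: box_def)
    finally show ?thesis .
  qed
  have "U \<in> sets (char_space G)" if U: "openin (dual_topology G) U" for U
  proof -
    obtain W where W: "openin ?T W" "U = W \<inter> ?D"
      using U unfolding dual_topology_def openin_subtopology by auto
    let ?\<F> = "{F \<in> {F. finite F \<and> F \<subseteq> ?I \<times> B}. box F \<subseteq> U}"
    have "U = (\<Union>F\<in>?\<F>. box F)"
    proof (intro subset_antisym subsetI)
      fix \<omega> assume \<omega>: "\<omega> \<in> U"
      then obtain V where V: "finite {x \<in> ?I. V x \<noteq> (UNIV :: complex set)}"
          "\<And>x. x \<in> ?I \<Longrightarrow> open (V x)" "\<omega> \<in> Pi\<^sub>E ?I V" "Pi\<^sub>E ?I V \<subseteq> W"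
        using W(1)[unfolded openin_product_topology_alt, THEN bspec, of \<omega>] W(2) \<omega> by auto
      have "\<exists>b\<in>B. \<omega> x \<in> b \<and> b \<subseteq> V x" if "x \<in> ?I" for x
      proof -
        have "\<omega> x \<in> V x" using V(3) that by (auto simp: PiE_iff)
        then show ?thesis using topological_basisE[OF B(2) V(2)[OF that]] by metis
      qed
      then obtain b where b: "\<And>x. x \<in> ?I \<Longrightarrow> b x \<in> B \<and> \<omega> x \<in> b x \<and> b x \<subseteq> V x" by metis
      let ?F = "(\<lambda>x. (x, b x)) ` {x \<in> ?I. V x \<noteq> UNIV}"
      have "box ?F \<subseteq> U"
      proof
        fix \<xi> assume \<xi>: "\<xi> \<in> box ?F"
        have "\<xi> x \<in> V x" if "x \<in> ?I" for x
          using \<xi> b[OF that] that by (cases "V x = UNIV") (auto simp: box_def)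
        then have "\<xi> \<in> Pi\<^sub>E ?I V" using \<xi> by (auto simp: box_def dual_iff PiE_def)
        then show "\<xi> \<in> U" using V(4) W(2) \<xi> by (auto simp: box_def)
      qed
      moreover have "\<omega> \<in> ?D" "\<And>x. x \<in> ?I \<Longrightarrow> \<omega> x \<in> b x" "\<And>x. x \<in> ?I \<Longrightarrow> b x \<in> B"
        using b \<omega> W(2) by blast+
      then have "\<omega> \<in> box ?F" "finite ?F" "?F \<subseteq> ?I \<times> B" using V(1) by (auto simp: box_def)
      ultimately show "\<omega> \<in> (\<Union>F\<in>?\<F>. box F)" by blast
    qed auto
    moreover have "countable ?\<F>"
    proof (rule countable_subset)
      show "countable {F. finite F \<and> F \<subseteq> ?I \<times> B}"
        using assms B(1) by (intro countable_Collect_finite_subset) auto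
    qed auto
    moreover have "(\<Union>F\<in>?\<F>. box F) \<in> sets (char_space G)"
      using \<open>countable ?\<F>\<close> by (rule sets.countable_UN') (use box_sets in auto)
    ultimately show ?thesis by simp
  qed
  then show "sigma_sets ?D {U. openin (dual_topology G) U} \<subseteq> sets (char_space G)"
    using sets.sigma_sets_subset[of "{U. openin (dual_topology G) U}" "char_space G"] by auto
qed

section \<open>Trigonometric polynomials determine measures on the dual\<close>

text \<open>
  A class of bounded functions on the dual that is closed under linear combinations, multiplication
  by evaluations and bounded pointwise limits is closed under multiplication by indicators of
  measurable sets.  By the Weierstrass theorem it is closed under multiplication by continuous
  functions of one evaluation, hence by the indicators of the generating sets; complements,
  intersections and countable unions lead to all measurable sets.
\<close>

locale trigonometric_class = group G for G (structure) +
  fixes \<Phi> :: "(('a \<Rightarrow> complex) \<Rightarrow> complex) \<Rightarrow> bool"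
  assumes sum_closed: "\<Phi> p \<Longrightarrow> \<Phi> q \<Longrightarrow> \<Phi> (\<lambda>\<omega>. p \<omega> + q \<omega>)"
    and scale_closed: "\<Phi> p \<Longrightarrow> \<Phi> (\<lambda>\<omega>. c * p \<omega>)"
    and eval_closed: "\<Phi> p \<Longrightarrow> x \<in> carrier G \<Longrightarrow> \<Phi> (\<lambda>\<omega>. p \<omega> * \<omega> x)"
    and bounded: "\<Phi> p \<Longrightarrow> \<exists>B. \<forall>\<omega>\<in>pontryagin_dual G. cmod (p \<omega>) \<le> B"
    and limit_closed: "(\<And>n :: nat. \<Phi> (r n)) \<Longrightarrow> (\<And>n \<omega>. \<omega> \<in> pontryagin_dual G \<Longrightarrow> cmod (r n \<omega>) \<le> B) \<Longrightarrow>
        (\<And>\<omega>. \<omega> \<in> pontryagin_dual G \<Longrightarrow> (\<lambda>n. r n \<omega>) \<longlonglongrightarrow> q \<omega>) \<Longrightarrow> \<Phi> q"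
begin

lemma cong:
  assumes "\<Phi> p" "\<And>\<omega>. \<omega> \<in> pontryagin_dual G \<Longrightarrow> p \<omega> = q \<omega>"
  shows "\<Phi> q"
proof -
  obtain B where "\<forall>\<omega>\<in>pontryagin_dual G. cmod (p \<omega>) \<le> B" using bounded[OF assms(1)] by auto
  then show ?thesis using assms by - (rule limit_closed[where r = "\<lambda>_. p" and B = B], auto)
qed

lemma bounded_limit:
  assumes p: "\<Phi> p" and "\<And>n :: nat. \<Phi> (\<lambda>\<omega>. p \<omega> * f n \<omega>)"
    and "\<And>n \<omega>. \<omega> \<in> pontryagin_dual G \<Longrightarrow> cmod (f n \<omega>) \<le> C"
    and "\<And>\<omega>. \<omega> \<in> pontryagin_dual G \<Longrightarrow> (\<lambda>n. f n \<omega>) \<longlonglongrightarrow> g \<omega>"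
  shows "\<Phi> (\<lambda>\<omega>. p \<omega> * g \<omega>)"
proof -
  obtain B where B: "\<And>\<omega>. \<omega> \<in> pontryagin_dual G \<Longrightarrow> cmod (p \<omega>) \<le> B"
    using bounded[OF p] by auto
  show ?thesis
  proof (rule limit_closed[where r = "\<lambda>n \<omega>. p \<omega> * f n \<omega>" and B = "B * C"])
    show "cmod (p \<omega> * f n \<omega>) \<le> B * C" if "\<omega> \<in> pontryagin_dual G" for n \<omega>
      unfolding norm_mult using B[OF that] assms(3)[OF that]
      by (intro mult_mono) (auto intro: order_trans[OF norm_ge_zero])
  qed (use assms(2,4) in \<open>auto intro: tendsto_mult_left\<close>)
qed

lemma times_polynomial:
  assumes "real_polynomial_function f" "x \<in> carrier G" "\<Phi> p"
  shows "\<Phi> (\<lambda>\<omega>. p \<omega> * complex_of_real (f (\<omega> x)))"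
  using assms(1,3)
proof (induction f arbitrary: p rule: real_polynomial_function.induct)
  case (linear f)
  then have lin: "linear f" by (simp add: bounded_linear.linear)
  define a where "a = complex_of_real (f 1) / 2 - \<i> * complex_of_real (f \<i>) / 2"
  have f: "complex_of_real (f z) = a * z + cnj a * cnj z" for z
  proof -
    have "f z = f (Re z *\<^sub>R 1 + Im z *\<^sub>R \<i>)"
      by (rule arg_cong[of _ _ f]) (simp add: complex_eq_iff)
    also have "\<dots> = Re z * f 1 + Im z * f \<i>" by (simp add: linear_add[OF lin] linear_scale[OF lin])
    finally show ?thesis by (simp add: a_def complex_eq_iff)
  qed
  have "\<Phi> (\<lambda>\<omega>. a * (p \<omega> * \<omega> x) + cnj a * (p \<omega> * \<omega> (inv x)))"
    using linear.prems assms(2) by (intro sum_closed scale_closed eval_closed) auto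
  then show ?case
    by (rule cong) (use assms(2) in \<open>auto simp: f dual_inv algebra_simps\<close>)
next
  case (const c)
  then show ?case using scale_closed[of p "complex_of_real c"] by (simp add: mult.commute)
next
  case (add f g)
  then show ?case using sum_closed[OF add.IH(1)[of p] add.IH(2)[of p]] by (simp add: algebra_simps)
next
  case (mult f g)
  then show ?case using mult.IH(2)[OF mult.IH(1)[of p]] by (simp add: algebra_simps)
qed

lemma times_continuous:
  fixes f :: "complex \<Rightarrow> real"
  assumes "continuous_on UNIV f" "x \<in> carrier G" "\<Phi> p"
  shows "\<Phi> (\<lambda>\<omega>. p \<omega> * complex_of_real (f (\<omega> x)))"
proof -
  have "\<exists>q. real_polynomial_function q \<and> (\<forall>z\<in>cball 0 1. \<bar>f z - q z\<bar> < inverse (real (Suc n)))" for n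
    by (rule Stone_Weierstrass_real_polynomial_function[of "cball 0 1" f "inverse (real (Suc n))"])
      (auto intro: continuous_on_subset[OF assms(1)])
  then obtain q where q: "\<And>n. real_polynomial_function (q n)"
      "\<And>n z. z \<in> cball 0 1 \<Longrightarrow> \<bar>f z - q n z\<bar> < inverse (real (Suc n))" by metis
  have "compact (f ` cball 0 1)"
    by (intro compact_continuous_image continuous_on_subset[OF assms(1)]) auto
  then obtain C where C: "\<And>z. z \<in> cball 0 1 \<Longrightarrow> \<bar>f z\<bar> \<le> C"
    using compact_imp_bounded bounded_iff by (metis imageI real_norm_def)
  have unit: "\<omega> x \<in> cball 0 1" if "\<omega> \<in> pontryagin_dual G" for \<omega>
    using dual_norm[OF that assms(2)] by simp
  show ?thesis
  proof (rule bounded_limit[OF assms(3) times_polynomial[OF q(1) assms(2,3)], where C = "C + 1"])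
    show "cmod (complex_of_real (q n (\<omega> x))) \<le> C + 1" if "\<omega> \<in> pontryagin_dual G" for n \<omega>
    proof -
      have "inverse (real (Suc n)) \<le> 1" by (simp add: inverse_le_1_iff)
      then show ?thesis using q(2)[OF unit[OF that], of n] C[OF unit[OF that]] by simp
    qed
    show "(\<lambda>n. complex_of_real (q n (\<omega> x))) \<longlonglongrightarrow> complex_of_real (f (\<omega> x))"
      if "\<omega> \<in> pontryagin_dual G" for \<omega>
    proof (rule tendsto_of_real, rule LIM_zero_cancel, rule Lim_null_comparison)
      show "\<forall>\<^sub>F n in sequentially. norm (q n (\<omega> x) - f (\<omega> x)) \<le> inverse (real (Suc n))"
        using q(2)[OF unit[OF that]] by (intro always_eventually) (auto simp: abs_minus_commute less_imp_le)
      show "(\<lambda>n. inverse (real (Suc n))) \<longlonglongrightarrow> 0" by (rule LIMSEQ_inverse_real_of_nat)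
    qed
  qed
qed

lemma times_closed:
  assumes "closed C" "x \<in> carrier G" "\<Phi> p"
  shows "\<Phi> (\<lambda>\<omega>. p \<omega> * indicator {\<omega> \<in> pontryagin_dual G. \<omega> x \<in> C} \<omega>)"
proof (cases "C = {}")
  case True
  then show ?thesis using scale_closed[OF assms(3), of 0] by simp
next
  case False
  let ?f = "\<lambda>n z. max 0 (1 - real n * infdist z C)"
  have lim: "(\<lambda>n. ?f n z) \<longlonglongrightarrow> indicator C z" for z
  proof (cases "z \<in> C")
    case True then show ?thesis by simp
  next
    case z: False
    then have d: "infdist z C > 0"
      using assms(1) False by (metis in_closed_iff_infdist_zero infdist_nonneg less_eq_real_def)
    obtain N where N: "1 / infdist z C < real N" using reals_Archimedean2 by blast
    have "?f n z = 0" if "n \<ge> N" for n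
    proof -
      have "1 < real N * infdist z C" using N d by (simp add: field_simps)
      also have "\<dots> \<le> real n * infdist z C" using that d by simp
      finally show ?thesis by simp
    qed
    then show ?thesis using z by (intro tendsto_eventually) (auto simp: eventually_sequentially)
  qed
  show ?thesis
  proof (rule bounded_limit[OF assms(3), where f = "\<lambda>n \<omega>. complex_of_real (?f n (\<omega> x))" and C = 1])
    show "\<Phi> (\<lambda>\<omega>. p \<omega> * complex_of_real (?f n (\<omega> x)))" for n
      by (rule times_continuous[OF _ assms(2,3), of "?f n"]) (intro continuous_intros)
    show "(\<lambda>n. complex_of_real (?f n (\<omega> x))) \<longlonglongrightarrow> indicator {\<omega> \<in> pontryagin_dual G. \<omega> x \<in> C} \<omega>"
      if "\<omega> \<in> pontryagin_dual G" for \<omega>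
    proof -
      have "indicator {\<omega> \<in> pontryagin_dual G. \<omega> x \<in> C} \<omega> = complex_of_real (indicator C (\<omega> x))"
        using that by (simp add: indicator_def)
      then show ?thesis using tendsto_of_real[OF lim[of "\<omega> x"]] by simp
    qed
  qed (auto simp: infdist_nonneg)
qed

lemma times_indicator:
  assumes "A \<in> sets (char_space G)" "\<Phi> p"
  shows "\<Phi> (\<lambda>\<omega>. p \<omega> * indicator A \<omega>)"
  using assms unfolding sets_char_space
proof (induction A arbitrary: p rule: sigma_sets.induct)
  case (Basic a)
  then show ?case using times_closed by auto
next
  case Empty
  then show ?case using scale_closed[of p 0] by simp
next
  case (Compl a)
  have "\<Phi> (\<lambda>\<omega>. p \<omega> + (-1) * (p \<omega> * indicator a \<omega>))"
    using Compl by (intro sum_closed scale_closed) auto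
  then show ?case by (rule cong) (auto simp: indicator_def)
next
  case (Union a)
  let ?f = "\<lambda>n \<omega>. indicator (\<Union>i<n. a i) \<omega> :: complex"
  have fin: "\<Phi> (\<lambda>\<omega>. p \<omega> * ?f n \<omega>)" for n
  proof (induction n)
    case 0
    then show ?case using scale_closed[of p 0] Union.prems by simp
  next
    case (Suc n)
    have "\<Phi> (\<lambda>\<omega>. (p \<omega> * ?f n \<omega> + p \<omega> * indicator (a n) \<omega>) + (-1) * (p \<omega> * ?f n \<omega> * indicator (a n) \<omega>))"
      by (intro sum_closed scale_closed Union.IH Suc Union.prems)
    then show ?case by (rule cong) (auto simp: indicator_def less_Suc_eq)
  qed
  show ?case
  proof (rule bounded_limit[OF Union.prems fin, where C = 1])
    show "(\<lambda>n. ?f n \<omega>) \<longlonglongrightarrow> indicator (\<Union>i. a i) \<omega>" for \<omega>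
    proof (cases "\<exists>i. \<omega> \<in> a i")
      case True
      then obtain i where "\<omega> \<in> a i" by auto
      then have "?f n \<omega> = 1" if "n > i" for n using that by (auto simp: indicator_def)
      then show ?thesis using True
        by (intro tendsto_eventually) (auto simp: eventually_sequentially indicator_def intro!: exI[of _ "Suc i"])
    qed (auto simp: indicator_def)
  qed (auto simp: indicator_def)
qed

end

definition bounded_measurable :: "('a, 'b) monoid_scheme \<Rightarrow> (('a \<Rightarrow> complex) \<Rightarrow> complex) set" where
  "bounded_measurable G = {p \<in> borel_measurable (char_space G).
     \<exists>B. \<forall>\<omega>\<in>pontryagin_dual G. cmod (p \<omega>) \<le> B}"

text \<open>
  The common form of the two uniqueness statements below: a linear functional that obeys bounded
  convergence and kills all characters kills all indicators.
\<close>

locale dual_functional = group G for G (structure) +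
  fixes I :: "(('a \<Rightarrow> complex) \<Rightarrow> complex) \<Rightarrow> complex"
  assumes I_add: "p \<in> bounded_measurable G \<Longrightarrow> q \<in> bounded_measurable G \<Longrightarrow>
        I (\<lambda>\<omega>. p \<omega> + q \<omega>) = I p + I q"
    and I_scale: "p \<in> bounded_measurable G \<Longrightarrow> I (\<lambda>\<omega>. c * p \<omega>) = c * I p"
    and I_limit: "(\<And>n :: nat. r n \<in> bounded_measurable G) \<Longrightarrow> q \<in> bounded_measurable G \<Longrightarrow>
        (\<And>n \<omega>. \<omega> \<in> pontryagin_dual G \<Longrightarrow> cmod (r n \<omega>) \<le> B) \<Longrightarrow>
        (\<And>\<omega>. \<omega> \<in> pontryagin_dual G \<Longrightarrow> (\<lambda>n. r n \<omega>) \<longlonglongrightarrow> q \<omega>) \<Longrightarrow>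
        (\<lambda>n. I (r n)) \<longlonglongrightarrow> I q"
    and I_character: "x \<in> carrier G \<Longrightarrow> I (\<lambda>\<omega>. \<omega> x) = 0"
begin

lemma I_cong:
  assumes "p \<in> bounded_measurable G" "q \<in> bounded_measurable G"
    and "\<And>\<omega>. \<omega> \<in> pontryagin_dual G \<Longrightarrow> p \<omega> = q \<omega>"
  shows "I p = I q"
proof -
  obtain B where "\<forall>\<omega>\<in>pontryagin_dual G. cmod (p \<omega>) \<le> B"
    using assms(1) by (auto simp: bounded_measurable_def)
  then have "(\<lambda>_ :: nat. I p) \<longlonglongrightarrow> I q" using assms by (intro I_limit[where r = "\<lambda>_. p" and B = B]) auto
  then show ?thesis by (simp add: tendsto_const_iff)
qed

lemma bounded_measurable_add:
  assumes "p \<in> bounded_measurable G" "q \<in> bounded_measurable G"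
  shows "(\<lambda>\<omega>. p \<omega> + q \<omega>) \<in> bounded_measurable G"
proof -
  obtain B C where "\<forall>\<omega>\<in>pontryagin_dual G. cmod (p \<omega>) \<le> B" "\<forall>\<omega>\<in>pontryagin_dual G. cmod (q \<omega>) \<le> C"
    using assms by (auto simp: bounded_measurable_def)
  then have "\<forall>\<omega>\<in>pontryagin_dual G. cmod (p \<omega> + q \<omega>) \<le> B + C"
    by (meson add_mono norm_triangle_le)
  then show ?thesis using assms by (auto simp: bounded_measurable_def)
qed

lemma bounded_measurable_scale:
  assumes "p \<in> bounded_measurable G" shows "(\<lambda>\<omega>. c * p \<omega>) \<in> bounded_measurable G"
proof -
  obtain B where "\<forall>\<omega>\<in>pontryagin_dual G. cmod (p \<omega>) \<le> B"
    using assms by (auto simp: bounded_measurable_def)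
  then have "\<forall>\<omega>\<in>pontryagin_dual G. cmod (c * p \<omega>) \<le> cmod c * B"
    by (simp add: norm_mult mult_left_mono)
  then show ?thesis using assms by (auto simp: bounded_measurable_def)
qed

lemma bounded_measurable_eval:
  assumes "p \<in> bounded_measurable G" and x: "x \<in> carrier G"
  shows "(\<lambda>\<omega>. p \<omega> * \<omega> x) \<in> bounded_measurable G"
proof -
  note [measurable] = x
  obtain B where "\<forall>\<omega>\<in>pontryagin_dual G. cmod (p \<omega>) \<le> B"
    using assms by (auto simp: bounded_measurable_def)
  then have "\<forall>\<omega>\<in>pontryagin_dual G. cmod (p \<omega> * \<omega> x) \<le> B"
    using x by (simp add: norm_mult dual_norm)
  then show ?thesis using assms by (auto simp: bounded_measurable_def)
qed

sublocale trigonometric_class G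
  "\<lambda>p. p \<in> bounded_measurable G \<and> (\<forall>x\<in>carrier G. I (\<lambda>\<omega>. p \<omega> * \<omega> x) = 0)"
proof (standard, goal_cases)
  case (1 p q)
  then show ?case
    by (auto simp: distrib_right bounded_measurable_add I_add bounded_measurable_eval)
next
  case (2 p c)
  then show ?case
    by (auto simp: mult.assoc bounded_measurable_scale I_scale bounded_measurable_eval)
next
  case (3 p x)
  have "I (\<lambda>\<omega>. p \<omega> * \<omega> x * \<omega> y) = I (\<lambda>\<omega>. p \<omega> * \<omega> (x \<otimes> y))" if "y \<in> carrier G" for y
    using 3 that by (intro I_cong bounded_measurable_eval) (auto simp: dual_mult)
  then show ?case using 3 by (auto intro: bounded_measurable_eval)
next
  case (4 p)
  then show ?case by (auto simp: bounded_measurable_def)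
next
  case (5 p B q)
  have "p n \<in> borel_measurable (char_space G)" for n
    using 5(1) by (auto simp: bounded_measurable_def)
  then have "q \<in> borel_measurable (char_space G)"
    by (rule borel_measurable_LIMSEQ_metric) (use 5(3) in auto)
  moreover have "cmod (q \<omega>) \<le> B" if "\<omega> \<in> pontryagin_dual G" for \<omega>
    using 5(3)[OF that] 5(2)[OF that] by (intro LIMSEQ_le_const2[OF tendsto_norm]) auto
  ultimately have q: "q \<in> bounded_measurable G" by (auto simp: bounded_measurable_def)
  moreover have "I (\<lambda>\<omega>. q \<omega> * \<omega> x) = 0" if x: "x \<in> carrier G" for x
  proof -
    have "(\<lambda>n. I (\<lambda>\<omega>. p n \<omega> * \<omega> x)) \<longlonglongrightarrow> I (\<lambda>\<omega>. q \<omega> * \<omega> x)"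
      using 5 x q
      by (intro I_limit[where B = B] bounded_measurable_eval tendsto_mult_right)
        (auto simp: norm_mult dual_norm)
    then show ?thesis using 5(1) x by (simp add: tendsto_const_iff)
  qed
  ultimately show ?case by auto
qed

lemma I_indicator:
  assumes "A \<in> sets (char_space G)" shows "I (indicator A) = 0"
proof -
  have one: "(\<lambda>_. 1) \<in> bounded_measurable G"
    by (auto simp: bounded_measurable_def intro!: exI[of _ 1])
  have *: "(\<lambda>\<omega>. 1 * indicator A \<omega>) \<in> bounded_measurable G \<and>
      (\<forall>x\<in>carrier G. I (\<lambda>\<omega>. 1 * indicator A \<omega> * \<omega> x) = 0)"
    by (rule times_indicator[OF assms]) (simp add: one I_character)
  have "I (indicator A) = I (\<lambda>\<omega>. 1 * indicator A \<omega> * \<omega> \<one>)"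
    using * by (intro I_cong bounded_measurable_eval) (auto simp: dual_one)
  then show ?thesis using * by simp
qed

end

text \<open>
  Fourier coefficients determine a measure; this replaces a direct verification of translation
  invariance for the measures constructed below.
\<close>

lemma prob_char_space_eqI:
  assumes G: "group G" and P: "prob_space P" "sets P = sets (char_space G)"
    and Q: "prob_space Q" "sets Q = sets (char_space G)"
    and eq: "\<And>x. x \<in> carrier G \<Longrightarrow> (\<integral>\<omega>. \<omega> x \<partial>P) = (\<integral>\<omega>. \<omega> x \<partial>Q)"
  shows "P = Q"
proof -
  interpret group G by fact
  interpret P: prob_space P by fact
  interpret Q: prob_space Q by fact
  have sp: "space P = pontryagin_dual G" "space Q = pontryagin_dual G"
    using sets_eq_imp_space_eq[OF P(2)] sets_eq_imp_space_eq[OF Q(2)] by auto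
  note [measurable_cong] = P(2) Q(2)
  have int: "integrable P p" "integrable Q p" if p: "p \<in> bounded_measurable G" for p
  proof -
    obtain B where B: "\<forall>\<omega>\<in>pontryagin_dual G. cmod (p \<omega>) \<le> B" and [measurable]: "p \<in> borel_measurable (char_space G)"
      using p by (auto simp: bounded_measurable_def)
    show "integrable P p" "integrable Q p"
      using B by (auto intro!: P.integrable_const_bound[of _ B] Q.integrable_const_bound[of _ B] simp: sp)
  qed
  interpret dual_functional G "\<lambda>p. (\<integral>\<omega>. p \<omega> \<partial>P) - (\<integral>\<omega>. p \<omega> \<partial>Q)"
  proof (standard, goal_cases)
    case (3 p q B)
    have [measurable]: "p n \<in> borel_measurable (char_space G)" "q \<in> borel_measurable (char_space G)" for n
      using 3(1,2) by (auto simp: bounded_measurable_def)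
    show ?case
      using 3
      by (intro tendsto_diff integral_dominated_convergence[where w = "\<lambda>_. B"]) (auto simp: sp)
  qed (auto simp: int eq algebra_simps)
  show ?thesis
  proof (rule measure_eqI)
    fix A assume "A \<in> sets P"
    then have A: "A \<in> sets (char_space G)" and [measurable]: "A \<in> sets P" "A \<in> sets Q" using P Q by auto
    have "(\<integral>\<omega>. indicator A \<omega> \<partial>R) = complex_of_real (measure R (A \<inter> space R))" for R
    proof -
      have "(\<integral>\<omega>. indicator A \<omega> \<partial>R) = (\<integral>\<omega>. complex_of_real (indicator A \<omega>) \<partial>R)"
        by (intro Bochner_Integration.integral_cong) (auto simp: indicator_def)
      then show ?thesis
        by (simp only: integral_complex_of_real Bochner_Integration.integral_indicator)
    qed
    moreover have "A \<inter> space P = A" "A \<inter> space Q = A"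
      using sets.sets_into_space[OF A] by (auto simp: sp)
    ultimately have "measure P A = measure Q A" using I_indicator[OF A] by simp
    then show "emeasure P A = emeasure Q A" by (simp add: P.emeasure_eq_measure Q.emeasure_eq_measure)
  qed (use P Q in simp)
qed

text \<open>
  Completeness of the characters: a density that is orthogonal to all of them integrates to zero over
  every measurable set.
\<close>

lemma fourier_coefficients_zero:
  assumes M: "prob_space M" and G: "group G" and sets: "sets M = sets (char_space G)" and F: "integrable M F"
    and zero: "\<And>x. x \<in> carrier G \<Longrightarrow> (\<integral>\<omega>. \<omega> x * F \<omega> \<partial>M) = (0 :: complex)"
  shows "AE \<omega> in M. F \<omega> = 0"
proof -
  interpret prob_space M by fact
  interpret group G by fact
  have sp: "space M = pontryagin_dual G"
    using sets_eq_imp_space_eq[OF sets] by auto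
  note [measurable_cong] = sets
  have [measurable]: "F \<in> borel_measurable (char_space G)"
    using borel_measurable_integrable[OF F] measurable_cong_sets[OF sets refl] by auto
  have int: "integrable M (\<lambda>\<omega>. p \<omega> * F \<omega>)" if p: "p \<in> bounded_measurable G" for p
  proof -
    obtain B where B: "\<forall>\<omega>\<in>pontryagin_dual G. cmod (p \<omega>) \<le> B" and [measurable]: "p \<in> borel_measurable (char_space G)"
      using p by (auto simp: bounded_measurable_def)
    show ?thesis
    proof (rule Bochner_Integration.integrable_bound)
      show "integrable M (\<lambda>\<omega>. B * norm (F \<omega>))" using F by auto
      show "AE \<omega> in M. norm (p \<omega> * F \<omega>) \<le> norm (B * norm (F \<omega>))"
        using B by (intro AE_I2) (fastforce simp: norm_mult sp abs_mult intro!: mult_right_mono)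
    qed measurable
  qed
  interpret dual_functional G "\<lambda>p. \<integral>\<omega>. p \<omega> * F \<omega> \<partial>M"
  proof (standard, goal_cases)
    case (3 p q B)
    have [measurable]: "p n \<in> borel_measurable (char_space G)" "q \<in> borel_measurable (char_space G)" for n
      using 3(1,2) by (auto simp: bounded_measurable_def)
    show ?case
    proof (rule integral_dominated_convergence[where w = "\<lambda>\<omega>. B * norm (F \<omega>)"])
      show "integrable M (\<lambda>\<omega>. B * norm (F \<omega>))" using F by auto
      show "AE \<omega> in M. (\<lambda>n. p n \<omega> * F \<omega>) \<longlonglongrightarrow> q \<omega> * F \<omega>"
        using 3(4) by (intro AE_I2 tendsto_mult_right) (auto simp: sp)
      show "AE \<omega> in M. norm (p n \<omega> * F \<omega>) \<le> B * norm (F \<omega>)" for n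
        using 3(3) by (intro AE_I2) (auto simp: norm_mult sp intro!: mult_right_mono)
    qed measurable
  qed (auto simp: int zero distrib_right mult.assoc)
  have "AE \<omega> in M. 0 = F \<omega>"
  proof (rule density_unique_banach[OF _ F])
    fix A assume "A \<in> sets M"
    then have A: "A \<in> sets (char_space G)" using sets by simp
    have "set_lebesgue_integral M A F = (\<integral>\<omega>. indicator A \<omega> * F \<omega> \<partial>M)"
      unfolding set_lebesgue_integral_def
      by (intro Bochner_Integration.integral_cong) (auto simp: indicator_def)
    then show "set_lebesgue_integral M A (\<lambda>_. 0) = set_lebesgue_integral M A F"
      using I_indicator[OF A] by (simp add: set_lebesgue_integral_def)
  qed auto
  then show ?thesis by auto
qed

section \<open>Fourier analysis on the dual of a countable Abelian group\<close>

text \<open>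
  The Haar measure enters through one property only: all nontrivial characters of the dual have mean
  zero.  This makes the evaluations an orthonormal system.
\<close>

locale dual_probability = comm_group N + prob_space P
  for N :: "('a, 'b) monoid_scheme" (structure) and P :: "('a \<Rightarrow> complex) measure" +
  assumes countable_carrier: "countable (carrier N)"
    and sets_P: "sets P = sets (char_space N)"
    and mean: "x \<in> carrier N \<Longrightarrow> (\<integral>\<omega>. \<omega> x \<partial>P) = (if x = \<one> then 1 else 0)"
begin

lemma space_P: "space P = pontryagin_dual N"
  using sets_eq_imp_space_eq[OF sets_P] by simp

lemma measurable_eval [measurable]: "x \<in> carrier N \<Longrightarrow> (\<lambda>\<omega>. \<omega> x) \<in> borel_measurable P"
  unfolding measurable_cong_sets[OF sets_P refl] by (rule measurable_char_space_eval)

lemma norm_eval: "\<omega> \<in> space P \<Longrightarrow> x \<in> carrier N \<Longrightarrow> cmod (\<omega> x) = 1"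
  by (simp add: space_P dual_norm)

lemma square_integrable_eval: "x \<in> carrier N \<Longrightarrow> square_integrable P (\<lambda>\<omega>. \<omega> x)"
  by (auto simp: square_integrable_def norm_eval intro!: integrable_const_bound[of _ 1])

lemma orthonormal:
  assumes "x \<in> carrier N" "y \<in> carrier N"
  shows "(\<integral>\<omega>. cnj (\<omega> x) * \<omega> y \<partial>P) = (if x = y then 1 else 0)"
proof -
  have "(\<integral>\<omega>. cnj (\<omega> x) * \<omega> y \<partial>P) = (\<integral>\<omega>. \<omega> (inv x \<otimes> y) \<partial>P)"
    using assms by (intro Bochner_Integration.integral_cong) (auto simp: space_P dual_mult dual_inv)
  also have "\<dots> = (if x = y then 1 else 0)"
    using assms inv_solve_left[of \<one> x y] by (auto simp: mean)
  finally show ?thesis .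
qed

definition coeff :: "(('a \<Rightarrow> complex) \<Rightarrow> complex) \<Rightarrow> 'a \<Rightarrow> complex" where
  "coeff F x = (if x \<in> carrier N then \<integral>\<omega>. cnj (\<omega> x) * F \<omega> \<partial>P else 0)"

lemma integrable_coeff:
  "square_integrable P F \<Longrightarrow> x \<in> carrier N \<Longrightarrow> integrable P (\<lambda>\<omega>. cnj (\<omega> x) * F \<omega>)"
  by (simp add: square_integrable_inner square_integrable_eval)

lemma coeff_add:
  "square_integrable P F \<Longrightarrow> square_integrable P F' \<Longrightarrow>
   coeff (\<lambda>\<omega>. F \<omega> + F' \<omega>) = (\<lambda>x. coeff F x + coeff F' x)"
  by (auto simp: coeff_def distrib_left integrable_coeff)

lemma coeff_cmult: "coeff (\<lambda>\<omega>. c * F \<omega>) = (\<lambda>x. c * coeff F x)"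
  by (auto simp: coeff_def mult.left_commute)

lemma coeff_diff:
  assumes "square_integrable P F" "square_integrable P F'"
  shows "coeff (\<lambda>\<omega>. F \<omega> - F' \<omega>) = (\<lambda>x. coeff F x - coeff F' x)"
  using coeff_add[OF assms(1) square_integrable_cmult[OF assms(2), of "-1"]]
    coeff_cmult[of "-1" F'] by simp

lemma coeff_cong_AE:
  assumes "F \<in> borel_measurable P" "F' \<in> borel_measurable P" "AE \<omega> in P. F \<omega> = F' \<omega>"
  shows "coeff F = coeff F'"
proof
  fix x show "coeff F x = coeff F' x"
  proof (cases "x \<in> carrier N")
    case True
    note [measurable] = assms(1,2) True
    have "(\<integral>\<omega>. cnj (\<omega> x) * F \<omega> \<partial>P) = (\<integral>\<omega>. cnj (\<omega> x) * F' \<omega> \<partial>P)"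
      by (intro integral_cong_AE) (use assms(3) in auto)
    then show ?thesis by (simp add: coeff_def)
  qed (simp add: coeff_def)
qed

lemma coeff_eq_imp_AE_eq:
  assumes F: "square_integrable P F" "square_integrable P F'" and eq: "coeff F = coeff F'"
  shows "AE \<omega> in P. F \<omega> = F' \<omega>"
proof -
  have "AE \<omega> in P. F \<omega> - F' \<omega> = 0"
  proof (rule fourier_coefficients_zero[OF prob_space_axioms is_group sets_P])
    have sq: "square_integrable P (\<lambda>\<omega>. F \<omega> - F' \<omega>)" by (rule square_integrable_diff[OF F])
    then show "integrable P (\<lambda>\<omega>. F \<omega> - F' \<omega>)" by (rule square_integrable_imp_integrable_complex)
    fix x assume x: "x \<in> carrier N"
    have "(\<integral>\<omega>. \<omega> x * (F \<omega> - F' \<omega>) \<partial>P) = (\<integral>\<omega>. cnj (\<omega> (inv x)) * (F \<omega> - F' \<omega>) \<partial>P)"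
      using x by (intro Bochner_Integration.integral_cong) (auto simp: space_P dual_inv)
    also have "\<dots> = coeff (\<lambda>\<omega>. F \<omega> - F' \<omega>) (inv x)" using x by (simp add: coeff_def)
    also have "\<dots> = 0" by (simp add: coeff_diff F eq)
    finally show "(\<integral>\<omega>. \<omega> x * (F \<omega> - F' \<omega>) \<partial>P) = 0" .
  qed
  then show ?thesis by auto
qed

definition trig :: "'a set \<Rightarrow> ('a \<Rightarrow> complex) \<Rightarrow> ('a \<Rightarrow> complex) \<Rightarrow> complex" where
  "trig S c \<omega> = (\<Sum>x\<in>S. c x * \<omega> x)"

lemma square_integrable_trig: "S \<subseteq> carrier N \<Longrightarrow> square_integrable P (trig S c)"
  unfolding trig_def
  by (intro square_integrable_sum square_integrable_cmult square_integrable_eval) auto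

lemma coeff_trig:
  assumes "finite S" "S \<subseteq> carrier N"
  shows "coeff (trig S c) y = (if y \<in> S then c y else 0)"
proof (cases "y \<in> carrier N")
  case True
  have "coeff (trig S c) y = (\<integral>\<omega>. (\<Sum>x\<in>S. c x * (cnj (\<omega> y) * \<omega> x)) \<partial>P)"
    using True by (simp add: coeff_def trig_def sum_distrib_left mult.left_commute)
  also have "\<dots> = (\<Sum>x\<in>S. c x * (\<integral>\<omega>. cnj (\<omega> y) * \<omega> x \<partial>P))"
    using assms(2) True
    by (subst Bochner_Integration.integral_sum)
      (auto intro!: integrable_mult_right integrable_coeff square_integrable_eval)
  also have "\<dots> = (\<Sum>x\<in>S. if x = y then c x else 0)"
    using assms(2) True by (intro sum.cong) (auto simp: orthonormal)
  finally show ?thesis using assms(1) by (simp add: sum.delta)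
qed (use assms in \<open>auto simp: coeff_def\<close>)

lemma inner_trig:
  assumes S: "finite S" "S \<subseteq> carrier N" and F: "square_integrable P F"
  shows "(\<integral>\<omega>. cnj (trig S c \<omega>) * F \<omega> \<partial>P) = (\<Sum>x\<in>S. cnj (c x) * coeff F x)"
proof -
  have "(\<integral>\<omega>. cnj (trig S c \<omega>) * F \<omega> \<partial>P) = (\<integral>\<omega>. (\<Sum>x\<in>S. cnj (c x) * (cnj (\<omega> x) * F \<omega>)) \<partial>P)"
    by (simp add: trig_def sum_distrib_right mult.assoc)
  also have "\<dots> = (\<Sum>x\<in>S. cnj (c x) * (\<integral>\<omega>. cnj (\<omega> x) * F \<omega> \<partial>P))"
    using S F by (subst Bochner_Integration.integral_sum)
      (auto intro!: integrable_mult_right integrable_coeff)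
  finally show ?thesis using S by (simp add: coeff_def subset_iff cong: sum.cong)
qed

lemma norm_trig:
  assumes "finite S" "S \<subseteq> carrier N"
  shows "(\<integral>\<omega>. (cmod (trig S c \<omega>))\<^sup>2 \<partial>P) = (\<Sum>x\<in>S. (cmod (c x))\<^sup>2)"
proof -
  have "complex_of_real (\<integral>\<omega>. (cmod (trig S c \<omega>))\<^sup>2 \<partial>P) = (\<integral>\<omega>. cnj (trig S c \<omega>) * trig S c \<omega> \<partial>P)"
    by (subst integral_complex_of_real[symmetric]) (simp only: cmod_sq_eq)
  also have "\<dots> = complex_of_real (\<Sum>x\<in>S. (cmod (c x))\<^sup>2)"
    using assms by (simp add: inner_trig square_integrable_trig coeff_trig cmod_sq_eq del: of_real_power)
  finally show ?thesis by (simp only: of_real_eq_iff)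
qed

lemma bessel:
  assumes S: "finite S" "S \<subseteq> carrier N" and F: "square_integrable P F"
  shows "(\<Sum>x\<in>S. (cmod (coeff F x))\<^sup>2) \<le> (\<integral>\<omega>. (cmod (F \<omega>))\<^sup>2 \<partial>P)"
proof -
  let ?T = "trig S (coeff F)"
  note T = square_integrable_trig[OF S(2), of "coeff F"]
  define q where "q \<omega> = cnj (?T \<omega>) * F \<omega>" for \<omega>
  have q: "integrable P q" unfolding q_def by (rule square_integrable_inner[OF T F])
  have "0 \<le> (\<integral>\<omega>. (cmod (F \<omega> - ?T \<omega>))\<^sup>2 \<partial>P)" by simp
  also have "\<dots> = (\<integral>\<omega>. (cmod (F \<omega>))\<^sup>2 + (cmod (?T \<omega>))\<^sup>2 - 2 * Re (q \<omega>) \<partial>P)"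
    unfolding q_def
    by (intro Bochner_Integration.integral_cong refl) (simp add: cmod_power2, simp add: power2_eq_square algebra_simps)
  also have "\<dots> = (\<integral>\<omega>. (cmod (F \<omega>))\<^sup>2 \<partial>P) + (\<integral>\<omega>. (cmod (?T \<omega>))\<^sup>2 \<partial>P) - 2 * Re (\<integral>\<omega>. q \<omega> \<partial>P)"
    using square_integrable_norm_sq[OF F] square_integrable_norm_sq[OF T] q by simp
  also have "(\<integral>\<omega>. q \<omega> \<partial>P) = complex_of_real (\<Sum>x\<in>S. (cmod (coeff F x))\<^sup>2)"
    by (simp add: q_def inner_trig S F cmod_sq_eq del: of_real_power)
  finally show ?thesis by (simp add: norm_trig S)
qed

lemma coeff_ell2:
  assumes "square_integrable P F" shows "coeff F \<in> ell2 (carrier N)"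
proof -
  have "(\<lambda>x. (cmod (coeff F x))\<^sup>2) summable_on carrier N"
    using bessel[OF _ _ assms]
    by (intro nonneg_bdd_above_summable_on bdd_aboveI[of _ "\<integral>\<omega>. (cmod (F \<omega>))\<^sup>2 \<partial>P"]) auto
  then show ?thesis by (simp add: ell2_def coeff_def)
qed

text \<open>
  Riesz--Fischer: along finite sets whose tails decay geometrically the partial Fourier sums have
  differences with summable \<open>L\<^sup>1\<close> norms, so they converge almost everywhere; Fatou bounds the norm
  of the limit.
\<close>

lemma riesz_fischer:
  assumes c: "c \<in> ell2 (carrier N)"
  obtains F where "square_integrable P F" "coeff F = c"
    "(\<integral>\<omega>. (cmod (F \<omega>))\<^sup>2 \<partial>P) \<le> (\<Sum>\<^sub>\<infinity>x\<in>carrier N. (cmod (c x))\<^sup>2)"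
proof -
  let ?s = "\<lambda>x. (cmod (c x))\<^sup>2"
  define total where "total = (\<Sum>\<^sub>\<infinity>x\<in>carrier N. ?s x)"
  have sm: "?s summable_on carrier N" using c by (simp add: ell2_def)
  have le_total: "sum ?s T \<le> total" if "finite T" "T \<subseteq> carrier N" for T
    unfolding total_def by (rule finite_sum_le_infsum[OF sm that]) auto
  \<comment> \<open>outside the finite set number \<open>k\<close> the coefficients have square sum at most \<open>(1/4)^k\<close>\<close>
  have "\<exists>S. finite S \<and> S \<subseteq> carrier N \<and> total - (1/4)^k \<le> sum ?s S" for k :: nat
  proof -
    have "\<forall>\<^sub>F S in finite_subsets_at_top (carrier N). dist (sum ?s S) total < (1/4)^k"
      using infsum_tendsto[OF sm] unfolding total_def by (rule tendstoD) auto
    then obtain S where "finite S" "S \<subseteq> carrier N" "dist (sum ?s S) total < (1/4)^k"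
      unfolding eventually_finite_subsets_at_top by blast
    then show ?thesis by (intro exI[of _ S]) (auto simp: dist_real_def)
  qed
  then obtain S0 where S0: "\<And>k. finite (S0 k)" "\<And>k. S0 k \<subseteq> carrier N"
      "\<And>k. total - (1/4)^k \<le> sum ?s (S0 k)" by metis
  define S where "S k = (\<Union>j\<le>k. S0 j)" for k
  have S: "finite (S k)" "S k \<subseteq> carrier N" "S k \<subseteq> S (Suc k)" "total - (1/4)^k \<le> sum ?s (S k)" for k
  proof -
    show "finite (S k)" "S k \<subseteq> carrier N" using S0 by (auto simp: S_def)
    show "S k \<subseteq> S (Suc k)" unfolding S_def by (rule UN_mono) auto
    have "sum ?s (S0 k) \<le> sum ?s (S k)" using S0(1) by (intro sum_mono2) (auto simp: S_def)
    then show "total - (1/4)^k \<le> sum ?s (S k)" using S0(3)[of k] by simp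
  qed
  have tail: "sum ?s T \<le> (1/4)^k" if "finite T" "T \<subseteq> carrier N" "T \<inter> S k = {}" for T k
  proof -
    have "sum ?s T + sum ?s (S k) = sum ?s (T \<union> S k)" using that S(1)[of k] by (simp add: sum.union_disjoint)
    also have "\<dots> \<le> total" using that S[of k] by (intro le_total) auto
    finally show ?thesis using S(4)[of k] by simp
  qed
  define d where "d k = trig (S (Suc k) - S k) c" for k
  have d_sub: "finite (S (Suc k) - S k)" "S (Suc k) - S k \<subseteq> carrier N" for k
    using S(1,2)[of "Suc k"] by auto
  have d_sq: "square_integrable P (d k)" for k
    unfolding d_def by (rule square_integrable_trig[OF d_sub(2)])
  have d_int: "integrable P (d k)" for k by (rule square_integrable_imp_integrable_complex[OF d_sq])
  have [measurable]: "d k \<in> borel_measurable P" for k using d_int by auto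
  have d_L1: "(\<integral>\<omega>. cmod (d k \<omega>) \<partial>P) \<le> (1/2)^k" for k
  proof -
    \<comment> \<open>trades the bound \<open>(1/4)^k\<close> on the square of the \<open>L\<^sup>2\<close> norm for a bound on the \<open>L\<^sup>1\<close> norm\<close>
    have am_gm: "t \<le> ((1/2)^k + 2^k * t\<^sup>2) / 2" for t :: real
    proof -
      have "0 \<le> (1 - 2^k * t)\<^sup>2 / 2^k" by simp
      then show ?thesis by (simp add: power2_eq_square field_simps)
    qed
    have "(\<integral>\<omega>. cmod (d k \<omega>) \<partial>P) \<le> (\<integral>\<omega>. ((1/2)^k + 2^k * (cmod (d k \<omega>))\<^sup>2) / 2 \<partial>P)"
      using d_int[of k] square_integrable_norm_sq[OF d_sq[of k]]
      by (intro integral_mono am_gm) auto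
    also have "\<dots> = ((1/2)^k + 2^k * (\<integral>\<omega>. (cmod (d k \<omega>))\<^sup>2 \<partial>P)) / 2"
      using square_integrable_norm_sq[OF d_sq[of k]] by (simp add: prob_space)
    also have "\<dots> \<le> ((1/2)^k + 2^k * (1/4)^k) / 2"
    proof -
      have "(\<integral>\<omega>. (cmod (d k \<omega>))\<^sup>2 \<partial>P) \<le> (1/4)^k"
        unfolding d_def norm_trig[OF d_sub] using d_sub by (intro tail) auto
      then show ?thesis by (intro divide_right_mono add_left_mono mult_left_mono) auto
    qed
    also have "\<dots> = (1/2)^k" by (simp add: power_mult_distrib[symmetric])
    finally show ?thesis .
  qed
  have L1_summable: "summable (\<lambda>k. \<integral>\<omega>. cmod (d k \<omega>) \<partial>P)"
    by (rule summable_comparison_test'[where g = "\<lambda>k. (1/2)^k" and N = 0]) (auto simp: d_L1)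
  have AE_summable: "AE \<omega> in P. summable (\<lambda>k. cmod (d k \<omega>))"
  proof -
    have "(\<integral>\<^sup>+\<omega>. (\<Sum>k. ennreal (cmod (d k \<omega>))) \<partial>P) = (\<Sum>k. \<integral>\<^sup>+\<omega>. ennreal (cmod (d k \<omega>)) \<partial>P)"
      by (rule nn_integral_suminf) measurable
    also have "\<dots> = (\<Sum>k. ennreal (\<integral>\<omega>. cmod (d k \<omega>) \<partial>P))"
      using d_int by (simp add: nn_integral_eq_integral)
    also have "\<dots> \<noteq> \<infinity>"
      unfolding infinity_ennreal_def by (rule ennreal_suminf_neq_top[OF L1_summable]) simp
    finally have "AE \<omega> in P. (\<Sum>k. ennreal (cmod (d k \<omega>))) \<noteq> \<infinity>"
      by (intro nn_integral_noteq_infinite) auto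
    then show ?thesis by eventually_elim (rule summable_suminf_not_top, auto)
  qed
  define F where "F \<omega> = trig (S 0) c \<omega> + (\<Sum>k. d k \<omega>)" for \<omega>
  have T0: "square_integrable P (trig (S 0) c)" by (rule square_integrable_trig[OF S(2)])
  note [measurable] = square_integrable_measurable[OF T0]
  have [measurable]: "F \<in> borel_measurable P" unfolding F_def by measurable
  have partial: "trig (S 0) c \<omega> + (\<Sum>k<n. d k \<omega>) = trig (S n) c \<omega>" for n \<omega>
  proof (induction n)
    case (Suc n)
    have "trig (S (Suc n)) c \<omega> = d n \<omega> + trig (S n) c \<omega>"
      unfolding d_def trig_def by (rule sum.subset_diff[OF S(3) S(1)])
    moreover have "trig (S 0) c \<omega> + (\<Sum>k<Suc n. d k \<omega>) =
        d n \<omega> + (trig (S 0) c \<omega> + (\<Sum>k<n. d k \<omega>))"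
      by (simp only: sum.lessThan_Suc ac_simps)
    ultimately show ?case by (simp only: Suc.IH)
  qed (simp only: lessThan_0 sum.empty add_0_right)
  have AE_lim: "AE \<omega> in P. (\<lambda>n. trig (S n) c \<omega>) \<longlonglongrightarrow> F \<omega>"
    using AE_summable
  proof eventually_elim
    case (elim \<omega>)
    then have "(\<lambda>n. \<Sum>k<n. d k \<omega>) \<longlonglongrightarrow> (\<Sum>k. d k \<omega>)"
      by (rule summable_LIMSEQ[OF summable_norm_cancel])
    then have "(\<lambda>n. trig (S 0) c \<omega> + (\<Sum>k<n. d k \<omega>)) \<longlonglongrightarrow> F \<omega>"
      unfolding F_def by (intro tendsto_add) auto
    then show ?case by (simp only: partial)
  qed
  have norm_bound: "(\<integral>\<^sup>+\<omega>. ennreal ((cmod (F \<omega>))\<^sup>2) \<partial>P) \<le> ennreal total"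
  proof -
    have [measurable]: "trig (S n) c \<in> borel_measurable P" for n
      by (rule square_integrable_measurable[OF square_integrable_trig[OF S(2)]])
    have "(\<integral>\<^sup>+\<omega>. ennreal ((cmod (F \<omega>))\<^sup>2) \<partial>P) = (\<integral>\<^sup>+\<omega>. liminf (\<lambda>n. ennreal ((cmod (trig (S n) c \<omega>))\<^sup>2)) \<partial>P)"
      using AE_lim
    proof (intro nn_integral_cong_AE, eventually_elim)
      case (elim \<omega>)
      then have "(\<lambda>n. ennreal ((cmod (trig (S n) c \<omega>))\<^sup>2)) \<longlonglongrightarrow> ennreal ((cmod (F \<omega>))\<^sup>2)"
        by (intro tendsto_ennrealI tendsto_power tendsto_norm)
      then show ?case by (rule lim_imp_Liminf[OF sequentially_bot, symmetric])
    qed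
    also have "\<dots> \<le> liminf (\<lambda>n. \<integral>\<^sup>+\<omega>. ennreal ((cmod (trig (S n) c \<omega>))\<^sup>2) \<partial>P)"
      by (rule nn_integral_liminf) measurable
    also have "\<dots> \<le> liminf (\<lambda>n :: nat. ennreal total)"
    proof (intro Liminf_mono always_eventually allI)
      fix n
      have "(\<integral>\<^sup>+\<omega>. ennreal ((cmod (trig (S n) c \<omega>))\<^sup>2) \<partial>P) = ennreal (sum ?s (S n))"
        by (subst nn_integral_eq_integral)
          (auto simp: norm_trig S square_integrable_norm_sq[OF square_integrable_trig[OF S(2)]])
      also have "\<dots> \<le> ennreal total" using le_total[OF S(1,2)] by (rule ennreal_leI)
      finally show "(\<integral>\<^sup>+\<omega>. ennreal ((cmod (trig (S n) c \<omega>))\<^sup>2) \<partial>P) \<le> ennreal total" .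
    qed
    finally show ?thesis by (simp add: Liminf_const)
  qed
  have F_sq: "square_integrable P F"
    unfolding square_integrable_def
  proof
    show "integrable P (\<lambda>\<omega>. (cmod (F \<omega>))\<^sup>2)"
      using norm_bound by (intro integrableI_bounded) (auto intro: le_less_trans)
  qed measurable
  have "coeff F y = c y" for y
  proof (cases "y \<in> carrier N")
    case True
    note [measurable] = True
    have e_int: "integrable P (\<lambda>\<omega>. cnj (\<omega> y) * d k \<omega>)" for k by (rule integrable_coeff[OF d_sq True])
    have e_norm: "(\<integral>\<omega>. norm (cnj (\<omega> y) * d k \<omega>) \<partial>P) = (\<integral>\<omega>. cmod (d k \<omega>) \<partial>P)" for k
      by (intro Bochner_Integration.integral_cong) (auto simp: norm_mult norm_eval True)
    have e_AE: "AE \<omega> in P. summable (\<lambda>k. norm (cnj (\<omega> y) * d k \<omega>))"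
      using AE_summable AE_space by eventually_elim (simp add: norm_mult norm_eval True)
    have e_summable: "summable (\<lambda>k. \<integral>\<omega>. norm (cnj (\<omega> y) * d k \<omega>) \<partial>P)"
      using L1_summable by (simp only: e_norm)
    note e = e_int e_AE e_summable
    have sums: "(\<lambda>k. coeff (d k) y) sums (\<integral>\<omega>. (\<Sum>k. cnj (\<omega> y) * d k \<omega>) \<partial>P)"
      using sums_integral[OF e] True by (simp add: coeff_def)
    have "coeff F y = (\<integral>\<omega>. cnj (\<omega> y) * trig (S 0) c \<omega> + (\<Sum>k. cnj (\<omega> y) * d k \<omega>) \<partial>P)"
      unfolding coeff_def if_P[OF True]
    proof (rule integral_cong_AE)
      show "AE \<omega> in P. cnj (\<omega> y) * F \<omega> = cnj (\<omega> y) * trig (S 0) c \<omega> + (\<Sum>k. cnj (\<omega> y) * d k \<omega>)"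
        using AE_summable
        by eventually_elim (simp add: F_def distrib_left suminf_mult summable_norm_cancel)
    qed measurable
    also have "\<dots> = coeff (trig (S 0) c) y + (\<integral>\<omega>. (\<Sum>k. cnj (\<omega> y) * d k \<omega>) \<partial>P)"
      using integrable_coeff[OF T0 True] integrable_suminf[OF e] True by (simp add: coeff_def)
    finally have "(\<lambda>n. coeff (trig (S 0) c) y + (\<Sum>k<n. coeff (d k) y)) \<longlonglongrightarrow> coeff F y"
      using sums unfolding sums_def by (auto intro: tendsto_add)
    moreover have "coeff (trig (S 0) c) y + (\<Sum>k<n. coeff (d k) y) = coeff (trig (S n) c) y" for n
    proof (induction n)
      case (Suc n)
      have "coeff (trig (S (Suc n)) c) y = coeff (d n) y + coeff (trig (S n) c) y"
        using S(3)[of n] by (auto simp: d_def coeff_trig[OF d_sub] coeff_trig[OF S(1,2)])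
      moreover have "coeff (trig (S 0) c) y + (\<Sum>k<Suc n. coeff (d k) y) =
          coeff (d n) y + (coeff (trig (S 0) c) y + (\<Sum>k<n. coeff (d k) y))"
        by (simp only: sum.lessThan_Suc ac_simps)
      ultimately show ?case by (simp only: Suc.IH)
    qed simp
    ultimately have lim: "(\<lambda>n. coeff (trig (S n) c) y) \<longlonglongrightarrow> coeff F y" by simp
    have "(\<lambda>n. coeff (trig (S n) c) y) \<longlonglongrightarrow> c y"
    proof (rule LIM_zero_cancel, rule Lim_null_comparison)
      have "cmod (coeff (trig (S n) c) y - c y) \<le> (1/2)^n" for n
      proof (cases "y \<in> S n")
        case False
        then have "(cmod (c y))\<^sup>2 \<le> (1/4)^n" using tail[of "{y}" n] True by simp
        also have "(1/4)^n = (((1/2)^n)\<^sup>2 :: real)"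
          unfolding power2_eq_square power_mult_distrib[symmetric] by simp
        finally have "cmod (c y) \<le> (1/2)^n" by (rule power2_le_imp_le) simp
        then show ?thesis using False by (simp add: coeff_trig S)
      qed (simp add: coeff_trig S)
      then show "\<forall>\<^sub>F n in sequentially. norm (coeff (trig (S n) c) y - c y) \<le> (1/2)^n"
        by (intro always_eventually) auto
    qed (rule LIMSEQ_realpow_zero, auto)
    with lim show ?thesis by (rule LIMSEQ_unique)
  qed (use c in \<open>auto simp: coeff_def ell2_def\<close>)
  moreover have "(\<integral>\<omega>. (cmod (F \<omega>))\<^sup>2 \<partial>P) \<le> total"
  proof -
    have "ennreal (\<integral>\<omega>. (cmod (F \<omega>))\<^sup>2 \<partial>P) \<le> ennreal total"
      using norm_bound nn_integral_eq_integral[OF square_integrable_norm_sq[OF F_sq]] by simp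
    moreover have "0 \<le> total" using le_total[of "{}"] by simp
    ultimately show ?thesis by simp
  qed
  ultimately show ?thesis using that[of F] F_sq by (auto simp: total_def)
qed

text \<open>
  One inequality is Bessel's.  For the other, the function that Riesz--Fischer assigns to the
  coefficients of \<open>F\<close> is bounded by them in norm and equals \<open>F\<close> almost everywhere by completeness.
\<close>

lemma parseval_norm:
  assumes F: "square_integrable P F"
  shows "(\<Sum>\<^sub>\<infinity>x\<in>carrier N. (cmod (coeff F x))\<^sup>2) = (\<integral>\<omega>. (cmod (F \<omega>))\<^sup>2 \<partial>P)"
proof (rule antisym)
  have "(\<lambda>x. (cmod (coeff F x))\<^sup>2) summable_on carrier N"
    using coeff_ell2[OF F] by (simp add: ell2_def)
  then show "(\<Sum>\<^sub>\<infinity>x\<in>carrier N. (cmod (coeff F x))\<^sup>2) \<le> (\<integral>\<omega>. (cmod (F \<omega>))\<^sup>2 \<partial>P)"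
    by (rule infsum_le_finite_sums) (use bessel F in auto)
  obtain F' where F': "square_integrable P F'" "coeff F' = coeff F"
    "(\<integral>\<omega>. (cmod (F' \<omega>))\<^sup>2 \<partial>P) \<le> (\<Sum>\<^sub>\<infinity>x\<in>carrier N. (cmod (coeff F x))\<^sup>2)"
    using riesz_fischer[OF coeff_ell2[OF F]] .
  note [measurable] = square_integrable_measurable[OF F] square_integrable_measurable[OF F'(1)]
  have "(\<integral>\<omega>. (cmod (F \<omega>))\<^sup>2 \<partial>P) = (\<integral>\<omega>. (cmod (F' \<omega>))\<^sup>2 \<partial>P)"
    using coeff_eq_imp_AE_eq[OF F'(1) F F'(2)] by (intro integral_cong_AE) auto
  with F'(3) show "(\<integral>\<omega>. (cmod (F \<omega>))\<^sup>2 \<partial>P) \<le> (\<Sum>\<^sub>\<infinity>x\<in>carrier N. (cmod (coeff F x))\<^sup>2)" by simp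
qed

lemma parseval:
  assumes "square_integrable P F" "square_integrable P F'"
  shows "(\<integral>x. cnj (coeff F x) * coeff F' x \<partial>count_space (carrier N)) = (\<integral>\<omega>. cnj (F \<omega>) * F' \<omega> \<partial>P)"
  using assms
  by (rule isometry_preserves_inner[where T = coeff])
    (simp_all add: ell2D coeff_ell2 coeff_add coeff_cmult parseval_norm flip: infsum_eq_integral_real)

end

section \<open>Square-integrable fields over a countable set\<close>

lemma L2D:
  assumes "\<phi> \<in> L2 P X"
  shows "\<omega> \<in> space P \<Longrightarrow> \<phi> \<omega> \<in> ell2 X"
    and "x \<in> X \<Longrightarrow> (\<lambda>\<omega>. \<phi> \<omega> x) \<in> borel_measurable P"
    and "integrable P (\<lambda>\<omega>. (ell2_norm X (\<phi> \<omega>))\<^sup>2)"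
  using assms by (auto simp: L2_def)

lemma borel_measurable_count_space_integral:
  fixes f :: "'x \<Rightarrow> 'w \<Rightarrow> _ :: {banach, second_countable_topology}"
  assumes "countable X" "\<And>x. x \<in> X \<Longrightarrow> f x \<in> borel_measurable M"
  shows "(\<lambda>\<omega>. \<integral>x. f x \<omega> \<partial>count_space X) \<in> borel_measurable M"
proof -
  interpret sigma_finite_measure "count_space X"
    by (rule sigma_finite_measure_count_space_countable[OF assms(1)])
  have "(\<lambda>p. f (fst p) (snd p)) \<in> borel_measurable (count_space X \<Otimes>\<^sub>M M)"
    by (rule measurable_pair_measure_countable1[OF assms(1)]) (use assms(2) in simp)
  then have "(\<lambda>(\<omega>, x). f x \<omega>) \<in> borel_measurable (M \<Otimes>\<^sub>M count_space X)"
    by (subst (asm) measurable_pair_swap_iff) (simp add: split_def)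
  then show ?thesis by (rule borel_measurable_lebesgue_integral)
qed

lemma borel_measurable_count_space_nn_integral:
  assumes "countable X" "\<And>x. x \<in> X \<Longrightarrow> f x \<in> borel_measurable M"
  shows "(\<lambda>\<omega>. \<integral>\<^sup>+x. f x \<omega> \<partial>count_space X) \<in> borel_measurable M"
proof -
  interpret sigma_finite_measure "count_space X"
    by (rule sigma_finite_measure_count_space_countable[OF assms(1)])
  have "(\<lambda>p. f (fst p) (snd p)) \<in> borel_measurable (count_space X \<Otimes>\<^sub>M M)"
    by (rule measurable_pair_measure_countable1[OF assms(1)]) (use assms(2) in simp)
  then have "(\<lambda>(\<omega>, x). f x \<omega>) \<in> borel_measurable (M \<Otimes>\<^sub>M count_space X)"
    by (subst (asm) measurable_pair_swap_iff) (simp add: split_def)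
  then show ?thesis by (rule borel_measurable_nn_integral)
qed

text \<open>
  A field in \<open>L\<^sup>2(P; \<ell>\<^sup>2(X))\<close> is a square-integrable function on \<open>X \<times> \<Omega>\<close>; Fubini then
  exchanges sums over \<open>X\<close> with expectations.
\<close>

lemma L2_square_integrable:
  assumes X: "countable X" and P: "prob_space P" and \<phi>: "\<phi> \<in> L2 P X"
  shows "square_integrable (count_space X \<Otimes>\<^sub>M P) (\<lambda>(x, \<omega>). \<phi> \<omega> x)"
proof -
  interpret P: prob_space P by fact
  interpret X: sigma_finite_measure "count_space X"
    by (rule sigma_finite_measure_count_space_countable[OF X])
  interpret pair_sigma_finite "count_space X" P ..
  have m [measurable]: "(\<lambda>(x, \<omega>). \<phi> \<omega> x) \<in> borel_measurable (count_space X \<Otimes>\<^sub>M P)"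
    by (rule measurable_pair_measure_countable1[OF X]) (use L2D(2)[OF \<phi>] in simp)
  have "integrable (count_space X \<Otimes>\<^sub>M P) (\<lambda>(x, \<omega>). (cmod (\<phi> \<omega> x))\<^sup>2)"
  proof (rule integrableI_bounded)
    have "(\<integral>\<^sup>+p. ennreal (norm (case p of (x, \<omega>) \<Rightarrow> (cmod (\<phi> \<omega> x))\<^sup>2)) \<partial>(count_space X \<Otimes>\<^sub>M P)) =
        (\<integral>\<^sup>+\<omega>. \<integral>\<^sup>+x. ennreal ((cmod (\<phi> \<omega> x))\<^sup>2) \<partial>count_space X \<partial>P)"
      by (subst nn_integral_snd[symmetric]) (use m in \<open>auto simp: split_def\<close>)
    also have "\<dots> = (\<integral>\<^sup>+\<omega>. ennreal ((ell2_norm X (\<phi> \<omega>))\<^sup>2) \<partial>P)"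
      using L2D(1)[OF \<phi>]
      by (intro nn_integral_cong)
        (auto simp: ell2_norm_sq nn_integral_eq_integral square_integrable_norm_sq[OF ell2D])
    also have "\<dots> < \<infinity>" using L2D(3)[OF \<phi>] by (subst nn_integral_eq_integral) auto
    finally show "(\<integral>\<^sup>+p. ennreal (norm (case p of (x, \<omega>) \<Rightarrow> (cmod (\<phi> \<omega> x))\<^sup>2)) \<partial>(count_space X \<Otimes>\<^sub>M P)) < \<infinity>" .
  qed (use m in \<open>auto simp: split_def\<close>)
  then show ?thesis using m by (simp add: square_integrable_def split_def)
qed

lemma L2I:
  assumes X: "countable X" and P: "prob_space P"
    and sq: "square_integrable (count_space X \<Otimes>\<^sub>M P) (\<lambda>(x, \<omega>). \<phi> \<omega> x)"
    and ell2: "\<And>\<omega>. \<omega> \<in> space P \<Longrightarrow> \<phi> \<omega> \<in> ell2 X"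
  shows "\<phi> \<in> L2 P X"
proof -
  interpret P: prob_space P by fact
  interpret X: sigma_finite_measure "count_space X"
    by (rule sigma_finite_measure_count_space_countable[OF X])
  interpret pair_sigma_finite "count_space X" P ..
  have "(\<lambda>\<omega>. \<phi> \<omega> x) \<in> borel_measurable P" if "x \<in> X" for x
    using measurable_compose[OF measurable_Pair1'[of x "count_space X" P] square_integrable_measurable[OF sq]] that
    by simp
  moreover have "integrable P (\<lambda>\<omega>. (ell2_norm X (\<phi> \<omega>))\<^sup>2)"
    using integrable_snd[of "\<lambda>x \<omega>. (cmod (\<phi> \<omega> x))\<^sup>2"] square_integrable_norm_sq[OF sq]
    by (simp add: ell2_norm_sq split_def)
  ultimately show ?thesis using ell2 by (auto simp: L2_def)
qed

lemma L2_Fubini: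
  assumes X: "countable X" and P: "prob_space P" and \<phi>: "\<phi> \<in> L2 P X" and \<psi>: "\<psi> \<in> L2 P X"
  shows "L2_inner P X \<phi> \<psi> = (\<integral>x. (\<integral>\<omega>. cnj (\<phi> \<omega> x) * \<psi> \<omega> x \<partial>P) \<partial>count_space X)"
    and "(\<integral>\<omega>. (ell2_norm X (\<phi> \<omega>))\<^sup>2 \<partial>P) = (\<integral>x. (\<integral>\<omega>. (cmod (\<phi> \<omega> x))\<^sup>2 \<partial>P) \<partial>count_space X)"
    and "integrable (count_space X) (\<lambda>x. \<integral>\<omega>. (cmod (\<phi> \<omega> x))\<^sup>2 \<partial>P)"
    and "x \<in> X \<Longrightarrow> square_integrable P (\<lambda>\<omega>. \<phi> \<omega> x)"
proof -
  interpret P: prob_space P by fact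
  interpret X: sigma_finite_measure "count_space X"
    by (rule sigma_finite_measure_count_space_countable[OF X])
  interpret pair_sigma_finite "count_space X" P ..
  note sq = L2_square_integrable[OF X P]
  have i: "integrable (count_space X \<Otimes>\<^sub>M P) (\<lambda>(x, \<omega>). (cmod (\<phi> \<omega> x))\<^sup>2)"
    using square_integrable_norm_sq[OF sq[OF \<phi>]] by (simp add: split_def)
  have "integrable (count_space X \<Otimes>\<^sub>M P) (\<lambda>(x, \<omega>). cnj (\<phi> \<omega> x) * \<psi> \<omega> x)"
    using square_integrable_inner[OF sq[OF \<phi>] sq[OF \<psi>]] by (simp add: split_def)
  from Fubini_integral[OF this]
  show "L2_inner P X \<phi> \<psi> = (\<integral>x. (\<integral>\<omega>. cnj (\<phi> \<omega> x) * \<psi> \<omega> x \<partial>P) \<partial>count_space X)"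
    by (simp add: L2_inner_def ell2_inner_eq_integral)
  from Fubini_integral[OF i]
  show "(\<integral>\<omega>. (ell2_norm X (\<phi> \<omega>))\<^sup>2 \<partial>P) = (\<integral>x. (\<integral>\<omega>. (cmod (\<phi> \<omega> x))\<^sup>2 \<partial>P) \<partial>count_space X)"
    by (simp add: ell2_norm_sq)
  show "integrable (count_space X) (\<lambda>x. \<integral>\<omega>. (cmod (\<phi> \<omega> x))\<^sup>2 \<partial>P)"
    using integrable_fst[OF i] .
  assume x: "x \<in> X"
  have "AE x in count_space X. integrable P (\<lambda>\<omega>. (cmod (\<phi> \<omega> x))\<^sup>2)"
    using AE_integrable_fst[OF i] .
  then show "square_integrable P (\<lambda>\<omega>. \<phi> \<omega> x)"
    using x L2D(2)[OF \<phi> x] by (auto simp: square_integrable_def AE_count_space)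
qed

lemma L2_add:
  assumes "countable X" "prob_space P" "\<phi> \<in> L2 P X" "\<psi> \<in> L2 P X"
  shows "(\<lambda>\<omega> x. \<phi> \<omega> x + \<psi> \<omega> x) \<in> L2 P X"
  using square_integrable_add[OF L2_square_integrable[OF assms(1-3)] L2_square_integrable[OF assms(1,2,4)]]
    L2D(1)[OF assms(3)] L2D(1)[OF assms(4)]
  by (intro L2I assms ell2_add) (auto simp: split_def)

lemma L2_cmult:
  assumes "countable X" "prob_space P" "\<phi> \<in> L2 P X"
  shows "(\<lambda>\<omega> x. c * \<phi> \<omega> x) \<in> L2 P X"
  using square_integrable_cmult[OF L2_square_integrable[OF assms], of c] L2D(1)[OF assms(3)]
  by (intro L2I assms ell2_cmult) (auto simp: split_def)

context dual_probability
begin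

text \<open>
  The Fourier transform in every fibre \<open>x\<close>.
\<close>

definition field_coeff :: "'x set \<Rightarrow> (('a \<Rightarrow> complex) \<Rightarrow> 'x \<Rightarrow> complex) \<Rightarrow> 'x \<times> 'a \<Rightarrow> complex" where
  "field_coeff X \<phi> = (\<lambda>(x, n). if x \<in> X then coeff (\<lambda>\<omega>. \<phi> \<omega> x) n else 0)"

lemma pair_sigma_finite_count_space:
  "countable X \<Longrightarrow> pair_sigma_finite (count_space X) (count_space (carrier N))"
  by (intro pair_sigma_finite.intro sigma_finite_measure_count_space_countable countable_carrier)

lemma count_space_Times:
  "countable X \<Longrightarrow> count_space (X \<times> carrier N) = count_space X \<Otimes>\<^sub>M count_space (carrier N)"
  by (simp add: pair_measure_countable countable_carrier)

lemma field_coeff_ell2: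
  assumes X: "countable X" and \<phi>: "\<phi> \<in> L2 P X"
  shows "field_coeff X \<phi> \<in> ell2 (X \<times> carrier N)"
proof -
  interpret pair_sigma_finite "count_space X" "count_space (carrier N)"
    by (rule pair_sigma_finite_count_space[OF X])
  note F = L2_Fubini[OF X prob_space_axioms \<phi> \<phi>]
  have inner: "integrable (count_space (carrier N)) (\<lambda>n. (cmod (field_coeff X \<phi> (x, n)))\<^sup>2)"
      "(\<integral>n. (cmod (field_coeff X \<phi> (x, n)))\<^sup>2 \<partial>count_space (carrier N)) = (\<integral>\<omega>. (cmod (\<phi> \<omega> x))\<^sup>2 \<partial>P)"
    if "x \<in> X" for x
    using that F(4)[OF that] square_integrable_norm_sq[OF ell2D[OF coeff_ell2[OF F(4)[OF that]]]]
    by (auto simp: field_coeff_def parseval_norm simp flip: infsum_eq_integral_real)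
  have "integrable (count_space X) (\<lambda>x. \<integral>n. norm ((cmod (field_coeff X \<phi> (x, n)))\<^sup>2) \<partial>count_space (carrier N)) \<longleftrightarrow>
      integrable (count_space X) (\<lambda>x. \<integral>\<omega>. (cmod (\<phi> \<omega> x))\<^sup>2 \<partial>P)"
    by (rule Bochner_Integration.integrable_cong) (auto simp: inner)
  then have "integrable (count_space X \<Otimes>\<^sub>M count_space (carrier N)) (\<lambda>p. (cmod (field_coeff X \<phi> p))\<^sup>2)"
    using F(3) inner(1)
    by (intro Fubini_integrable) (auto simp: AE_count_space count_space_Times[OF X, symmetric])
  then show ?thesis
    by (auto simp: ell2_iff square_integrable_def count_space_Times[OF X, symmetric])
      (auto simp: field_coeff_def coeff_def)
qed

lemma field_coeff_inner:
  assumes X: "countable X" and \<phi>: "\<phi> \<in> L2 P X" and \<psi>: "\<psi> \<in> L2 P X"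
  shows "ell2_inner (X \<times> carrier N) (field_coeff X \<phi>) (field_coeff X \<psi>) = L2_inner P X \<phi> \<psi>"
proof -
  interpret pair_sigma_finite "count_space X" "count_space (carrier N)"
    by (rule pair_sigma_finite_count_space[OF X])
  note sq = L2_Fubini(4)[OF X prob_space_axioms \<phi> \<phi>] L2_Fubini(4)[OF X prob_space_axioms \<psi> \<psi>]
  have "integrable (count_space (X \<times> carrier N)) (\<lambda>p. cnj (field_coeff X \<phi> p) * field_coeff X \<psi> p)"
    by (intro square_integrable_inner ell2D field_coeff_ell2 assms)
  then have "ell2_inner (X \<times> carrier N) (field_coeff X \<phi>) (field_coeff X \<psi>) =
      (\<integral>x. \<integral>n. cnj (field_coeff X \<phi> (x, n)) * field_coeff X \<psi> (x, n) \<partial>count_space (carrier N) \<partial>count_space X)"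
    unfolding ell2_inner_eq_integral count_space_Times[OF X] by (rule integral_fst'[symmetric])
  also have "\<dots> = (\<integral>x. (\<integral>\<omega>. cnj (\<phi> \<omega> x) * \<psi> \<omega> x \<partial>P) \<partial>count_space X)"
    by (intro Bochner_Integration.integral_cong) (auto simp: field_coeff_def parseval sq)
  also have "\<dots> = L2_inner P X \<phi> \<psi>" by (rule L2_Fubini(1)[OF X prob_space_axioms \<phi> \<psi>, symmetric])
  finally show ?thesis .
qed

lemma field_coeff_add:
  assumes X: "countable X" and \<phi>: "\<phi> \<in> L2 P X" and \<psi>: "\<psi> \<in> L2 P X"
  shows "field_coeff X (\<lambda>\<omega> x. \<phi> \<omega> x + \<psi> \<omega> x) = (\<lambda>y. field_coeff X \<phi> y + field_coeff X \<psi> y)"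
  using L2_Fubini(4)[OF X prob_space_axioms \<phi> \<phi>] L2_Fubini(4)[OF X prob_space_axioms \<psi> \<psi>]
  by (auto simp: field_coeff_def coeff_add)

lemma field_coeff_cmult:
  "field_coeff X (\<lambda>\<omega> x. c * \<phi> \<omega> x) = (\<lambda>y. c * field_coeff X \<phi> y)"
  by (auto simp: field_coeff_def coeff_cmult)

text \<open>
  Riesz--Fischer in each fibre yields the coordinates of a preimage; they are square-summable only
  almost everywhere, so the field is put to zero on the exceptional null set.
\<close>

lemma field_coeff_surj:
  assumes X: "countable X" and u: "u \<in> ell2 (X \<times> carrier N)"
  shows "u \<in> field_coeff X ` L2 P X"
proof -
  note sigma_finite_P = sigma_finite_measure_axioms
  interpret pair_sigma_finite "count_space X" "count_space (carrier N)"
    by (rule pair_sigma_finite_count_space[OF X])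
  have ui: "integrable (count_space X \<Otimes>\<^sub>M count_space (carrier N)) (\<lambda>(x, n). (cmod (u (x, n)))\<^sup>2)"
    using square_integrable_norm_sq[OF ell2D[OF u]] by (simp add: count_space_Times[OF X, symmetric] split_def)
  have fibre: "(\<lambda>n. u (x, n)) \<in> ell2 (carrier N)" if "x \<in> X" for x
    using AE_integrable_fst[OF ui] u that
    by (auto simp: AE_count_space ell2_def summable_on_iff_integrable_real)
  have "\<exists>F. square_integrable P F \<and> coeff F = (\<lambda>n. u (x, n))" if "x \<in> X" for x
    using riesz_fischer[OF fibre[OF that]] by metis
  then obtain F where F: "\<And>x. x \<in> X \<Longrightarrow> square_integrable P (F x)"
      "\<And>x. x \<in> X \<Longrightarrow> coeff (F x) = (\<lambda>n. u (x, n))" by metis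
  have F_norm: "(\<integral>\<omega>. (cmod (F x \<omega>))\<^sup>2 \<partial>P) = (\<integral>n. (cmod (u (x, n)))\<^sup>2 \<partial>count_space (carrier N))" if "x \<in> X" for x
    using parseval_norm[OF F(1)[OF that]] by (simp add: F(2) that infsum_eq_integral_real)
  interpret XP: pair_sigma_finite "count_space X" P
    using sigma_finite_measure_count_space_countable[OF X] sigma_finite_P
    by (rule pair_sigma_finite.intro)
  have Fm: "(\<lambda>(x, \<omega>). F x \<omega>) \<in> borel_measurable (count_space X \<Otimes>\<^sub>M P)"
    by (rule measurable_pair_measure_countable1[OF X]) (use F(1) square_integrable_measurable in auto)
  have Fi: "integrable (count_space X \<Otimes>\<^sub>M P) (\<lambda>(x, \<omega>). (cmod (F x \<omega>))\<^sup>2)"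
  proof (rule XP.Fubini_integrable)
    have "integrable (count_space X) (\<lambda>x. \<integral>n. (cmod (u (x, n)))\<^sup>2 \<partial>count_space (carrier N))"
      using integrable_fst[OF ui] .
    then show "integrable (count_space X) (\<lambda>x. \<integral>\<omega>. norm (case (x, \<omega>) of (x, \<omega>) \<Rightarrow> (cmod (F x \<omega>))\<^sup>2) \<partial>P)"
      by (rule Bochner_Integration.integrable_cong[THEN iffD1, rotated -1]) (auto simp: F_norm)
    show "AE x in count_space X. integrable P (\<lambda>\<omega>. case (x, \<omega>) of (x, \<omega>) \<Rightarrow> (cmod (F x \<omega>))\<^sup>2)"
      using F(1) by (auto simp: AE_count_space square_integrable_def)
    show "(\<lambda>(x, \<omega>). (cmod (F x \<omega>))\<^sup>2) \<in> borel_measurable (count_space X \<Otimes>\<^sub>M P)"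
      using Fm by (simp add: split_def)
  qed
  define \<Omega> where "\<Omega> = {\<omega> \<in> space P. (\<integral>\<^sup>+x. ennreal ((cmod (F x \<omega>))\<^sup>2) \<partial>count_space X) < \<infinity>}"
  have [measurable]: "(\<lambda>\<omega>. \<integral>\<^sup>+x. ennreal ((cmod (F x \<omega>))\<^sup>2) \<partial>count_space X) \<in> borel_measurable P"
  proof (rule borel_measurable_count_space_nn_integral[OF X])
    fix x assume "x \<in> X"
    note [measurable] = square_integrable_measurable[OF F(1)[OF this]]
    show "(\<lambda>\<omega>. ennreal ((cmod (F x \<omega>))\<^sup>2)) \<in> borel_measurable P" by measurable
  qed
  have \<Omega> [measurable]: "\<Omega> \<in> sets P" unfolding \<Omega>_def by measurable
  have AE: "AE \<omega> in P. \<omega> \<in> \<Omega>"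
    using XP.AE_integrable_snd[OF Fi] AE_space
    by eventually_elim (auto simp: \<Omega>_def integrable_iff_bounded)
  define \<phi> where "\<phi> \<omega> x = (if x \<in> X then indicator \<Omega> \<omega> * F x \<omega> else 0)" for \<omega> x
  have "\<phi> \<in> L2 P X"
  proof (rule L2I[OF X prob_space_axioms])
    have "square_integrable (count_space X \<Otimes>\<^sub>M P) (\<lambda>(x, \<omega>). F x \<omega>)"
      using Fm Fi by (simp add: square_integrable_def split_def)
    then have *: "square_integrable (count_space X \<Otimes>\<^sub>M P) (\<lambda>p. indicator \<Omega> (snd p) * (case p of (x, \<omega>) \<Rightarrow> F x \<omega>))"
      by (rule square_integrable_mult_bounded[where C = 1]) (auto simp: indicator_def)
    show "square_integrable (count_space X \<Otimes>\<^sub>M P) (\<lambda>(x, \<omega>). \<phi> \<omega> x)"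
    proof (rule square_integrable_cong_AE[OF *])
      show "AE p in count_space X \<Otimes>\<^sub>M P. indicator \<Omega> (snd p) * (case p of (x, \<omega>) \<Rightarrow> F x \<omega>) = (case p of (x, \<omega>) \<Rightarrow> \<phi> \<omega> x)"
        by (intro AE_I2) (auto simp: \<phi>_def space_pair_measure)
      show "(\<lambda>(x, \<omega>). \<phi> \<omega> x) \<in> borel_measurable (count_space X \<Otimes>\<^sub>M P)"
      proof (rule measurable_pair_measure_countable1[OF X])
        fix x assume x: "x \<in> X"
        note [measurable] = square_integrable_measurable[OF F(1)[OF x]]
        show "(\<lambda>\<omega>. case (x, \<omega>) of (x, \<omega>) \<Rightarrow> \<phi> \<omega> x) \<in> borel_measurable P"
          using x by (simp add: \<phi>_def)
      qed
    qed
    fix \<omega> assume "\<omega> \<in> space P"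
    show "\<phi> \<omega> \<in> ell2 X"
    proof (cases "\<omega> \<in> \<Omega>")
      case True
      then have "integrable (count_space X) (\<lambda>x. (cmod (F x \<omega>))\<^sup>2)"
        by (auto simp: \<Omega>_def integrable_iff_bounded)
      then have "(\<lambda>x. (cmod (F x \<omega>))\<^sup>2) summable_on X" by (simp add: summable_on_iff_integrable_real)
      then have "(\<lambda>x. (cmod (\<phi> \<omega> x))\<^sup>2) summable_on X"
        by (rule summable_on_cong[THEN iffD1, rotated]) (simp add: \<phi>_def True)
      then show ?thesis by (auto simp: ell2_def \<phi>_def)
    next
      case False
      then have "\<phi> \<omega> = (\<lambda>_. 0)" by (auto simp: \<phi>_def fun_eq_iff)
      then show ?thesis by (simp add: ell2_def)
    qed
  qed
  moreover have "field_coeff X \<phi> = u"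
  proof
    fix p show "field_coeff X \<phi> p = u p"
    proof (cases "fst p \<in> X")
      case True
      have "coeff (\<lambda>\<omega>. \<phi> \<omega> (fst p)) = coeff (F (fst p))"
      proof (rule coeff_cong_AE)
        show "AE \<omega> in P. \<phi> \<omega> (fst p) = F (fst p) \<omega>"
          using AE by eventually_elim (simp add: \<phi>_def True)
        show m: "F (fst p) \<in> borel_measurable P" by (rule square_integrable_measurable[OF F(1)[OF True]])
        show "(\<lambda>\<omega>. \<phi> \<omega> (fst p)) \<in> borel_measurable P" using m by (simp add: \<phi>_def)
      qed
      then show ?thesis using True by (simp add: field_coeff_def F(2) split_def)
    next
      case False
      then have "p \<notin> X \<times> carrier N" by auto
      then have "u p = 0" using u unfolding ell2_def by blast
      then show ?thesis using False by (simp add: field_coeff_def split_def)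
    qed
  qed
  ultimately show ?thesis by blast
qed

end

section \<open>Haar measure on the dual of a finitely generated Abelian group\<close>

lemma (in group) dual_int_pow:
  assumes "\<omega> \<in> pontryagin_dual G" "x \<in> carrier G"
  shows "\<omega> (x [^] (n :: int)) = \<omega> x powi n"
proof -
  have nat: "\<omega> (x [^] (k :: nat)) = \<omega> x ^ k" for k
    by (induction k) (use assms in \<open>auto simp: dual_one dual_mult\<close>)
  have "\<omega> x * cnj (\<omega> x) = 1"
    using dual_norm[OF assms] cmod_sq_eq[of "\<omega> x"] by (simp add: mult.commute)
  then have inv: "inverse (\<omega> x) = cnj (\<omega> x)" by (rule inverse_unique)
  show ?thesis
  proof (cases "n < 0")
    case True
    have "\<omega> (x [^] n) = cnj (\<omega> (x [^] nat (- n)))"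
      using True assms dual_inv[OF assms(1), of "x [^] nat (- n)"] by (simp only: int_pow_def2 if_True nat_pow_closed)
    then show ?thesis using True by (simp only: nat power_int_def inv complex_cnj_power not_le[symmetric] if_False)
  next
    case False
    then have "x [^] n = x [^] nat n" by (simp only: int_pow_def2 if_False)
    moreover have "\<omega> x powi n = \<omega> x ^ nat n"
      unfolding power_int_def using False by (simp only: not_less if_True)
    ultimately show ?thesis by (simp only: nat)
  qed
qed

text \<open>
  A random character of a subgroup \<open>H\<close> extends to the subgroup generated by \<open>H\<close> and one more
  element \<open>a\<close> once a random value \<open>\<zeta>\<close> at \<open>a\<close> is chosen that is compatible with the powers of \<open>a\<close>
  in \<open>H\<close>.  The extended family has mean zero at nontrivial elements if \<open>\<zeta> powi n\<close> averages to zero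
  over the auxiliary randomness whenever \<open>a [^] n\<close> lies outside \<open>H\<close>.
\<close>

lemma (in comm_group) dual_probability_extend:
  fixes a :: 'a and \<zeta> :: "('a \<Rightarrow> complex) \<times> 'q \<Rightarrow> complex"
  assumes H: "subgroup H G" and K: "subgroup K G" and a: "a \<in> carrier G"
    and K_eq: "K = {h \<otimes> a [^] n | h (n :: int). h \<in> H}"
    and P: "dual_probability (G\<lparr>carrier := H\<rparr>) P" and Q: "prob_space Q"
    and \<zeta>_meas [measurable]: "\<zeta> \<in> borel_measurable (P \<Otimes>\<^sub>M Q)"
    and \<zeta>_norm: "\<And>\<theta> q. \<theta> \<in> space P \<Longrightarrow> q \<in> space Q \<Longrightarrow> cmod (\<zeta> (\<theta>, q)) = 1"
    and \<zeta>_root: "\<And>\<theta> q n. \<theta> \<in> space P \<Longrightarrow> q \<in> space Q \<Longrightarrow> a [^] (n :: int) \<in> H \<Longrightarrow>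
        \<zeta> (\<theta>, q) powi n = \<theta> (a [^] n)"
    and \<zeta>_mean: "\<And>\<theta> n. \<theta> \<in> space P \<Longrightarrow> a [^] (n :: int) \<notin> H \<Longrightarrow> (\<integral>q. \<zeta> (\<theta>, q) powi n \<partial>Q) = 0"
  shows "\<exists>P'. dual_probability (G\<lparr>carrier := K\<rparr>) P'"
proof -
  interpret P: dual_probability "G\<lparr>carrier := H\<rparr>" P by fact
  interpret Q: prob_space Q by fact
  interpret PQ: pair_prob_space P Q ..
  interpret H: subgroup H G by fact
  interpret K: subgroup K G by fact
  have eval [measurable]: "(\<lambda>\<theta>. \<theta> h) \<in> borel_measurable P" if "h \<in> H" for h
    using P.measurable_eval[of h] that by simp
  have \<theta>_norm: "cmod (\<theta> h) = 1" if "\<theta> \<in> space P" "h \<in> H" for \<theta> h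
    using P.norm_eval[of \<theta> h] that by simp
  have \<theta>_mult: "\<theta> (h \<otimes> h') = \<theta> h * \<theta> h'" if "\<theta> \<in> space P" "h \<in> H" "h' \<in> H" for \<theta> h h'
    using dual_mult[of \<theta> "G\<lparr>carrier := H\<rparr>" h h'] that by (simp add: P.space_P)
  \<comment> \<open>one representation of each element is chosen; \<open>ext_eq\<close> shows that the choice does not matter\<close>
  have "\<exists>h n. h \<in> H \<and> y = h \<otimes> a [^] (n :: int)" if "y \<in> K" for y
    using that by (auto simp: K_eq)
  then obtain \<eta> \<nu> where \<eta>: "\<And>y. y \<in> K \<Longrightarrow> \<eta> y \<in> H" "\<And>y. y \<in> K \<Longrightarrow> y = \<eta> y \<otimes> a [^] (\<nu> y :: int)"
    by metis
  define ext where "ext p = (\<lambda>y\<in>K. fst p (\<eta> y) * \<zeta> p powi \<nu> y)" for p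
  have ext_eq: "ext (\<theta>, q) (h \<otimes> a [^] n) = \<theta> h * \<zeta> (\<theta>, q) powi n"
    if \<theta>: "\<theta> \<in> space P" "q \<in> space Q" and h: "h \<in> H" for \<theta> q h and n :: int
  proof -
    let ?y = "h \<otimes> a [^] n" and ?z = "\<zeta> (\<theta>, q)"
    have y: "?y \<in> K" using h by (auto simp: K_eq)
    note \<eta>' = \<eta>[OF y]
    have "a [^] (n - \<nu> ?y) = inv h \<otimes> (h \<otimes> a [^] n) \<otimes> inv (a [^] \<nu> ?y)"
      using h a by (simp add: int_pow_diff m_assoc[symmetric])
    also have "\<dots> = inv h \<otimes> (\<eta> ?y \<otimes> a [^] \<nu> ?y) \<otimes> inv (a [^] \<nu> ?y)" using \<eta>'(2) by simp
    also have "\<dots> = inv h \<otimes> \<eta> ?y" using h \<eta>'(1) a by (simp add: m_assoc)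
    finally have pow: "a [^] (n - \<nu> ?y) = inv h \<otimes> \<eta> ?y" .
    then have "a [^] (n - \<nu> ?y) \<in> H" using h \<eta>'(1) by simp
    then have "?z powi (n - \<nu> ?y) = \<theta> (inv h \<otimes> \<eta> ?y)" using \<zeta>_root[OF \<theta>] pow by simp
    moreover have "\<theta> h * \<theta> (inv h \<otimes> \<eta> ?y) = \<theta> (\<eta> ?y)"
      using \<theta> h \<eta>'(1) by (simp add: \<theta>_mult[symmetric] m_assoc[symmetric])
    moreover have "?z \<noteq> 0" using \<zeta>_norm[OF \<theta>] by auto
    then have "?z powi n = ?z powi (n - \<nu> ?y) * ?z powi \<nu> ?y"
      by (simp add: power_int_add[symmetric])
    ultimately show ?thesis using y by (simp add: ext_def mult.assoc[symmetric])
  qed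
  have ext_dual: "ext p \<in> pontryagin_dual (G\<lparr>carrier := K\<rparr>)" if p: "p \<in> space (P \<Otimes>\<^sub>M Q)" for p
  proof -
    obtain \<theta> q where pq: "p = (\<theta>, q)" "\<theta> \<in> space P" "q \<in> space Q"
      using p by (auto simp: space_pair_measure)
    have \<zeta>: "cmod (\<zeta> (\<theta>, q)) = 1" by (rule \<zeta>_norm) (use pq in auto)
    have "ext p (x \<otimes> y) = ext p x * ext p y" if xy: "x \<in> K" "y \<in> K" for x y
    proof -
      obtain h m h' n where x: "x = h \<otimes> a [^] (m :: int)" "h \<in> H" and y: "y = h' \<otimes> a [^] (n :: int)" "h' \<in> H"
        using xy by (auto simp: K_eq)
      have "x \<otimes> y = (h \<otimes> h') \<otimes> a [^] (m + n)"
        using x y a by (simp add: int_pow_mult m_ac)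
      moreover have "\<zeta> (\<theta>, q) \<noteq> 0" using \<zeta> by auto
      ultimately show ?thesis
        using pq x y by (simp add: ext_eq \<theta>_mult power_int_add)
    qed
    moreover have "cmod (ext p x) = 1" if "x \<in> K" for x
      using that pq \<zeta> \<eta>(1)[OF that] by (simp add: ext_def norm_mult norm_power_int \<theta>_norm)
    ultimately show ?thesis by (auto simp: dual_iff ext_def)
  qed
  have meas: "ext \<in> measurable (P \<Otimes>\<^sub>M Q) (char_space (G\<lparr>carrier := K\<rparr>))"
  proof (rule measurable_char_spaceI[OF ext_dual])
    fix y assume "y \<in> carrier (G\<lparr>carrier := K\<rparr>)"
    then have y: "y \<in> K" by simp
    have [measurable]: "(\<lambda>\<theta>. \<theta> (\<eta> y)) \<in> borel_measurable P" using \<eta>(1)[OF y] by (rule eval)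
    have "(\<lambda>p. \<zeta> p powi \<nu> y) \<in> borel_measurable (P \<Otimes>\<^sub>M Q)"
      unfolding power_int_def by measurable
    then show "(\<lambda>p. ext p y) \<in> borel_measurable (P \<Otimes>\<^sub>M Q)"
      using y by (simp add: ext_def)
  qed
  let ?P' = "distr (P \<Otimes>\<^sub>M Q) (char_space (G\<lparr>carrier := K\<rparr>)) ext"
  have "comm_group (G\<lparr>carrier := K\<rparr>)"
    using K by (intro group.group_comm_groupI subgroup_imp_group) (auto intro: m_comm)
  then interpret GK: comm_group "G\<lparr>carrier := K\<rparr>" .
  interpret P': prob_space ?P' by (rule PQ.prob_space_distr[OF meas])
  have "dual_probability (G\<lparr>carrier := K\<rparr>) ?P'"
  proof
    have "countable H" using P.countable_carrier by simp
    then have "countable ((\<lambda>(h, n :: int). h \<otimes> a [^] n) ` (H \<times> UNIV))" by auto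
    then show "countable (carrier (G\<lparr>carrier := K\<rparr>))"
      by (rule countable_subset[rotated]) (auto simp: K_eq)
    show "sets ?P' = sets (char_space (G\<lparr>carrier := K\<rparr>))" by simp
    fix y assume "y \<in> carrier (G\<lparr>carrier := K\<rparr>)"
    then have yK: "y \<in> K" by simp
    then obtain h n where y: "y = h \<otimes> a [^] (n :: int)" "h \<in> H" by (auto simp: K_eq)
    have [measurable]: "(\<lambda>p. \<zeta> p powi n) \<in> borel_measurable (P \<Otimes>\<^sub>M Q)"
      unfolding power_int_def by measurable
    note [measurable] = eval[OF y(2)]
    have "(\<integral>\<omega>. \<omega> y \<partial>?P') = (\<integral>p. ext p y \<partial>(P \<Otimes>\<^sub>M Q))"
      by (rule integral_distr[OF meas measurable_char_space_eval]) (use yK in simp)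
    also have "\<dots> = (\<integral>p. fst p h * \<zeta> p powi n \<partial>(P \<Otimes>\<^sub>M Q))"
      by (intro Bochner_Integration.integral_cong) (auto simp: space_pair_measure ext_eq y)
    also have "\<dots> = (\<integral>\<theta>. (\<integral>q. \<theta> h * \<zeta> (\<theta>, q) powi n \<partial>Q) \<partial>P)"
      by (subst PQ.integral_fst'[symmetric])
        (auto simp: space_pair_measure norm_mult norm_power_int \<theta>_norm \<zeta>_norm y
          intro!: PQ.integrable_const_bound[of _ 1])
    also have "\<dots> = (if y = \<one> then 1 else 0)"
    proof (cases "a [^] n \<in> H")
      case True
      then have yH: "y \<in> H" using y by auto
      have "(\<integral>\<theta>. (\<integral>q. \<theta> h * \<zeta> (\<theta>, q) powi n \<partial>Q) \<partial>P) = (\<integral>\<theta>. \<theta> y \<partial>P)"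
      proof (rule Bochner_Integration.integral_cong[OF refl])
        fix \<theta> assume \<theta>: "\<theta> \<in> space P"
        have "(\<integral>q. \<theta> h * \<zeta> (\<theta>, q) powi n \<partial>Q) = (\<integral>q. \<theta> y \<partial>Q)"
          using \<theta> True y by (intro Bochner_Integration.integral_cong) (auto simp: \<zeta>_root \<theta>_mult)
        then show "(\<integral>q. \<theta> h * \<zeta> (\<theta>, q) powi n \<partial>Q) = \<theta> y" by (simp add: Q.prob_space)
      qed
      then show ?thesis using P.mean[of y] yH by simp
    next
      case False
      have "y \<noteq> \<one>"
      proof
        assume "y = \<one>"
        then have "a [^] n = inv h" using y a by (metis H.mem_carrier int_pow_closed inv_equality inv_inv m_comm)
        then show False using False y by simp
      qed
      moreover have "(\<integral>\<theta>. (\<integral>q. \<theta> h * \<zeta> (\<theta>, q) powi n \<partial>Q) \<partial>P) = (\<integral>\<theta>. 0 \<partial>P)"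
        using False by (intro Bochner_Integration.integral_cong) (auto simp: \<zeta>_mean)
      ultimately show ?thesis by simp
    qed
    finally show "(\<integral>\<omega>. \<omega> y \<partial>?P') = (if y = \<one>\<^bsub>G\<lparr>carrier := K\<rparr>\<^esub> then 1 else 0)" by simp
  qed
  then show ?thesis by blast
qed

lemma borel_measurable_Arg [measurable]: "Arg \<in> borel_measurable borel"
proof -
  let ?A = "- \<real>\<^sub>\<le>\<^sub>0 :: complex set"
  have A [measurable]: "?A \<in> sets borel"
    by (intro borel_open open_Compl closed_nonpos_Reals_complex)
  have [measurable]: "(\<lambda>z. indicator ?A z *\<^sub>R Arg z) \<in> borel_measurable borel"
    by (rule borel_measurable_continuous_on_indicator[OF A continuous_on_Arg])
  have "(\<lambda>z. indicator ?A z *\<^sub>R Arg z + (if z \<in> insert 0 ?A then 0 else pi)) \<in> borel_measurable borel"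
    by measurable
  also have "(\<lambda>z. indicator ?A z *\<^sub>R Arg z + (if z \<in> insert 0 ?A then 0 else pi)) = Arg"
    by (auto simp: fun_eq_iff indicator_def nonpos_Reals_def Arg_of_real Arg_zero)
  finally show ?thesis .
qed

lemma integral_cis_period:
  fixes n :: int assumes n: "n \<noteq> 0"
  shows "(\<integral>t. cis (2 * pi * t) powi n \<partial>uniform_measure lborel {0..1}) = 0"
proof -
  define c where "c = 2 * pi * real_of_int n"
  have c: "c \<noteq> 0" using n by (simp add: c_def)
  have cis: "cis (2 * pi * t) powi n = cis (c * t)" for t
    by (simp add: c_def cis_power_int mult_ac)
  have D: "((\<lambda>t. cis (c * t) / (\<i> * c)) has_vector_derivative cis (c * t)) (at t within {0..1})" for t
  proof -
    have "((\<lambda>z. exp (\<i> * (c * z)) / (\<i> * c)) has_field_derivative exp (\<i> * (c * t))) (at (complex_of_real t))"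
      using c by (auto intro!: derivative_eq_intros simp: algebra_simps)
    from has_vector_derivative_real_field[OF this] show ?thesis
      by (simp add: cis_conv_exp)
  qed
  have "uniform_measure lborel {0..1 :: real} = density lborel (\<lambda>t. ennreal (indicator {0..1} t))"
    by (simp add: uniform_measure_def ennreal_indicator divide_ennreal_def)
  then have "(\<integral>t. cis (2 * pi * t) powi n \<partial>uniform_measure lborel {0..1}) =
      (\<integral>t. indicator {0..1} t *\<^sub>R cis (c * t) \<partial>lborel)"
    unfolding cis by (subst \<open>uniform_measure _ _ = _\<close>, subst integral_density) (auto simp: cis_conv_exp)
  also have "\<dots> = cis (c * 1) / (\<i> * c) - cis (c * 0) / (\<i> * c)"
    by (rule integral_FTC_atLeastAtMost[OF _ D]) (auto intro!: continuous_intros)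
  also have "cis (c * 1) = 1" unfolding c_def using cis_multiple_2pi[of "real_of_int n"] by simp
  finally show ?thesis by simp
qed

lemma sum_roots_of_unity:
  fixes n :: int and k :: nat assumes k: "0 < k" and n: "\<not> int k dvd n"
  shows "(\<Sum>j<k. cis (2 * pi * real j / real k) powi n) = 0"
proof -
  define w where "w = cis (2 * pi * real_of_int n / real k)"
  have "cis (2 * pi * real j / real k) powi n = w ^ j" for j
    unfolding w_def cis_power_int Complex.DeMoivre by (rule arg_cong[of _ _ cis]) simp
  moreover have "w \<noteq> 1"
  proof
    assume "w = 1"
    then have "cos (2 * pi * real_of_int n / real k) = 1"
      unfolding w_def by (simp only: cis.sel(1)[symmetric] one_complex.sel)
    then obtain m :: int where "2 * pi * real_of_int n / real k = real_of_int m * 2 * pi"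
      unfolding cos_one_2pi_int by blast
    then have "real_of_int n = real_of_int (int k * m)" using k by (simp add: field_simps)
    then have "n = int k * m" by linarith
    then show False using n by simp
  qed
  moreover have "w ^ k = 1" using k by (simp add: w_def Complex.DeMoivre cis_multiple_2pi)
  ultimately show ?thesis by (simp add: geometric_sum)
qed

text \<open>
  If no power of \<open>a\<close> lies in \<open>H\<close>, the value at \<open>a\<close> is uniform on the unit circle.  Otherwise let \<open>k\<close>
  be the least positive exponent with \<open>a [^] k \<in> H\<close>; the value at \<open>a\<close> has to be a \<open>k\<close>-th root of the value
  at \<open>a [^] k\<close>, and all \<open>k\<close> roots are taken with equal probability.
\<close>

lemma (in comm_group) dual_probability_insert:
  assumes H: "subgroup H G" and K: "subgroup K G" and a: "a \<in> carrier G"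
    and K_eq: "K = {h \<otimes> a [^] n | h (n :: int). h \<in> H}"
    and P: "dual_probability (G\<lparr>carrier := H\<rparr>) P"
  shows "\<exists>P'. dual_probability (G\<lparr>carrier := K\<rparr>) P'"
proof (cases "\<exists>k>0. a [^] (k :: nat) \<in> H")
  case False
  have out: "a [^] n \<notin> H" if "n \<noteq> 0" for n :: int
  proof
    assume n: "a [^] n \<in> H"
    then have inv: "inv (a [^] n) \<in> H" using H by (rule subgroup.m_inv_closed[rotated])
    obtain m where m: "n = int m \<or> n = - int m" by (metis int_cases2)
    then have "a [^] m \<in> H"
    proof
      assume "n = int m"
      then show ?thesis using n by (simp only: int_pow_int)
    next
      assume "n = - int m"
      then show ?thesis using inv a by (simp only: int_pow_neg_int inv_inv nat_pow_closed)
    qed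
    moreover have "0 < m" using m that by auto
    ultimately show False using False by blast
  qed
  let ?Q = "uniform_measure lborel {0..1 :: real}"
  show ?thesis
  proof (rule dual_probability_extend[OF H K a K_eq P, of ?Q "\<lambda>(\<theta>, q). cis (2 * pi * q)"])
    show "prob_space ?Q" by (rule prob_space_uniform_measure) auto
    show "(\<lambda>(\<theta>, q). cis (2 * pi * q)) \<in> borel_measurable (P \<Otimes>\<^sub>M ?Q)"
      unfolding cis_conv_exp by measurable
    fix \<theta> and q :: real and n :: int assume \<theta>: "\<theta> \<in> space P"
    show "cmod (case (\<theta>, q) of (\<theta>, q) \<Rightarrow> cis (2 * pi * q)) = 1" by simp
    show "(case (\<theta>, q) of (\<theta>, q) \<Rightarrow> cis (2 * pi * q)) powi n = \<theta> (a [^] n)" if "a [^] n \<in> H"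
    proof -
      interpret P: dual_probability "G\<lparr>carrier := H\<rparr>" P by fact
      have "n = 0" using that out by auto
      then show ?thesis using P.dual_one[of \<theta>] \<theta> by (simp add: P.space_P)
    qed
    show "(\<integral>q. (case (\<theta>, q) of (\<theta>, q) \<Rightarrow> cis (2 * pi * q)) powi n \<partial>?Q) = 0" if "a [^] n \<notin> H"
      using that subgroup.one_closed[OF H] by (cases "n = 0") (auto simp: integral_cis_period)
  qed
next
  case True
  define k where "k = (LEAST k. 0 < k \<and> a [^] (k :: nat) \<in> H)"
  have k: "0 < k" "a [^] k \<in> H" using LeastI_ex[OF True] by (auto simp: k_def)
  have k_min: "\<not> (0 < j \<and> a [^] j \<in> H)" if "j < k" for j :: nat
    using that unfolding k_def by (rule not_less_Least)
  let ?H = "G\<lparr>carrier := H\<rparr>"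
  interpret P: dual_probability ?H P by fact
  have mult: "a [^] (int k * m) = (a [^] k) [^]\<^bsub>?H\<^esub> m" "a [^] (int k * m) \<in> H" for m :: int
  proof -
    have "a [^] (int k * m) = (a [^] k) [^] m" using a by (simp add: int_pow_pow[symmetric] int_pow_int)
    then show "a [^] (int k * m) = (a [^] k) [^]\<^bsub>?H\<^esub> m"
      using int_pow_consistent[OF H k(2)] by simp
    then show "a [^] (int k * m) \<in> H" using P.int_pow_closed[of "a [^] k" m] k by simp
  qed
  have dvd: "int k dvd n" if "a [^] n \<in> H" for n :: int
  proof -
    have "a [^] (n mod int k) = a [^] (n - int k * (n div int k))" by (simp add: minus_mult_div_eq_mod)
    also have "\<dots> = a [^] n \<otimes> inv (a [^] (int k * (n div int k)))" using a by (rule int_pow_diff)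
    also have "\<dots> \<in> H" using that mult(2) H by (intro subgroup.m_closed subgroup.m_inv_closed)
    finally have "a [^] (nat (n mod int k)) \<in> H" using k by (simp add: int_pow_def2)
    moreover have "nat (n mod int k) < k" using k by (simp add: nat_less_iff)
    ultimately have "nat (n mod int k) = 0" using k_min[of "nat (n mod int k)"] by simp
    moreover have "0 \<le> n mod int k" using k by simp
    ultimately have "n mod int k = 0" by linarith
    then show ?thesis by (rule mod_0_imp_dvd)
  qed
  let ?Q = "uniform_count_measure {..<k}"
  \<comment> \<open>the principal \<open>k\<close>-th root of the value at \<open>a [^] k\<close> times a random \<open>k\<close>-th root of unity\<close>
  let ?\<zeta> = "\<lambda>(\<theta> :: 'a \<Rightarrow> complex, j). cis (Arg (\<theta> (a [^] k)) / real k) * cis (2 * pi * real j / real k)"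
  have z_pow: "cis (Arg z / real k) ^ k = z" if "cmod z = 1" for z
  proof -
    have "z \<noteq> 0" using that by auto
    then show ?thesis using that k cis_Arg[of z] by (simp add: Complex.DeMoivre sgn_eq)
  qed
  show ?thesis
  proof (rule dual_probability_extend[OF H K a K_eq P, of ?Q ?\<zeta>])
    show "prob_space ?Q" using k by (intro prob_space_uniform_count_measure) auto
    have "(\<lambda>\<theta>. \<theta> (a [^] k)) \<in> borel_measurable P"
      using P.measurable_eval[of "a [^] k"] k by simp
    from measurable_compose[OF measurable_fst this]
    have [measurable]: "(\<lambda>p. fst p (a [^] k)) \<in> borel_measurable (P \<Otimes>\<^sub>M ?Q)" .
    have "real \<in> borel_measurable ?Q"
      by (simp add: measurable_cong_sets[OF sets_uniform_count_measure_count_space refl])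
    from measurable_compose[OF measurable_snd this]
    have [measurable]: "(\<lambda>p. real (snd p)) \<in> borel_measurable (P \<Otimes>\<^sub>M ?Q)" .
    show "?\<zeta> \<in> borel_measurable (P \<Otimes>\<^sub>M ?Q)"
      unfolding cis_conv_exp split_def by measurable
    fix \<theta> and q :: nat and n :: int assume \<theta>: "\<theta> \<in> space P"
    have norm: "cmod (\<theta> (a [^] k)) = 1" using P.norm_eval[OF \<theta>, of "a [^] k"] k by simp
    show "cmod (?\<zeta> (\<theta>, q)) = 1" by (simp add: norm_mult)
    show "?\<zeta> (\<theta>, q) powi n = \<theta> (a [^] n)" if n: "a [^] n \<in> H"
    proof -
      obtain m where m: "n = int k * m" using dvd[OF n] by auto
      have "?\<zeta> (\<theta>, q) ^ k = \<theta> (a [^] k)"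
        using k by (simp add: power_mult_distrib z_pow[OF norm] Complex.DeMoivre[of "2 * pi * real q / real k"] cis_multiple_2pi)
      then have "?\<zeta> (\<theta>, q) powi n = \<theta> (a [^] k) powi m"
        by (simp only: m power_int_mult power_int_of_nat)
      also have "\<dots> = \<theta> (a [^] n)"
        using P.dual_int_pow[of \<theta> "a [^] k" m] \<theta> k by (simp add: P.space_P m mult(1))
      finally show ?thesis .
    qed
    show "(\<integral>q. ?\<zeta> (\<theta>, q) powi n \<partial>?Q) = 0" if "a [^] n \<notin> H"
    proof -
      have "\<not> int k dvd n" using that mult(2) by auto
      then show ?thesis
        using sum_roots_of_unity[OF k(1)]
        by (simp add: power_int_mult_distrib uniform_count_measure_def
            lebesgue_integral_point_measure_finite scaleR_sum_right[symmetric])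
    qed
  qed
qed

text \<open>
  The generators are added one at a time, starting from the trivial group.
\<close>

lemma (in comm_group) dual_probability_exists:
  assumes "finitely_generated G"
  shows "\<exists>P. dual_probability G P"
proof -
  obtain S where S: "finite S" "S \<subseteq> carrier G" "generate G S = carrier G"
    using assms by (auto simp: finitely_generated_def)
  have "\<exists>P. dual_probability (G\<lparr>carrier := generate G S\<rparr>) P" using S(1,2)
  proof (induction S)
    case empty
    let ?G = "G\<lparr>carrier := generate G {}\<rparr>"
    have car: "carrier ?G = {\<one>}" using generate_empty by simp
    have sub: "subgroup {\<one>} G" by (rule triv_subgroup)
    have "comm_group ?G"
      using subgroup_imp_group[OF sub] generate_empty by (intro group.group_comm_groupI) auto
    then interpret T: comm_group ?G .
    let ?\<omega> = "\<lambda>x\<in>{\<one>}. 1 :: complex"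
    let ?P = "return (char_space ?G) ?\<omega>"
    have \<omega>: "?\<omega> \<in> space (char_space ?G)" using car by (simp add: dual_iff)
    interpret P: prob_space ?P by (rule prob_space_return[OF \<omega>])
    have "dual_probability ?G ?P"
    proof
      fix x assume x: "x \<in> carrier ?G"
      then have "(\<integral>\<omega>. \<omega> x \<partial>?P) = ?\<omega> x"
        by (intro integral_return[OF \<omega>] measurable_char_space_eval)
      then show "(\<integral>\<omega>. \<omega> x \<partial>?P) = (if x = \<one>\<^bsub>?G\<^esub> then 1 else 0)" using x car by simp
    qed (use car in auto)
    then show ?case by blast
  next
    case (insert a S)
    let ?H = "generate G S" and ?K = "generate G (insert a S)"
    have a: "a \<in> carrier G" and S: "S \<subseteq> carrier G" using insert.prems by auto
    have H: "subgroup ?H G" and K: "subgroup ?K G" using S insert.prems by (auto intro: generate_is_subgroup)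
    interpret H: subgroup ?H G by fact
    interpret K: subgroup ?K G by fact
    let ?E = "{h \<otimes> a [^] n | h (n :: int). h \<in> ?H}"
    have "subgroup ?E G"
    proof (rule subgroupI)
      show "?E \<subseteq> carrier G" using a by auto
      show "?E \<noteq> {}" using H.one_closed by blast
      fix x assume "x \<in> ?E"
      then obtain h n where x: "x = h \<otimes> a [^] (n :: int)" "h \<in> ?H" by auto
      have "inv x = inv h \<otimes> a [^] (- n)" using x a by (simp add: inv_mult int_pow_neg)
      then show "inv x \<in> ?E" using x H.m_inv_closed by blast
      fix y assume "y \<in> ?E"
      then obtain h' n' where y: "y = h' \<otimes> a [^] (n' :: int)" "h' \<in> ?H" by auto
      have "x \<otimes> y = (h \<otimes> h') \<otimes> a [^] (n + n')" using x y a by (simp add: int_pow_mult m_ac)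
      then show "x \<otimes> y \<in> ?E" using x y H.m_closed by blast
    qed
    moreover have "insert a S \<subseteq> ?E"
    proof -
      have "a = \<one> \<otimes> a [^] (1 :: int)" using a by simp
      then have "a \<in> ?E" using H.one_closed by blast
      moreover have "s \<in> ?E" if "s \<in> S" for s
      proof -
        have "s = s \<otimes> a [^] (0 :: int)" using that S by auto
        then show ?thesis using generate.incl[OF that, of G] by blast
      qed
      ultimately show ?thesis by blast
    qed
    ultimately have "?K \<subseteq> ?E" by (rule generate_subgroup_incl[rotated])
    moreover have "?E \<subseteq> ?K"
    proof -
      have "?H \<subseteq> ?K" by (rule mono_generate) auto
      moreover have "a [^] n \<in> ?K" for n :: int
        using subgroup_int_pow_closed[OF K] generate.incl[of a "insert a S" G] by auto
      ultimately show ?thesis using K.m_closed by auto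
    qed
    ultimately have "?K = ?E" by blast
    then show ?case
      using insert.IH[OF S] dual_probability_insert[OF H K a] by blast
  qed
  then show ?thesis using S(3) by simp
qed

section \<open>Haar measure on the dual of the group of lamp configurations\<close>

lemma prob_space_PiM_indep_vars:
  assumes M: "\<And>i. i \<in> I \<Longrightarrow> prob_space (M i)" and t: "inj_on t K" "t \<in> K \<rightarrow> I" and K: "K \<noteq> {}"
  shows "prob_space.indep_vars (PiM I M) (\<lambda>k. M (t k)) (\<lambda>k \<omega>. \<omega> (t k)) K"
proof -
  interpret prob_space "PiM I M" by (rule prob_space_PiM[OF M])
  have t': "t k \<in> I" if "k \<in> K" for k using t that by auto
  have rv: "(\<lambda>\<omega>. \<omega> (t k)) \<in> measurable (PiM I M) (M (t k))" if "k \<in> K" for k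
    by (rule measurable_component_singleton[OF t'[OF that]])
  have "distr (PiM I M) (\<Pi>\<^sub>M k\<in>K. M (t k)) (\<lambda>\<omega>. \<lambda>k\<in>K. \<omega> (t k)) = (\<Pi>\<^sub>M k\<in>K. M (t k))"
    by (rule distr_PiM_reindex[OF M t])
  also have "\<dots> = (\<Pi>\<^sub>M k\<in>K. distr (PiM I M) (M (t k)) (\<lambda>\<omega>. \<omega> (t k)))"
    by (rule PiM_cong) (simp_all add: distr_PiM_component M t')
  finally show ?thesis by (subst indep_vars_iff_distr_eq_PiM'[OF K rv])
qed

text \<open>
  This transfers the independence of the coordinates of a product space to the components of the random
  character that is built from them; the two families agree only on the space of the measure.
\<close>

lemma (in prob_space) indep_vars_distr:
  assumes \<Theta>: "\<Theta> \<in> measurable M N" and I: "I \<noteq> {}"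
    and X: "\<And>i. i \<in> I \<Longrightarrow> X i \<in> measurable N (M' i)"
    and Y: "indep_vars M' Y I" "\<And>i \<omega>. i \<in> I \<Longrightarrow> \<omega> \<in> space M \<Longrightarrow> X i (\<Theta> \<omega>) = Y i \<omega>"
  shows "prob_space.indep_vars (distr M N \<Theta>) M' X I"
proof -
  interpret D: prob_space "distr M N \<Theta>" by (rule prob_space_distr[OF \<Theta>])
  have Y_meas: "Y i \<in> measurable M (M' i)" if "i \<in> I" for i
    using Y(1) that by (simp add: indep_vars_def)
  have XI: "(\<lambda>\<omega>. \<lambda>i\<in>I. X i \<omega>) \<in> measurable N (Pi\<^sub>M I M')"
    by (rule measurable_restrict[OF X])
  have "distr (distr M N \<Theta>) (Pi\<^sub>M I M') (\<lambda>\<omega>. \<lambda>i\<in>I. X i \<omega>) = distr M (Pi\<^sub>M I M') (\<lambda>\<omega>. \<lambda>i\<in>I. X i (\<Theta> \<omega>))"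
    using distr_distr[OF XI \<Theta>] by (simp add: comp_def)
  also have "\<dots> = distr M (Pi\<^sub>M I M') (\<lambda>\<omega>. \<lambda>i\<in>I. Y i \<omega>)"
    by (rule distr_cong) (auto simp: Y(2))
  also have "\<dots> = (\<Pi>\<^sub>M i\<in>I. distr M (M' i) (Y i))"
    by (rule indep_vars_iff_distr_eq_PiM'[OF I Y_meas, THEN iffD1, OF _ Y(1)])
  also have "\<dots> = (\<Pi>\<^sub>M i\<in>I. distr (distr M N \<Theta>) (M' i) (X i))"
  proof (rule PiM_cong[OF refl])
    fix i assume i: "i \<in> I"
    show "distr M (M' i) (Y i) = distr (distr M N \<Theta>) (M' i) (X i)"
      unfolding distr_distr[OF X[OF i] \<Theta>] by (rule distr_cong) (auto simp: Y(2) i)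
  qed
  finally show ?thesis
    by (subst D.indep_vars_iff_distr_eq_PiM'[OF I]) (use X in auto)
qed

definition lamp_component ::
    "('l, 'b) monoid_scheme \<Rightarrow> ('g, 'c) monoid_scheme \<Rightarrow> 'g \<Rightarrow> (('g \<Rightarrow> 'l) \<Rightarrow> complex) \<Rightarrow> 'l \<Rightarrow> complex" where
  "lamp_component \<Lambda> \<Gamma> x \<omega> = (\<lambda>l\<in>carrier \<Lambda>. \<omega> (lamp_at \<Lambda> \<Gamma> x l))"

definition product_character ::
    "('l, 'b) monoid_scheme \<Rightarrow> ('g, 'c) monoid_scheme \<Rightarrow> ('g \<Rightarrow> 'l \<Rightarrow> complex) \<Rightarrow> ('g \<Rightarrow> 'l) \<Rightarrow> complex" where
  "product_character \<Lambda> \<Gamma> \<theta> = (\<lambda>f\<in>carrier (lamps \<Lambda> \<Gamma>). \<Prod>x | x \<in> carrier \<Gamma> \<and> f x \<noteq> \<one>\<^bsub>\<Lambda>\<^esub>. \<theta> x (f x))"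

locale lamp_groups = \<Gamma>: group \<Gamma> + \<Lambda>: comm_group \<Lambda>
  for \<Gamma> :: "('g, 'c) monoid_scheme" and \<Lambda> :: "('l, 'b) monoid_scheme" +
  assumes countable_\<Gamma>: "countable (carrier \<Gamma>)"
begin

lemma lamps_iff:
  "f \<in> carrier (lamps \<Lambda> \<Gamma>) \<longleftrightarrow> f \<in> carrier \<Gamma> \<rightarrow>\<^sub>E carrier \<Lambda> \<and> finite {x \<in> carrier \<Gamma>. f x \<noteq> \<one>\<^bsub>\<Lambda>\<^esub>}"
  using carrier_sum_group[of "carrier \<Gamma>" "\<lambda>_. \<Lambda>"] \<Lambda>.is_group by auto

lemma lampsD:
  assumes "f \<in> carrier (lamps \<Lambda> \<Gamma>)"
  shows "x \<in> carrier \<Gamma> \<Longrightarrow> f x \<in> carrier \<Lambda>" "f \<in> extensional (carrier \<Gamma>)"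
    "finite {x \<in> carrier \<Gamma>. f x \<noteq> \<one>\<^bsub>\<Lambda>\<^esub>}"
  using assms by (auto simp: lamps_iff PiE_iff)

lemma comm_group_lamps: "comm_group (lamps \<Lambda> \<Gamma>)"
proof (rule group.group_comm_groupI)
  show "group (lamps \<Lambda> \<Gamma>)" using \<Lambda>.is_group by (intro sum_group)
  show "f \<otimes>\<^bsub>lamps \<Lambda> \<Gamma>\<^esub> f' = f' \<otimes>\<^bsub>lamps \<Lambda> \<Gamma>\<^esub> f"
    if "f \<in> carrier (lamps \<Lambda> \<Gamma>)" "f' \<in> carrier (lamps \<Lambda> \<Gamma>)" for f f'
    using that by (auto intro!: restrict_ext \<Lambda>.m_comm simp: lampsD)
qed

lemma lamp_at_carrier: "l \<in> carrier \<Lambda> \<Longrightarrow> lamp_at \<Lambda> \<Gamma> x l \<in> carrier (lamps \<Lambda> \<Gamma>)"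
  by (auto simp: lamps_iff lamp_at_def)

lemma lamp_at_mult:
  "l \<in> carrier \<Lambda> \<Longrightarrow> l' \<in> carrier \<Lambda> \<Longrightarrow>
   lamp_at \<Lambda> \<Gamma> x l \<otimes>\<^bsub>lamps \<Lambda> \<Gamma>\<^esub> lamp_at \<Lambda> \<Gamma> x l' = lamp_at \<Lambda> \<Gamma> x (l \<otimes>\<^bsub>\<Lambda>\<^esub> l')"
  by (auto simp: lamp_at_def fun_eq_iff)

lemma lamp_component_dual:
  assumes \<omega>: "\<omega> \<in> pontryagin_dual (lamps \<Lambda> \<Gamma>)"
  shows "lamp_component \<Lambda> \<Gamma> x \<omega> \<in> pontryagin_dual \<Lambda>"
proof -
  have "\<omega> (lamp_at \<Lambda> \<Gamma> x (l \<otimes>\<^bsub>\<Lambda>\<^esub> l')) = \<omega> (lamp_at \<Lambda> \<Gamma> x l) * \<omega> (lamp_at \<Lambda> \<Gamma> x l')"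
    if "l \<in> carrier \<Lambda>" "l' \<in> carrier \<Lambda>" for l l'
    using that by (simp only: lamp_at_mult[symmetric] dual_mult[OF \<omega>] lamp_at_carrier)
  then show ?thesis
    by (auto simp: dual_iff lamp_component_def dual_norm[OF \<omega>] lamp_at_carrier)
qed

lemma countable_lamps:
  assumes "countable (carrier \<Lambda>)" shows "countable (carrier (lamps \<Lambda> \<Gamma>))"
proof -
  let ?graph = "\<lambda>f. (\<lambda>x. (x, f x)) ` {x \<in> carrier \<Gamma>. f x \<noteq> \<one>\<^bsub>\<Lambda>\<^esub>}"
  have "?graph ` carrier (lamps \<Lambda> \<Gamma>) \<subseteq> {F. finite F \<and> F \<subseteq> carrier \<Gamma> \<times> carrier \<Lambda>}"
    by (auto simp: lampsD)
  moreover have "countable {F. finite F \<and> F \<subseteq> carrier \<Gamma> \<times> carrier \<Lambda>}"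
    using assms countable_\<Gamma> by (intro countable_Collect_finite_subset) auto
  ultimately have "countable (?graph ` carrier (lamps \<Lambda> \<Gamma>))" by (rule countable_subset)
  moreover have "inj_on ?graph (carrier (lamps \<Lambda> \<Gamma>))"
  proof (rule inj_onI)
    fix f f' assume f: "f \<in> carrier (lamps \<Lambda> \<Gamma>)" "f' \<in> carrier (lamps \<Lambda> \<Gamma>)" and eq: "?graph f = ?graph f'"
    have iff: "(x, l) \<in> ?graph f \<longleftrightarrow> x \<in> carrier \<Gamma> \<and> f x \<noteq> \<one>\<^bsub>\<Lambda>\<^esub> \<and> l = f x" for x l f by auto
    show "f = f'"
    proof (rule extensionalityI[of _ "carrier \<Gamma>"])
      fix x assume x: "x \<in> carrier \<Gamma>"
      show "f x = f' x" using iff[of x "f x" f] iff[of x "f x" f'] iff[of x "f' x" f] iff[of x "f' x" f'] eq x by metis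
    qed (use f lampsD in auto)
  qed
  ultimately show ?thesis by (simp add: countable_image_inj_eq)
qed

text \<open>
  The independent product of copies of a Haar measure on the dual of \<open>\<Lambda>\<close> turns into the Haar
  measure on the dual of the lamp group under the identification of a family of characters with
  the character \<open>f \<mapsto> \<Prod>x. \<theta> x (f x)\<close>; a nontrivial \<open>f\<close> has a factor of mean zero.
\<close>

context
  fixes Q :: "('l \<Rightarrow> complex) measure"
  assumes Q: "dual_probability \<Lambda> Q"
begin

interpretation Q: dual_probability \<Lambda> Q by (rule Q)

abbreviation "PM \<equiv> \<Pi>\<^sub>M x\<in>carrier \<Gamma>. Q"

interpretation PM: prob_space PM by (rule prob_space_PiM) (rule Q.prob_space_axioms)

lemma space_PM: "\<theta> \<in> space PM \<longleftrightarrow> \<theta> \<in> carrier \<Gamma> \<rightarrow>\<^sub>E pontryagin_dual \<Lambda>"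
  by (simp add: space_PiM Q.space_P)

lemma product_character_eq:
  assumes \<theta>: "\<theta> \<in> space PM" and f: "f \<in> carrier (lamps \<Lambda> \<Gamma>)"
    and S: "finite S" "S \<subseteq> carrier \<Gamma>" "\<And>x. x \<in> carrier \<Gamma> - S \<Longrightarrow> f x = \<one>\<^bsub>\<Lambda>\<^esub>"
  shows "product_character \<Lambda> \<Gamma> \<theta> f = (\<Prod>x\<in>S. \<theta> x (f x))"
proof -
  have "(\<Prod>x | x \<in> carrier \<Gamma> \<and> f x \<noteq> \<one>\<^bsub>\<Lambda>\<^esub>. \<theta> x (f x)) = (\<Prod>x\<in>S. \<theta> x (f x))"
  proof (rule prod.mono_neutral_left[OF S(1)])
    show "\<forall>x\<in>S - {x \<in> carrier \<Gamma>. f x \<noteq> \<one>\<^bsub>\<Lambda>\<^esub>}. \<theta> x (f x) = 1"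
      using \<theta> S(2) \<Lambda>.dual_one by (auto simp: space_PM PiE_iff)
  qed (use S in auto)
  then show ?thesis using f by (simp add: product_character_def)
qed

lemma product_character_dual:
  assumes \<theta>: "\<theta> \<in> space PM"
  shows "product_character \<Lambda> \<Gamma> \<theta> \<in> pontryagin_dual (lamps \<Lambda> \<Gamma>)"
proof -
  interpret L: comm_group "lamps \<Lambda> \<Gamma>" by (rule comm_group_lamps)
  have \<theta>': "\<theta> x \<in> pontryagin_dual \<Lambda>" if "x \<in> carrier \<Gamma>" for x using \<theta> that by (auto simp: space_PM)
  have "product_character \<Lambda> \<Gamma> \<theta> (f \<otimes>\<^bsub>lamps \<Lambda> \<Gamma>\<^esub> f') = product_character \<Lambda> \<Gamma> \<theta> f * product_character \<Lambda> \<Gamma> \<theta> f'"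
    if f: "f \<in> carrier (lamps \<Lambda> \<Gamma>)" "f' \<in> carrier (lamps \<Lambda> \<Gamma>)" for f f'
  proof -
    let ?S = "{x \<in> carrier \<Gamma>. f x \<noteq> \<one>\<^bsub>\<Lambda>\<^esub>} \<union> {x \<in> carrier \<Gamma>. f' x \<noteq> \<one>\<^bsub>\<Lambda>\<^esub>}"
    have S: "finite ?S" "?S \<subseteq> carrier \<Gamma>" using f lampsD(3) by auto
    have "product_character \<Lambda> \<Gamma> \<theta> (f \<otimes>\<^bsub>lamps \<Lambda> \<Gamma>\<^esub> f') = (\<Prod>x\<in>?S. \<theta> x ((f \<otimes>\<^bsub>lamps \<Lambda> \<Gamma>\<^esub> f') x))"
      using L.m_closed[OF f] by (intro product_character_eq[OF \<theta> _ S]) auto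
    also have "\<dots> = (\<Prod>x\<in>?S. \<theta> x (f x) * \<theta> x (f' x))"
      using f by (intro prod.cong) (auto simp: dual_mult[OF \<theta>'] lampsD)
    also have "\<dots> = (\<Prod>x\<in>?S. \<theta> x (f x)) * (\<Prod>x\<in>?S. \<theta> x (f' x))" by (rule prod.distrib)
    also have "(\<Prod>x\<in>?S. \<theta> x (f x)) = product_character \<Lambda> \<Gamma> \<theta> f"
      by (rule product_character_eq[OF \<theta> f(1) S, symmetric]) auto
    also have "(\<Prod>x\<in>?S. \<theta> x (f' x)) = product_character \<Lambda> \<Gamma> \<theta> f'"
      by (rule product_character_eq[OF \<theta> f(2) S, symmetric]) auto
    finally show ?thesis .
  qed
  moreover have "cmod (product_character \<Lambda> \<Gamma> \<theta> f) = 1" if f: "f \<in> carrier (lamps \<Lambda> \<Gamma>)" for f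
  proof -
    have "cmod (\<theta> x (f x)) = 1" if "x \<in> carrier \<Gamma>" for x
      using \<theta>'[OF that] lampsD(1)[OF f that] by (rule dual_norm)
    then show ?thesis using f by (simp add: product_character_def prod_norm[symmetric])
  qed
  ultimately show ?thesis by (auto simp: dual_iff product_character_def simp del: mult_sum_group)
qed

lemma product_character_lamp_at:
  assumes \<theta>: "\<theta> \<in> space PM" and x: "x \<in> carrier \<Gamma>" and l: "l \<in> carrier \<Lambda>"
  shows "product_character \<Lambda> \<Gamma> \<theta> (lamp_at \<Lambda> \<Gamma> x l) = \<theta> x l"
  using product_character_eq[OF \<theta> lamp_at_carrier[OF l], of "{x}" x] x by (auto simp: lamp_at_def)

lemma lamp_component_product_character:
  assumes \<theta>: "\<theta> \<in> space PM" and x: "x \<in> carrier \<Gamma>"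
  shows "lamp_component \<Lambda> \<Gamma> x (product_character \<Lambda> \<Gamma> \<theta>) = \<theta> x"
proof (rule extensionalityI[of _ "carrier \<Lambda>"])
  show "\<theta> x \<in> extensional (carrier \<Lambda>)" using \<theta> x by (auto simp: space_PM dual_iff PiE_iff)
qed (auto simp: lamp_component_def product_character_lamp_at \<theta> x)

lemma measurable_PM_eval:
  assumes "x \<in> carrier \<Gamma>" "l \<in> carrier \<Lambda>"
  shows "(\<lambda>\<theta>. \<theta> x l) \<in> borel_measurable PM"
  using measurable_compose[OF measurable_component_singleton[OF assms(1)] Q.measurable_eval[OF assms(2)]] .

lemma product_character_measurable:
  "product_character \<Lambda> \<Gamma> \<in> measurable PM (char_space (lamps \<Lambda> \<Gamma>))"
proof (rule measurable_char_spaceI[OF product_character_dual])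
  fix f assume f: "f \<in> carrier (lamps \<Lambda> \<Gamma>)"
  have "(\<lambda>\<theta>. \<Prod>x | x \<in> carrier \<Gamma> \<and> f x \<noteq> \<one>\<^bsub>\<Lambda>\<^esub>. \<theta> x (f x)) \<in> borel_measurable PM"
    using f by (intro borel_measurable_prod measurable_PM_eval) (auto simp: lampsD)
  then show "(\<lambda>\<theta>. product_character \<Lambda> \<Gamma> \<theta> f) \<in> borel_measurable PM"
    using f by (simp add: product_character_def)
qed

definition lamp_measure :: "(('g \<Rightarrow> 'l) \<Rightarrow> complex) measure" where
  "lamp_measure = distr PM (char_space (lamps \<Lambda> \<Gamma>)) (product_character \<Lambda> \<Gamma>)"

lemma dual_probability_lamp_measure: "dual_probability (lamps \<Lambda> \<Gamma>) lamp_measure"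
proof -
  interpret L: comm_group "lamps \<Lambda> \<Gamma>" by (rule comm_group_lamps)
  interpret P: prob_space lamp_measure
    unfolding lamp_measure_def by (rule PM.prob_space_distr[OF product_character_measurable])
  show ?thesis
  proof
    show "countable (carrier (lamps \<Lambda> \<Gamma>))" by (rule countable_lamps[OF Q.countable_carrier])
    show "sets lamp_measure = sets (char_space (lamps \<Lambda> \<Gamma>))" by (simp add: lamp_measure_def)
    fix f assume f: "f \<in> carrier (lamps \<Lambda> \<Gamma>)"
    let ?S = "{x \<in> carrier \<Gamma>. f x \<noteq> \<one>\<^bsub>\<Lambda>\<^esub>}"
    have S: "finite ?S" using lampsD(3)[OF f] .
    have "(\<integral>\<omega>. \<omega> f \<partial>lamp_measure) = (\<integral>\<theta>. product_character \<Lambda> \<Gamma> \<theta> f \<partial>PM)"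
      unfolding lamp_measure_def
      by (rule integral_distr[OF product_character_measurable measurable_char_space_eval[OF f]])
    also have "\<dots> = (\<integral>\<theta>. (\<Prod>x\<in>?S. \<theta> x (f x)) \<partial>PM)"
      using f by (simp add: product_character_def)
    also have "\<dots> = (\<Prod>x\<in>?S. \<integral>\<theta>. \<theta> x (f x) \<partial>PM)"
    proof (rule PM.indep_vars_lebesgue_integral[OF S])
      have "PM.indep_vars (\<lambda>_. Q) (\<lambda>x \<theta>. \<theta> x) (carrier \<Gamma>)"
        using prob_space_PiM_indep_vars[of "carrier \<Gamma>" "\<lambda>_. Q" "\<lambda>x. x" "carrier \<Gamma>"]
          Q.prob_space_axioms \<Gamma>.one_closed by auto
      then have "PM.indep_vars (\<lambda>_. Q) (\<lambda>x \<theta>. \<theta> x) ?S" by (rule PM.indep_vars_subset) auto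
      then show "PM.indep_vars (\<lambda>_. borel) (\<lambda>x \<theta>. \<theta> x (f x)) ?S"
        by (rule PM.indep_vars_compose2[where Y = "\<lambda>x \<omega>. \<omega> (f x)"])
          (auto simp: lampsD f intro!: Q.measurable_eval)
      fix x assume x: "x \<in> ?S"
      show "integrable PM (\<lambda>\<theta>. \<theta> x (f x))"
      proof (rule PM.integrable_const_bound[of _ 1])
        show "AE \<theta> in PM. norm (\<theta> x (f x)) \<le> 1"
        proof (rule AE_I2)
          fix \<theta> assume "\<theta> \<in> space PM"
          then have "\<theta> x \<in> pontryagin_dual \<Lambda>" using x by (auto simp: space_PM)
          then show "norm (\<theta> x (f x)) \<le> 1" using x by (simp add: dual_norm lampsD[OF f])
        qed
        show "(\<lambda>\<theta>. \<theta> x (f x)) \<in> borel_measurable PM"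
          using x by (intro measurable_PM_eval) (auto simp: lampsD f)
      qed
    qed
    also have "\<dots> = (\<Prod>x\<in>?S. 0)"
    proof (rule prod.cong[OF refl])
      fix x assume x: "x \<in> ?S"
      have "(\<integral>\<theta>. \<theta> x (f x) \<partial>PM) = (\<integral>\<omega>. \<omega> (f x) \<partial>distr PM Q (\<lambda>\<theta>. \<theta> x))"
        using x by (subst integral_distr) (auto intro: Q.measurable_eval simp: lampsD f)
      also have "distr PM Q (\<lambda>\<theta>. \<theta> x) = Q"
        using x by (intro distr_PiM_component) (auto intro: Q.prob_space_axioms)
      also have "(\<integral>\<omega>. \<omega> (f x) \<partial>Q) = 0" using x by (simp add: Q.mean lampsD f)
      finally show "(\<integral>\<theta>. \<theta> x (f x) \<partial>PM) = 0" .
    qed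
    also have "\<dots> = (if f = \<one>\<^bsub>lamps \<Lambda> \<Gamma>\<^esub> then 1 else 0)"
    proof -
      have "f = \<one>\<^bsub>lamps \<Lambda> \<Gamma>\<^esub> \<longleftrightarrow> ?S = {}"
        using lampsD(2)[OF f] by (auto simp: extensional_def fun_eq_iff)
      then show ?thesis using S by (auto simp: card_gt_0_iff zero_power)
    qed
    finally show "(\<integral>\<omega>. \<omega> f \<partial>lamp_measure) = (if f = \<one>\<^bsub>lamps \<Lambda> \<Gamma>\<^esub> then 1 else 0)" .
  qed
qed

lemma lamp_component_measurable:
  assumes x: "x \<in> carrier \<Gamma>"
  shows "lamp_component \<Lambda> \<Gamma> x \<in> measurable lamp_measure Q"
proof -
  have "lamp_component \<Lambda> \<Gamma> x \<in> measurable (char_space (lamps \<Lambda> \<Gamma>)) (char_space \<Lambda>)"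
  proof (rule measurable_char_spaceI)
    fix \<omega> assume "\<omega> \<in> space (char_space (lamps \<Lambda> \<Gamma>))"
    then show "lamp_component \<Lambda> \<Gamma> x \<omega> \<in> pontryagin_dual \<Lambda>" by (intro lamp_component_dual) simp
  next
    fix l assume "l \<in> carrier \<Lambda>"
    then show "(\<lambda>\<omega>. lamp_component \<Lambda> \<Gamma> x \<omega> l) \<in> borel_measurable (char_space (lamps \<Lambda> \<Gamma>))"
      by (simp add: lamp_component_def measurable_char_space_eval lamp_at_carrier)
  qed
  then show ?thesis
    by (simp add: measurable_cong_sets[OF _ Q.sets_P] lamp_measure_def)
qed

lemma distr_lamp_component:
  assumes x: "x \<in> carrier \<Gamma>"
  shows "distr lamp_measure Q (lamp_component \<Lambda> \<Gamma> x) = Q"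
proof -
  have "lamp_component \<Lambda> \<Gamma> x \<in> measurable (char_space (lamps \<Lambda> \<Gamma>)) Q"
    using lamp_component_measurable[OF x] by (simp add: lamp_measure_def)
  then have "distr lamp_measure Q (lamp_component \<Lambda> \<Gamma> x) = distr PM Q (\<lambda>\<theta>. lamp_component \<Lambda> \<Gamma> x (product_character \<Lambda> \<Gamma> \<theta>))"
    by (simp add: lamp_measure_def distr_distr[OF _ product_character_measurable] comp_def)
  also have "\<dots> = distr PM Q (\<lambda>\<theta>. \<theta> x)"
    by (rule distr_cong) (auto simp: lamp_component_product_character x)
  also have "\<dots> = Q" using x by (intro distr_PiM_component) (auto intro: Q.prob_space_axioms)
  finally show ?thesis .
qed

lemma indep_lamp_components:
  assumes t: "inj_on t (carrier \<Gamma>)" "t \<in> carrier \<Gamma> \<rightarrow> carrier \<Gamma>"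
  shows "prob_space.indep_vars lamp_measure (\<lambda>_. Q) (\<lambda>x. lamp_component \<Lambda> \<Gamma> (t x)) (carrier \<Gamma>)"
  unfolding lamp_measure_def
proof (rule PM.indep_vars_distr[OF product_character_measurable])
  show "carrier \<Gamma> \<noteq> {}" using \<Gamma>.one_closed by auto
  show "lamp_component \<Lambda> \<Gamma> (t x) \<in> measurable (char_space (lamps \<Lambda> \<Gamma>)) Q" if "x \<in> carrier \<Gamma>" for x
    using lamp_component_measurable[of "t x"] t that by (auto simp: lamp_measure_def)
  show "PM.indep_vars (\<lambda>_. Q) (\<lambda>x \<theta>. \<theta> (t x)) (carrier \<Gamma>)"
    using prob_space_PiM_indep_vars[of "carrier \<Gamma>" "\<lambda>_. Q" t "carrier \<Gamma>"] t
      Q.prob_space_axioms \<Gamma>.one_closed by auto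
  show "lamp_component \<Lambda> \<Gamma> (t x) (product_character \<Lambda> \<Gamma> \<theta>) = \<theta> (t x)"
    if "x \<in> carrier \<Gamma>" "\<theta> \<in> space PM" for x \<theta>
    using that t by (intro lamp_component_product_character) auto
qed

end

end

section \<open>Spectral measures are determined by their moments\<close>

text \<open>
  Rounding \<open>t\<close> down to a multiple of \<open>1/n\<close> turns the integral of \<open>t\<close> into a sum over intervals.  Such
  sums are linear in the measure, which is what makes polarization available for spectral measures
  below.
\<close>

lemma tendsto_integral_floor:
  fixes g :: "real \<Rightarrow> complex"
  assumes M: "sets M = sets borel" and g: "integrable M g" and supp: "AE t in M. \<bar>t\<bar> \<le> real N"
  shows "(\<lambda>n. \<Sum>j\<in>{- int (N * Suc n)..int (N * Suc n)}. complex_of_real (of_int j / real (Suc n)) *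
      (\<integral>t. indicator {of_int j / real (Suc n)..<(of_int j + 1) / real (Suc n)} t * g t \<partial>M))
    \<longlonglongrightarrow> (\<integral>t. complex_of_real t * g t \<partial>M)"
proof -
  have [measurable_cong]: "sets M = sets borel" by fact
  let ?J = "\<lambda>n. {- int (N * Suc n)..int (N * Suc n)}"
  let ?I = "\<lambda>n j. {of_int j / real (Suc n)..<(of_int j + 1) / real (Suc n)}"
  define r where "r n t = (\<Sum>j\<in>?J n. complex_of_real (of_int j / real (Suc n)) * indicator (?I n j) t)" for n t
  have [measurable]: "g \<in> borel_measurable M" using g by auto
  have int: "integrable M (\<lambda>t. indicator (?I n j) t * g t)" for n and j :: int
    by (rule Bochner_Integration.integrable_bound[OF g]) (auto simp: norm_mult indicator_def)
  have r_eq: "r n t = complex_of_real (of_int \<lfloor>t * real (Suc n)\<rfloor> / real (Suc n))" if t: "\<bar>t\<bar> \<le> real N" for n t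
  proof -
    have mem: "t \<in> ?I n j \<longleftrightarrow> j = \<lfloor>t * real (Suc n)\<rfloor>" for j
      by (auto simp: field_simps floor_eq_iff eq_commute[of j] simp del: of_nat_Suc)
    have "\<bar>t * real (Suc n)\<bar> \<le> real N * real (Suc n)"
      unfolding abs_mult using t by (intro mult_mono) auto
    then have le: "t * real (Suc n) \<le> of_int (int (N * Suc n))" "of_int (- int (N * Suc n)) \<le> t * real (Suc n)"
      unfolding of_int_minus of_int_of_nat_eq unfolding of_nat_mult by linarith+
    have "\<lfloor>t * real (Suc n)\<rfloor> \<in> ?J n"
      using floor_mono[OF le(1)] le(2) by (simp only: atLeastAtMost_iff floor_of_int le_floor_iff)
    moreover have "r n t = (\<Sum>j\<in>?J n. if j = \<lfloor>t * real (Suc n)\<rfloor> then complex_of_real (of_int j / real (Suc n)) else 0)"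
      unfolding r_def by (intro sum.cong refl) (simp only: indicator_def mem, simp)
    ultimately show ?thesis by (simp add: sum.delta)
  qed
  have "(\<lambda>n. \<integral>t. r n t * g t \<partial>M) \<longlonglongrightarrow> (\<integral>t. complex_of_real t * g t \<partial>M)"
  proof (rule integral_dominated_convergence[where w = "\<lambda>t. (real N + 1) * norm (g t)"])
    show "integrable M (\<lambda>t. (real N + 1) * norm (g t))" using g by auto
    show "AE t in M. (\<lambda>n. r n t * g t) \<longlonglongrightarrow> complex_of_real t * g t"
      using supp
    proof eventually_elim
      case (elim t)
      have "(\<lambda>n. of_int \<lfloor>t * real (Suc n)\<rfloor> / real (Suc n)) \<longlonglongrightarrow> t"
      proof (rule LIM_zero_cancel, rule Lim_null_comparison)
        have "\<bar>of_int \<lfloor>t * real (Suc n)\<rfloor> / real (Suc n) - t\<bar> \<le> inverse (real (Suc n))" for n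
        proof -
          have "\<bar>of_int \<lfloor>t * real (Suc n)\<rfloor> - t * real (Suc n)\<bar> \<le> 1" by linarith
          then have "\<bar>of_int \<lfloor>t * real (Suc n)\<rfloor> - t * real (Suc n)\<bar> / real (Suc n) \<le> 1 / real (Suc n)"
            by (intro divide_right_mono) auto
          also have "\<bar>of_int \<lfloor>t * real (Suc n)\<rfloor> - t * real (Suc n)\<bar> / real (Suc n) =
              \<bar>(of_int \<lfloor>t * real (Suc n)\<rfloor> - t * real (Suc n)) / real (Suc n)\<bar>"
            by (simp only: abs_divide abs_of_nat)
          also have "(of_int \<lfloor>t * real (Suc n)\<rfloor> - t * real (Suc n)) / real (Suc n) =
              of_int \<lfloor>t * real (Suc n)\<rfloor> / real (Suc n) - t"
            by (simp only: diff_divide_distrib) simp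
          finally show ?thesis by (simp only: inverse_eq_divide)
        qed
        then show "\<forall>\<^sub>F n in sequentially. norm (of_int \<lfloor>t * real (Suc n)\<rfloor> / real (Suc n) - t) \<le> inverse (real (Suc n))"
          by (intro always_eventually) (simp only: real_norm_def, blast)
      qed (rule LIMSEQ_inverse_real_of_nat)
      then show ?case
        unfolding r_eq[OF elim] by (intro tendsto_mult tendsto_of_real tendsto_const)
    qed
    show "AE t in M. norm (r n t * g t) \<le> (real N + 1) * norm (g t)" for n
      using supp
    proof eventually_elim
      case (elim t)
      have "\<bar>of_int \<lfloor>t * real (Suc n)\<rfloor>\<bar> \<le> \<bar>t * real (Suc n)\<bar> + 1" by linarith
      also have "\<dots> \<le> real N * real (Suc n) + real (Suc n)"
        using elim by (intro add_mono) (auto simp: abs_mult simp del: of_nat_Suc intro!: mult_right_mono)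
      finally have "\<bar>of_int \<lfloor>t * real (Suc n)\<rfloor>\<bar> / real (Suc n) \<le> real N + 1"
        by (simp add: field_simps)
      then show ?case unfolding r_eq[OF elim] norm_mult norm_of_real abs_divide
        by (intro mult_right_mono) auto
    qed
    show "(\<lambda>t. r n t * g t) \<in> borel_measurable M" for n unfolding r_def by measurable
  qed measurable
  moreover have "(\<integral>t. r n t * g t \<partial>M) = (\<Sum>j\<in>?J n. complex_of_real (of_int j / real (Suc n)) *
      (\<integral>t. indicator (?I n j) t * g t \<partial>M))" for n
  proof -
    have "(\<integral>t. r n t * g t \<partial>M) = (\<integral>t. (\<Sum>j\<in>?J n. complex_of_real (of_int j / real (Suc n)) * (indicator (?I n j) t * g t)) \<partial>M)"
      unfolding r_def sum_distrib_right by (simp only: mult.assoc)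
    also have "\<dots> = (\<Sum>j\<in>?J n. \<integral>t. complex_of_real (of_int j / real (Suc n)) * (indicator (?I n j) t * g t) \<partial>M)"
      by (rule Bochner_Integration.integral_sum) (rule integrable_mult_right[OF int])
    finally show ?thesis by (simp only: integral_mult_right_zero)
  qed
  ultimately show ?thesis by simp
qed

text \<open>
  The moments are the Taylor coefficients of the characteristic function.  For bounded support the
  remainder is at most a constant times \<open>(\<bar>s\<bar> R)\<^sup>n / n!\<close>, so they determine the characteristic function.
\<close>

lemma real_distribution_eqI_moments:
  assumes M: "real_distribution M" "AE t in M. \<bar>t\<bar> \<le> R" and N: "real_distribution N" "AE t in N. \<bar>t\<bar> \<le> R"
    and eq: "\<And>k. (\<integral>t. t ^ k \<partial>M) = (\<integral>t. t ^ k \<partial>N)"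
  shows "M = N"
proof (rule Levy_uniqueness[OF M(1) N(1)], rule ext)
  fix s
  have approx: "cmod (char M s - (\<Sum>k\<le>n. ((\<i> * s)^k / fact k) * (\<integral>t. t ^ k \<partial>M))) \<le> 2 * (inverse (fact n) * (\<bar>s\<bar> * \<bar>R\<bar>) ^ n)"
    if M: "real_distribution M" and R: "AE t in M. \<bar>t\<bar> \<le> R" for M :: "real measure" and n
  proof -
    interpret real_distribution M by fact
    have bound: "AE t in M. \<bar>t\<bar> ^ k \<le> \<bar>R\<bar> ^ k" for k
      using R by eventually_elim (auto intro: power_mono)
    have int: "integrable M (\<lambda>t. t ^ k)" for k
      using bound by (intro integrable_const_bound[of _ "\<bar>R\<bar> ^ k"]) (auto simp: power_abs)
    have "(\<integral>t. \<bar>t\<bar> ^ n \<partial>M) \<le> (\<integral>t. \<bar>R\<bar> ^ n \<partial>M)"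
      using bound[of n] int[of n] by (intro integral_mono_AE) (auto simp: power_abs[symmetric])
    then have "(\<integral>t. \<bar>t\<bar> ^ n \<partial>M) \<le> \<bar>R\<bar> ^ n"
      using prob_space by (simp add: space_eq_univ)
    then have "(2 * \<bar>s\<bar>^n / fact n) * (\<integral>t. \<bar>t\<bar> ^ n \<partial>M) \<le> (2 * \<bar>s\<bar>^n / fact n) * \<bar>R\<bar> ^ n"
      by (intro mult_left_mono) auto
    then show ?thesis using char_approx1[of n s, OF int]
      by (simp add: power_mult_distrib field_simps)
  qed
  have bound: "cmod (char M s - char N s) \<le> 4 * (inverse (fact n) * (\<bar>s\<bar> * \<bar>R\<bar>) ^ n)" for n
    using approx[OF M, of n] approx[OF N, of n] unfolding eq
    by (smt (verit) norm_triangle_ineq4 diff_diff_eq2 diff_add_cancel norm_minus_commute norm_triangle_ineq add_diff_eq)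
  have lim: "(\<lambda>n. 4 * (inverse (fact n) * (\<bar>s\<bar> * \<bar>R\<bar>) ^ n)) \<longlonglongrightarrow> 4 * 0"
    by (intro tendsto_mult tendsto_const summable_LIMSEQ_zero summable_exp)
  have "cmod (char M s - char N s) \<le> 4 * 0"
    by (rule LIMSEQ_le_const[OF lim]) (use bound in blast)
  then show "char M s = char N s" by simp
qed

lemma self_adjoint_opD:
  assumes "self_adjoint_op X L"
  shows "u \<in> ell2 X \<Longrightarrow> L u \<in> ell2 X"
    and "u \<in> ell2 X \<Longrightarrow> w \<in> ell2 X \<Longrightarrow> L (\<lambda>x. u x + w x) = (\<lambda>x. L u x + L w x)"
    and "u \<in> ell2 X \<Longrightarrow> L (\<lambda>x. c * u x) = (\<lambda>x. c * L u x)"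
    and "u \<in> ell2 X \<Longrightarrow> w \<in> ell2 X \<Longrightarrow> ell2_inner X (L u) w = ell2_inner X u (L w)"
  using assms by (auto simp: self_adjoint_op_def bounded_op_def)

lemma quadratic_form_polarization:
  assumes T: "self_adjoint_op X T" and a: "a \<in> ell2 X" and b: "b \<in> ell2 X"
  shows "4 * ell2_inner X a (T b) =
    (\<Sum>c\<in>{1, -1, \<i>, -\<i>}. cnj c * ell2_inner X (\<lambda>x. a x + c * b x) (T (\<lambda>x. a x + c * b x)))"
proof -
  have "ell2_inner X (\<lambda>x. a x + c * b x) (T (\<lambda>x. a x + c * b x)) =
      ell2_inner X a (T a) + c * ell2_inner X a (T b) + cnj c * ell2_inner X b (T a) + c * cnj c * ell2_inner X b (T b)" for c
    using a b self_adjoint_opD(1)[OF T]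
    by (simp add: self_adjoint_opD(2,3)[OF T] ell2_inner_add_left ell2_inner_add_right
        ell2_inner_cmult_left ell2_inner_cmult_right ell2_cmult ell2_add algebra_simps)
  moreover have "(\<Sum>c\<in>{1, -1, \<i>, -\<i>}. f c) = f 1 + (f (-1) + (f \<i> + f (-\<i>)))" for f :: "complex \<Rightarrow> complex"
    by (simp add: complex_eq_iff)
  ultimately show ?thesis by (simp add: algebra_simps)
qed

locale resolution =
  fixes X :: "'a set" and L :: "'a op" and E :: "real set \<Rightarrow> 'a op"
  assumes L: "self_adjoint_op X L" and res: "is_spectral_resolution X L E"
begin

lemma E_projection: "S \<in> sets borel \<Longrightarrow> self_adjoint_op X (E S)"
  and E_UNIV: "u \<in> ell2 X \<Longrightarrow> E UNIV u = u"
  and E_Int: "S \<in> sets borel \<Longrightarrow> T \<in> sets borel \<Longrightarrow> u \<in> ell2 X \<Longrightarrow> E (S \<inter> T) u = E S (E T u)"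
  and E_sums: "range A \<subseteq> sets borel \<Longrightarrow> disjoint_family A \<Longrightarrow> u \<in> ell2 X \<Longrightarrow> w \<in> ell2 X \<Longrightarrow>
      (\<lambda>n. ell2_inner X u (E (A n) w)) sums ell2_inner X u (E (\<Union>n. A n) w)"
  using res by (auto simp: is_spectral_resolution_def projection_valued_measure_def orthogonal_projection_def)

lemma E_ell2: "S \<in> sets borel \<Longrightarrow> u \<in> ell2 X \<Longrightarrow> E S u \<in> ell2 X"
  using self_adjoint_opD(1)[OF E_projection] .

lemma E_quadratic:
  assumes "S \<in> sets borel" "u \<in> ell2 X"
  shows "ell2_inner X u (E S u) = complex_of_real ((ell2_norm X (E S u))\<^sup>2)"
proof -
  have "ell2_inner X u (E S u) = ell2_inner X u (E S (E S u))"
    using E_Int[of S S u] assms by simp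
  also have "\<dots> = ell2_inner X (E S u) (E S u)"
    using assms by (simp add: self_adjoint_opD(4)[OF E_projection] E_ell2)
  finally show ?thesis by (simp add: ell2_inner_self)
qed

lemma sets_diagonal: "sets (diagonal_measure X E u) = sets borel"
  unfolding diagonal_measure_def using sets.sigma_sets_eq[of "borel :: real measure"]
  by (subst sets_measure_of) auto

lemma space_diagonal: "space (diagonal_measure X E u) = UNIV"
  using sets_eq_imp_space_eq[OF sets_diagonal] by simp

lemma emeasure_diagonal:
  assumes u: "u \<in> ell2 X" and S: "S \<in> sets borel"
  shows "emeasure (diagonal_measure X E u) S = ennreal (Re (ell2_inner X u (E S u)))"
proof -
  let ?\<mu> = "\<lambda>S. Re (ell2_inner X u (E S u))"
  have nonneg: "0 \<le> ?\<mu> S" if "S \<in> sets borel" for S using E_quadratic[OF that u] by simp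
  have sums: "(\<lambda>n. ?\<mu> (A n)) sums ?\<mu> (\<Union>n. A n)" if "range A \<subseteq> sets borel" "disjoint_family A" for A
    using sums_Re[OF E_sums[OF that u u]] .
  show ?thesis
  proof (rule emeasure_measure_of[OF diagonal_measure_def])
    show "positive (sets (diagonal_measure X E u)) (\<lambda>S. ennreal (?\<mu> S))"
    proof -
      have "(\<lambda>n :: nat. ?\<mu> {}) sums ?\<mu> {}" using sums[of "\<lambda>_. {}"] by (simp add: disjoint_family_on_def)
      then have "?\<mu> {} = 0" by (metis sums_summable summable_const_iff)
      then show ?thesis by (simp add: positive_def)
    qed
    show "countably_additive (sets (diagonal_measure X E u)) (\<lambda>S. ennreal (?\<mu> S))"
      unfolding countably_additive_def sets_diagonal
    proof (intro allI impI)
      fix A :: "nat \<Rightarrow> real set" assume A: "range A \<subseteq> sets borel" "disjoint_family A"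
      then have "A n \<in> sets borel" for n by auto
      then show "(\<Sum>n. ennreal (?\<mu> (A n))) = ennreal (?\<mu> (\<Union>n. A n))"
        using sums[OF A] nonneg by (simp add: suminf_ennreal2 sums_iff)
    qed
  qed (use S sets_diagonal in \<open>auto simp: sets_diagonal\<close>)
qed

lemma finite_measure_diagonal: "u \<in> ell2 X \<Longrightarrow> finite_measure (diagonal_measure X E u)"
  by (intro finite_measureI) (simp add: space_diagonal emeasure_diagonal)

lemma bounded_support: "\<exists>N. \<forall>u\<in>ell2 X. AE t in diagonal_measure X E u. \<bar>t\<bar> \<le> real N"
proof -
  obtain R where R: "\<And>u. u \<in> ell2 X \<Longrightarrow> E {-R..R} u = u"
    using res by (auto simp: is_spectral_resolution_def)
  obtain N where N: "R \<le> real N" using real_arch_simple by blast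
  have "AE t in diagonal_measure X E u. \<bar>t\<bar> \<le> real N" if u: "u \<in> ell2 X" for u
  proof -
    let ?M = "diagonal_measure X E u"
    interpret finite_measure ?M by (rule finite_measure_diagonal[OF u])
    have "emeasure ?M {-R..R} = emeasure ?M UNIV" by (simp add: emeasure_diagonal u R E_UNIV)
    then have "emeasure ?M (UNIV - {-R..R}) = 0"
      by (subst emeasure_Diff) (auto simp: sets_diagonal emeasure_eq_measure)
    then have "UNIV - {-R..R} \<in> null_sets ?M" by (auto simp: null_sets_def sets_diagonal)
    then have "AE t in ?M. t \<notin> UNIV - {-R..R}" by (rule AE_not_in)
    then show ?thesis by eventually_elim (use N in auto)
  qed
  then show ?thesis by blast
qed

text \<open>
  The defining identity for the quadratic form of \<open>L\<close> passes to the sesquilinear form: both sides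
  are limits of the same Riemann sums over intervals of length \<open>1/n\<close>, and on each interval
  polarization applies to the projection.
\<close>

lemma inner_L_eq_integral:
  fixes M :: "real measure" and g :: "real \<Rightarrow> complex"
  assumes a: "a \<in> ell2 X" and b: "b \<in> ell2 X"
    and M: "sets M = sets borel" "integrable M g" and supp: "\<exists>N. AE t in M. \<bar>t\<bar> \<le> real N"
    and eq: "\<And>S. S \<in> sets borel \<Longrightarrow> ell2_inner X a (E S b) = (\<integral>t. indicator S t * g t \<partial>M)"
  shows "ell2_inner X a (L b) = (\<integral>t. complex_of_real t * g t \<partial>M)"
proof -
  obtain N1 where N1: "\<And>u. u \<in> ell2 X \<Longrightarrow> AE t in diagonal_measure X E u. \<bar>t\<bar> \<le> real N1"
    using bounded_support by blast
  obtain N2 where N2: "AE t in M. \<bar>t\<bar> \<le> real N2" using supp by blast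
  define N where "N = max N1 N2"
  have N: "AE t in M. \<bar>t\<bar> \<le> real N" using N2 by eventually_elim (simp add: N_def)
  have N': "AE t in diagonal_measure X E u. \<bar>t\<bar> \<le> real N" if "u \<in> ell2 X" for u
    using N1[OF that] by eventually_elim (simp add: N_def)
  let ?J = "\<lambda>n. {- int (N * Suc n)..int (N * Suc n)}"
  let ?I = "\<lambda>n j. {of_int j / real (Suc n)..<(of_int j + 1) / real (Suc n)}"
  let ?r = "\<lambda>T n. \<Sum>j\<in>?J n. complex_of_real (of_int j / real (Suc n)) * T (?I n j)"
  have quad: "(\<lambda>n. ?r (\<lambda>S. ell2_inner X u (E S u)) n) \<longlonglongrightarrow> ell2_inner X u (L u)" if u: "u \<in> ell2 X" for u
  proof -
    let ?M = "diagonal_measure X E u"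
    interpret finite_measure ?M by (rule finite_measure_diagonal[OF u])
    have ind: "(\<integral>t. indicator S t * 1 \<partial>?M) = ell2_inner X u (E S u)" if S: "S \<in> sets borel" for S
    proof -
      have "(\<integral>t. indicator S t * 1 \<partial>?M) = (\<integral>t. complex_of_real (indicator S t) \<partial>?M)"
        by (intro Bochner_Integration.integral_cong) (auto simp: indicator_def)
      also have "\<dots> = complex_of_real (measure ?M S)"
        using S by (simp only: integral_complex_of_real Bochner_Integration.integral_indicator) (simp add: space_diagonal)
      also have "\<dots> = ell2_inner X u (E S u)"
        using E_quadratic[OF S u] by (simp add: measure_def emeasure_diagonal u S)
      finally show ?thesis .
    qed
    have "(\<lambda>n. ?r (\<lambda>S. \<integral>t. indicator S t * 1 \<partial>?M) n) \<longlonglongrightarrow> (\<integral>t. complex_of_real t * 1 \<partial>?M)"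
      by (rule tendsto_integral_floor[OF sets_diagonal _ N'[OF u]]) simp
    moreover have "(\<integral>t. complex_of_real t * 1 \<partial>?M) = ell2_inner X u (L u)"
      using res u by (simp add: is_spectral_resolution_def)
    ultimately show ?thesis by (simp only: ind atLeastLessThan_borel)
  qed
  let ?C = "{1, -1, \<i>, -\<i>}" and ?u = "\<lambda>c x. a x + c * b x"
  have u: "?u c \<in> ell2 X" for c using a b by (intro ell2_add ell2_cmult)
  have "(\<lambda>n. \<Sum>c\<in>?C. cnj c * ?r (\<lambda>S. ell2_inner X (?u c) (E S (?u c))) n)
      \<longlonglongrightarrow> (\<Sum>c\<in>?C. cnj c * ell2_inner X (?u c) (L (?u c)))"
    by (intro tendsto_sum tendsto_mult tendsto_const quad u)
  also have "(\<lambda>n. \<Sum>c\<in>?C. cnj c * ?r (\<lambda>S. ell2_inner X (?u c) (E S (?u c))) n) =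
      (\<lambda>n. 4 * ?r (\<lambda>S. ell2_inner X a (E S b)) n)"
  proof
    fix n
    have "(\<Sum>c\<in>?C. cnj c * ?r (\<lambda>S. ell2_inner X (?u c) (E S (?u c))) n) =
        (\<Sum>j\<in>?J n. complex_of_real (of_int j / real (Suc n)) *
          (\<Sum>c\<in>?C. cnj c * ell2_inner X (?u c) (E (?I n j) (?u c))))"
      unfolding sum_distrib_left by (subst sum.swap) (simp only: mult.left_commute)
    also have "\<dots> = (\<Sum>j\<in>?J n. complex_of_real (of_int j / real (Suc n)) * (4 * ell2_inner X a (E (?I n j) b)))"
      using quadratic_form_polarization[OF E_projection a b] by (simp del: of_nat_Suc)
    finally show "(\<Sum>c\<in>?C. cnj c * ?r (\<lambda>S. ell2_inner X (?u c) (E S (?u c))) n) = 4 * ?r (\<lambda>S. ell2_inner X a (E S b)) n"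
      by (simp only: sum_distrib_left mult.left_commute)
  qed
  also have "(\<Sum>c\<in>?C. cnj c * ell2_inner X (?u c) (L (?u c))) = 4 * ell2_inner X a (L b)"
    by (rule quadratic_form_polarization[OF L a b, symmetric])
  finally have "(\<lambda>n. 4 * ?r (\<lambda>S. ell2_inner X a (E S b)) n) \<longlonglongrightarrow> 4 * ell2_inner X a (L b)" .
  moreover have "(\<lambda>n. 4 * ?r (\<lambda>S. ell2_inner X a (E S b)) n) \<longlonglongrightarrow> 4 * (\<integral>t. complex_of_real t * g t \<partial>M)"
    using tendsto_mult[OF tendsto_const[of 4] tendsto_integral_floor[OF M N]] by (simp add: eq del: of_nat_Suc)
  ultimately have "4 * ell2_inner X a (L b) = 4 * (\<integral>t. complex_of_real t * g t \<partial>M)" by (rule LIMSEQ_unique)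
  then show ?thesis by simp
qed

lemma funpow_ell2: "u \<in> ell2 X \<Longrightarrow> (L ^^ k) u \<in> ell2 X"
  by (induction k) (auto intro: self_adjoint_opD(1)[OF L])

text \<open>
  In the induction step one factor \<open>L\<close> is kept and \<open>E S\<close> is moved to the left argument.  The rule
  \<open>E S (E T u) = E (S \<inter> T) u\<close> then reduces the pairing with \<open>E T\<close> to the induction hypothesis.
\<close>

lemma inner_E_funpow:
  assumes u: "u \<in> ell2 X" and S: "S \<in> sets borel"
  shows "ell2_inner X u (E S ((L ^^ k) u)) =
    (\<integral>t. indicator S t * complex_of_real (t ^ k) \<partial>diagonal_measure X E u)"
  using S
proof (induction k arbitrary: S)
  case 0
  let ?M = "diagonal_measure X E u"
  have "(\<integral>t. indicator S t * complex_of_real (t ^ 0) \<partial>?M) = (\<integral>t. complex_of_real (indicator S t) \<partial>?M)"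
    by (intro Bochner_Integration.integral_cong) (auto simp: indicator_def)
  also have "\<dots> = complex_of_real (measure ?M S)"
    by (simp only: integral_complex_of_real Bochner_Integration.integral_indicator) (simp add: space_diagonal)
  also have "\<dots> = ell2_inner X u (E S u)"
    using E_quadratic[OF 0 u] by (simp add: measure_def emeasure_diagonal u 0)
  finally show ?case by simp
next
  case (Suc k)
  let ?M = "diagonal_measure X E u"
  interpret finite_measure ?M by (rule finite_measure_diagonal[OF u])
  obtain N where N: "AE t in ?M. \<bar>t\<bar> \<le> real N" using bounded_support u by blast
  have [measurable_cong]: "sets ?M = sets borel" by (rule sets_diagonal)
  note [measurable] = Suc.prems
  have int: "integrable ?M (\<lambda>t. indicator S t * complex_of_real (t ^ k))"
  proof (rule integrable_const_bound[of _ "real N ^ k"])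
    show "AE t in ?M. norm (indicator S t * complex_of_real (t ^ k)) \<le> real N ^ k"
      using N by eventually_elim (auto simp: norm_mult norm_power indicator_def intro: power_mono)
  qed measurable
  have "ell2_inner X u (E S ((L ^^ Suc k) u)) = ell2_inner X (E S u) (L ((L ^^ k) u))"
    using u Suc.prems
    by (simp add: self_adjoint_opD(4)[OF E_projection] self_adjoint_opD(1)[OF L] funpow_ell2)
  also have "\<dots> = (\<integral>t. complex_of_real t * (indicator S t * complex_of_real (t ^ k)) \<partial>?M)"
  proof (rule inner_L_eq_integral[OF _ _ sets_diagonal int])
    show "E S u \<in> ell2 X" "(L ^^ k) u \<in> ell2 X" "\<exists>N. AE t in ?M. \<bar>t\<bar> \<le> real N"
      using u Suc.prems N by (auto intro: E_ell2 funpow_ell2)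
    fix T :: "real set" assume T: "T \<in> sets borel"
    have "ell2_inner X (E S u) (E T ((L ^^ k) u)) = ell2_inner X u (E (S \<inter> T) ((L ^^ k) u))"
      using u Suc.prems T
      by (simp add: self_adjoint_opD(4)[OF E_projection] E_Int E_ell2 funpow_ell2)
    also have "\<dots> = (\<integral>t. indicator (S \<inter> T) t * complex_of_real (t ^ k) \<partial>?M)"
      using Suc.IH[of "S \<inter> T"] Suc.prems T by auto
    finally show "ell2_inner X (E S u) (E T ((L ^^ k) u)) =
        (\<integral>t. indicator T t * (indicator S t * complex_of_real (t ^ k)) \<partial>?M)"
      by (simp add: indicator_inter_arith mult_ac)
  qed
  finally show ?case by (simp add: mult_ac)
qed

lemma diagonal_measure_moments:
  assumes u: "u \<in> ell2 X"
  shows "complex_of_real (\<integral>t. t ^ k \<partial>diagonal_measure X E u) = ell2_inner X u ((L ^^ k) u)"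
proof -
  have "(\<integral>t. indicator UNIV t * complex_of_real (t ^ k) \<partial>diagonal_measure X E u) =
      (\<integral>t. complex_of_real (t ^ k) \<partial>diagonal_measure X E u)" by simp
  then show ?thesis
    using inner_E_funpow[OF u, of UNIV k] by (simp add: E_UNIV funpow_ell2 u del: of_real_power)
qed

end

section \<open>The spectral measure of a convolution operator\<close>

lemma ell1_integrable: "m \<in> ell1 X \<Longrightarrow> integrable (count_space X) m"
  using integrable_norm_iff[of m "count_space X"]
  by (simp add: ell1_def summable_on_iff_integrable_real)

lemma infsum_integral_swap:
  fixes m :: "'x \<Rightarrow> complex" and F :: "'x \<Rightarrow> 'w \<Rightarrow> complex"
  assumes X: "countable X" and m: "m \<in> ell1 X" and P: "sigma_finite_measure P"
    and F: "\<And>x. x \<in> X \<Longrightarrow> integrable P (F x)" "\<And>x. x \<in> X \<Longrightarrow> (\<integral>\<omega>. norm (F x \<omega>) \<partial>P) \<le> B"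
  shows "(\<Sum>\<^sub>\<infinity>x\<in>X. m x * (\<integral>\<omega>. F x \<omega> \<partial>P)) = (\<integral>\<omega>. (\<Sum>\<^sub>\<infinity>x\<in>X. m x * F x \<omega>) \<partial>P)"
proof -
  interpret pair_sigma_finite "count_space X" P
    by (intro pair_sigma_finite.intro sigma_finite_measure_count_space_countable X P)
  have meas: "(\<lambda>(x, \<omega>). m x * F x \<omega>) \<in> borel_measurable (count_space X \<Otimes>\<^sub>M P)"
    using F(1) by (intro measurable_pair_measure_countable1[OF X]) auto
  have "integrable (count_space X) (\<lambda>x. \<integral>\<omega>. norm (m x * F x \<omega>) \<partial>P)"
  proof (rule Bochner_Integration.integrable_bound)
    show "integrable (count_space X) (\<lambda>x. B * norm (m x))"
      using ell1_integrable[OF m] by auto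
    have "norm (\<integral>\<omega>. norm (m x * F x \<omega>) \<partial>P) \<le> norm (B * norm (m x))" if "x \<in> X" for x
    proof -
      have "0 \<le> (\<integral>\<omega>. norm (F x \<omega>) \<partial>P)" by simp
      then have "0 \<le> B" using F(2)[OF that] by linarith
      then show ?thesis
        using F(2)[OF that] by (simp add: norm_mult abs_mult mult.commute[of B] mult_left_mono)
    qed
    then show "AE x in count_space X. norm (\<integral>\<omega>. norm (m x * F x \<omega>) \<partial>P) \<le> norm (B * norm (m x))"
      by (intro AE_I2) simp
  qed simp
  then have "integrable (count_space X \<Otimes>\<^sub>M P) (\<lambda>(x, \<omega>). m x * F x \<omega>)"
    using F(1) meas by (intro Fubini_integrable) (auto simp: AE_count_space)
  from Fubini_integral[OF this]
  have "(\<integral>\<omega>. (\<Sum>\<^sub>\<infinity>x\<in>X. m x * F x \<omega>) \<partial>P) = (\<integral>x. (\<integral>\<omega>. m x * F x \<omega> \<partial>P) \<partial>count_space X)"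
    by (simp only: infsum_eq_integral_complex)
  then show ?thesis by (simp add: infsum_eq_integral_complex)
qed

lemma ell1_unit_sum_bound:
  assumes m: "m \<in> ell1 X" and f: "\<And>x. x \<in> X \<Longrightarrow> cmod (f x) \<le> 1"
  shows "cmod (\<Sum>\<^sub>\<infinity>x\<in>X. m x * f x) \<le> (\<Sum>\<^sub>\<infinity>x\<in>X. cmod (m x))"
proof -
  have "cmod (\<integral>x. m x * f x \<partial>count_space X) \<le> (\<integral>x. cmod (m x) \<partial>count_space X)"
  proof (rule order_trans[OF integral_norm_bound integral_mono_AE'])
    show "integrable (count_space X) (\<lambda>x. cmod (m x))" using ell1_integrable[OF m] by simp
    show "AE x in count_space X. norm (m x * f x) \<le> cmod (m x)"
      using f by (intro AE_I2) (auto simp: norm_mult mult_left_le)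
  qed auto
  then show ?thesis by (simp add: infsum_eq_integral_complex infsum_eq_integral_real)
qed

lemma (in group) conv_op_delta:
  assumes x: "x \<in> carrier G" and y: "y \<in> carrier G"
  shows "conv_op G m (delta x) y = m (y \<otimes> inv x)"
proof -
  have "inv s \<otimes> y = x \<longleftrightarrow> s = y \<otimes> inv x" if "s \<in> carrier G" for s
  proof -
    have "inv s \<otimes> y = x \<longleftrightarrow> y = s \<otimes> x" using inv_solve_left'[of x s y] that x y by auto
    also have "\<dots> \<longleftrightarrow> s = y \<otimes> inv x" using inv_solve_right[of s y x] that x y by auto
    finally show ?thesis .
  qed
  then have "conv_op G m (delta x) y = (\<Sum>\<^sub>\<infinity>s\<in>{y \<otimes> inv x}. m s)"
    unfolding conv_op_def using x y
    by (intro infsum_cong_neutral) (auto simp: left_regular_def delta_def)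
  then show ?thesis by simp
qed

text \<open>
  The columns of the operator at \<open>\<delta>\<^sub>1\<close> and \<open>\<delta>\<^sub>x\<close> contain \<open>m x\<close> and \<open>m (inv x)\<close> in mutually
  transposed positions.
\<close>

lemma (in group) self_adjoint_conv_op_imp:
  assumes m: "self_adjoint_op (carrier G) (conv_op G m)" and x: "x \<in> carrier G"
  shows "m (inv x) = cnj (m x)"
proof -
  let ?L = "conv_op G m" and ?X = "carrier G"
  have d: "delta \<one> \<in> ell2 ?X" "delta x \<in> ell2 ?X" using x by (auto intro: delta_ell2)
  have "m (inv x) = ell2_inner ?X (delta \<one>) (?L (delta x))"
    using x by (simp add: ell2_inner_delta_left conv_op_delta)
  also have "\<dots> = ell2_inner ?X (?L (delta \<one>)) (delta x)"
    using self_adjoint_opD(4)[OF m d] by simp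
  also have "\<dots> = cnj (ell2_inner ?X (delta x) (?L (delta \<one>)))" by (rule ell2_inner_commute)
  also have "\<dots> = cnj (m x)" using x by (simp add: ell2_inner_delta_left conv_op_delta)
  finally show ?thesis .
qed

lemma (in group) character_sum_real:
  assumes m: "self_adjoint_op (carrier G) (conv_op G m)" and \<omega>: "\<omega> \<in> pontryagin_dual G"
  shows "(\<Sum>\<^sub>\<infinity>x\<in>carrier G. m x * \<omega> x) = complex_of_real (Re (\<Sum>\<^sub>\<infinity>x\<in>carrier G. m x * \<omega> x))"
proof -
  have bij: "bij_betw (m_inv G) (carrier G) (carrier G)"
    by (rule bij_betwI[of _ _ _ "m_inv G"]) auto
  have "cnj (\<Sum>\<^sub>\<infinity>x\<in>carrier G. m x * \<omega> x) = (\<Sum>\<^sub>\<infinity>x\<in>carrier G. cnj (m x * \<omega> x))"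
    by (rule infsum_cnj[symmetric])
  also have "\<dots> = (\<Sum>\<^sub>\<infinity>x\<in>carrier G. m (inv x) * \<omega> (inv x))"
    using self_adjoint_conv_op_imp[OF m] dual_inv[OF \<omega>] by (intro infsum_cong) simp
  also have "\<dots> = (\<Sum>\<^sub>\<infinity>x\<in>carrier G. m x * \<omega> x)"
    by (rule infsum_reindex_bij_betw[OF bij])
  finally have "Im (\<Sum>\<^sub>\<infinity>x\<in>carrier G. m x * \<omega> x) = 0" by (simp add: complex_eq_iff)
  then show ?thesis by (simp add: complex_eq_iff)
qed

locale self_adjoint_convolution = dual_probability N P
  for N :: "('a, 'b) monoid_scheme" (structure) and P +
  fixes m :: "'a \<Rightarrow> complex"
  assumes m_ell1: "m \<in> ell1 (carrier N)"
    and self_adjoint: "self_adjoint_op (carrier N) (conv_op N m)"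
begin

definition symbol :: "('a \<Rightarrow> complex) \<Rightarrow> real" where
  "symbol \<omega> = Re (\<Sum>\<^sub>\<infinity>x\<in>carrier N. m x * \<omega> x)"

definition m_norm :: real where "m_norm = (\<Sum>\<^sub>\<infinity>x\<in>carrier N. cmod (m x))"

lemma character_sum_eq_symbol:
  "\<omega> \<in> space P \<Longrightarrow> (\<Sum>\<^sub>\<infinity>x\<in>carrier N. m x * \<omega> x) = complex_of_real (symbol \<omega>)"
  using character_sum_real[OF self_adjoint] by (simp add: symbol_def space_P)

lemma symbol_bound: "\<omega> \<in> space P \<Longrightarrow> \<bar>symbol \<omega>\<bar> \<le> m_norm"
  using ell1_unit_sum_bound[OF m_ell1, of \<omega>] character_sum_eq_symbol[of \<omega>]
  by (simp add: norm_eval m_norm_def)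

lemma symbol_measurable [measurable]: "symbol \<in> borel_measurable P"
proof -
  have "(\<lambda>\<omega>. \<integral>x. m x * \<omega> x \<partial>count_space (carrier N)) \<in> borel_measurable P"
    by (intro borel_measurable_count_space_integral countable_carrier borel_measurable_times
        borel_measurable_const measurable_eval)
  then show ?thesis unfolding symbol_def[abs_def] infsum_eq_integral_complex by measurable
qed

text \<open>Under the Fourier transform, convolution by \<open>m\<close> becomes multiplication by its symbol.\<close>

lemma conv_op_coeff:
  assumes F: "square_integrable P F"
  shows "conv_op N m (coeff F) = coeff (\<lambda>\<omega>. complex_of_real (symbol \<omega>) * F \<omega>)"
proof
  fix y
  show "conv_op N m (coeff F) y = coeff (\<lambda>\<omega>. complex_of_real (symbol \<omega>) * F \<omega>) y"
  proof (cases "y \<in> carrier N")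
    case True
    have F_int: "integrable P F" by (rule square_integrable_imp_integrable_complex[OF F])
    have int: "integrable P (\<lambda>\<omega>. cnj (\<omega> (inv s \<otimes> y)) * F \<omega>)" if "s \<in> carrier N" for s
      using that True by (intro integrable_coeff[OF F]) simp
    have "conv_op N m (coeff F) y = (\<Sum>\<^sub>\<infinity>s\<in>carrier N. m s * (\<integral>\<omega>. cnj (\<omega> (inv s \<otimes> y)) * F \<omega> \<partial>P))"
      unfolding conv_op_def using True by (intro infsum_cong) (simp add: left_regular_def coeff_def)
    also have "\<dots> = (\<integral>\<omega>. (\<Sum>\<^sub>\<infinity>s\<in>carrier N. m s * (cnj (\<omega> (inv s \<otimes> y)) * F \<omega>)) \<partial>P)"
    proof (rule infsum_integral_swap[OF countable_carrier m_ell1 sigma_finite_measure_axioms int])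
      fix s assume "s \<in> carrier N"
      then show "(\<integral>\<omega>. norm (cnj (\<omega> (inv s \<otimes> y)) * F \<omega>) \<partial>P) \<le> (\<integral>\<omega>. norm (F \<omega>) \<partial>P)"
        using F_int True
        by (intro integral_mono_AE' AE_I2) (auto simp: norm_mult norm_eval)
    qed
    also have "\<dots> = (\<integral>\<omega>. cnj (\<omega> y) * (complex_of_real (symbol \<omega>) * F \<omega>) \<partial>P)"
    proof (rule Bochner_Integration.integral_cong[OF refl])
      fix \<omega> assume \<omega>: "\<omega> \<in> space P"
      have "(\<Sum>\<^sub>\<infinity>s\<in>carrier N. m s * (cnj (\<omega> (inv s \<otimes> y)) * F \<omega>)) =
          (\<Sum>\<^sub>\<infinity>s\<in>carrier N. (m s * \<omega> s) * (cnj (\<omega> y) * F \<omega>))"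
        using True \<omega> by (intro infsum_cong) (simp add: space_P dual_mult dual_inv)
      also have "\<dots> = (\<Sum>\<^sub>\<infinity>s\<in>carrier N. m s * \<omega> s) * (cnj (\<omega> y) * F \<omega>)"
        by (rule infsum_cmult_left')
      finally show "(\<Sum>\<^sub>\<infinity>s\<in>carrier N. m s * (cnj (\<omega> (inv s \<otimes> y)) * F \<omega>)) =
          cnj (\<omega> y) * (complex_of_real (symbol \<omega>) * F \<omega>)"
        by (simp add: character_sum_eq_symbol[OF \<omega>])
    qed
    finally show ?thesis using True by (simp add: coeff_def)
  qed (simp add: conv_op_def left_regular_def coeff_def)
qed

text \<open>
  The spectral resolution is therefore multiplication by indicators of the symbol, transported by
  the Fourier transform.  A representative of the inverse transform is chosen for every element of
  \<open>\<ell>\<^sup>2\<close>; different choices agree almost everywhere.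
\<close>

definition inverse_coeff :: "('a \<Rightarrow> complex) \<Rightarrow> ('a \<Rightarrow> complex) \<Rightarrow> complex" where
  "inverse_coeff u = (SOME F. square_integrable P F \<and> coeff F = u)"

definition model_resolution :: "real set \<Rightarrow> 'a op" where
  "model_resolution S u = coeff (\<lambda>\<omega>. indicator S (symbol \<omega>) * inverse_coeff u \<omega>)"

lemma inverse_coeff:
  assumes "u \<in> ell2 (carrier N)"
  shows "square_integrable P (inverse_coeff u)" "coeff (inverse_coeff u) = u"
proof -
  have "\<exists>F. square_integrable P F \<and> coeff F = u" using riesz_fischer[OF assms] by metis
  from someI_ex[OF this] show "square_integrable P (inverse_coeff u)" "coeff (inverse_coeff u) = u"
    by (auto simp: inverse_coeff_def)
qed

lemma inner_eq_integral:
  assumes "u \<in> ell2 (carrier N)" "square_integrable P F"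
  shows "ell2_inner (carrier N) u (coeff F) = (\<integral>\<omega>. cnj (inverse_coeff u \<omega>) * F \<omega> \<partial>P)"
  using parseval[OF inverse_coeff(1)[OF assms(1)] assms(2)] inverse_coeff(2)[OF assms(1)]
  by (simp add: ell2_inner_eq_integral)

lemma square_integrable_indicator:
  assumes [measurable]: "S \<in> sets borel" and F: "square_integrable P F"
  shows "square_integrable P (\<lambda>\<omega>. indicator S (symbol \<omega>) * F \<omega>)"
  by (rule square_integrable_mult_bounded[OF F, where C = 1]) (auto simp: indicator_def)

lemma model_resolution_ell2:
  "S \<in> sets borel \<Longrightarrow> u \<in> ell2 (carrier N) \<Longrightarrow> model_resolution S u \<in> ell2 (carrier N)"
  unfolding model_resolution_def
  by (intro coeff_ell2 square_integrable_indicator inverse_coeff(1))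

lemma model_resolution_coeff:
  assumes S [measurable]: "S \<in> sets borel" and F: "square_integrable P F"
  shows "model_resolution S (coeff F) = coeff (\<lambda>\<omega>. indicator S (symbol \<omega>) * F \<omega>)"
  unfolding model_resolution_def
proof (rule coeff_cong_AE)
  note R = inverse_coeff[OF coeff_ell2[OF F]]
  show "AE \<omega> in P. indicator S (symbol \<omega>) * inverse_coeff (coeff F) \<omega> = indicator S (symbol \<omega>) * F \<omega>"
    using coeff_eq_imp_AE_eq[OF R(1) F R(2)] by eventually_elim simp
  show "(\<lambda>\<omega>. indicator S (symbol \<omega>) * inverse_coeff (coeff F) \<omega>) \<in> borel_measurable P"
    "(\<lambda>\<omega>. indicator S (symbol \<omega>) * F \<omega>) \<in> borel_measurable P"
    by (intro square_integrable_measurable square_integrable_indicator S R(1) F)+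
qed

lemma inner_model_resolution:
  assumes S: "S \<in> sets borel" and u: "u \<in> ell2 (carrier N)" and w: "w \<in> ell2 (carrier N)"
  shows "ell2_inner (carrier N) u (model_resolution S w) =
    (\<integral>\<omega>. indicator S (symbol \<omega>) * (cnj (inverse_coeff u \<omega>) * inverse_coeff w \<omega>) \<partial>P)"
  unfolding model_resolution_def
  using inner_eq_integral[OF u square_integrable_indicator[OF S inverse_coeff(1)[OF w]]]
  by (simp add: mult.left_commute)

lemma self_adjoint_model_resolution:
  assumes S [measurable]: "S \<in> sets borel"
  shows "self_adjoint_op (carrier N) (model_resolution S)"
  unfolding self_adjoint_op_def bounded_op_def
proof (intro conjI ballI allI exI[of _ 1])
  fix u assume u: "u \<in> ell2 (carrier N)"
  let ?F = "\<lambda>\<omega>. indicator S (symbol \<omega>) * inverse_coeff u \<omega>"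
  note R = inverse_coeff[OF u]
  have F: "square_integrable P ?F" by (rule square_integrable_indicator[OF S R(1)])
  show "model_resolution S u \<in> ell2 (carrier N)" by (rule model_resolution_ell2[OF S u])
  have "(ell2_norm (carrier N) (model_resolution S u))\<^sup>2 = (\<integral>\<omega>. (cmod (?F \<omega>))\<^sup>2 \<partial>P)"
    using parseval_norm[OF F] by (simp add: ell2_norm_sq infsum_eq_integral_real model_resolution_def)
  also have "\<dots> \<le> (\<integral>\<omega>. (cmod (inverse_coeff u \<omega>))\<^sup>2 \<partial>P)"
    using square_integrable_norm_sq[OF F] square_integrable_norm_sq[OF R(1)]
    by (intro integral_mono) (auto simp: indicator_def)
  also have "\<dots> = (ell2_norm (carrier N) u)\<^sup>2"
    using parseval_norm[OF R(1)] by (simp add: R(2) ell2_norm_sq infsum_eq_integral_real)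
  finally have "ell2_norm (carrier N) (model_resolution S u) \<le> ell2_norm (carrier N) u"
    by (rule power2_le_imp_le) (rule ell2_norm_nonneg)
  then show "ell2_norm (carrier N) (model_resolution S u) \<le> 1 * ell2_norm (carrier N) u" by simp
  show "model_resolution S (\<lambda>x. c * u x) = (\<lambda>x. c * model_resolution S u x)" for c
    using model_resolution_coeff[OF S square_integrable_cmult[OF R(1), of c]]
    by (simp add: coeff_cmult R(2) model_resolution_def mult.left_commute)
  fix w assume w: "w \<in> ell2 (carrier N)"
  note R' = inverse_coeff[OF w]
  show "model_resolution S (\<lambda>x. u x + w x) = (\<lambda>x. model_resolution S u x + model_resolution S w x)"
    using model_resolution_coeff[OF S square_integrable_add[OF R(1) R'(1)]]
    by (simp add: coeff_add R R' model_resolution_def distrib_left square_integrable_indicator[OF S])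
  show "ell2_inner (carrier N) (model_resolution S u) w = ell2_inner (carrier N) u (model_resolution S w)"
  proof -
    have "ell2_inner (carrier N) (model_resolution S u) w = cnj (ell2_inner (carrier N) w (model_resolution S u))"
      by (rule ell2_inner_commute)
    also have "\<dots> = (\<integral>\<omega>. cnj (indicator S (symbol \<omega>) * (cnj (inverse_coeff w \<omega>) * inverse_coeff u \<omega>)) \<partial>P)"
      unfolding inner_model_resolution[OF S w u] by (rule Bochner_Integration.integral_cnj[symmetric])
    also have "\<dots> = (\<integral>\<omega>. indicator S (symbol \<omega>) * (cnj (inverse_coeff u \<omega>) * inverse_coeff w \<omega>) \<partial>P)"
      by (intro Bochner_Integration.integral_cong) (auto simp: indicator_def)
    also have "\<dots> = ell2_inner (carrier N) u (model_resolution S w)"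
      by (rule inner_model_resolution[OF S u w, symmetric])
    finally show ?thesis .
  qed
qed

lemma model_resolution_Int:
  assumes S: "S \<in> sets borel" and T: "T \<in> sets borel" and u: "u \<in> ell2 (carrier N)"
  shows "model_resolution (S \<inter> T) u = model_resolution S (model_resolution T u)"
proof -
  have "model_resolution S (model_resolution T u) =
      coeff (\<lambda>\<omega>. indicator S (symbol \<omega>) * (indicator T (symbol \<omega>) * inverse_coeff u \<omega>))"
    unfolding model_resolution_def[of T u]
    by (rule model_resolution_coeff[OF S square_integrable_indicator[OF T inverse_coeff(1)[OF u]]])
  then show ?thesis by (simp add: model_resolution_def indicator_inter_arith mult.assoc)
qed

lemma diagonal_model_resolution:
  assumes u: "u \<in> ell2 (carrier N)"
  shows "diagonal_measure (carrier N) model_resolution u =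
    distr (density P (\<lambda>\<omega>. ennreal ((cmod (inverse_coeff u \<omega>))\<^sup>2))) borel symbol"
proof -
  let ?M = "distr (density P (\<lambda>\<omega>. ennreal ((cmod (inverse_coeff u \<omega>))\<^sup>2))) borel symbol"
  note R = inverse_coeff(1)[OF u]
  note [measurable] = square_integrable_measurable[OF R]
  have "ennreal (Re (ell2_inner (carrier N) u (model_resolution S u))) = emeasure ?M S" if S [measurable]: "S \<in> sets borel" for S
  proof -
    have "ell2_inner (carrier N) u (model_resolution S u) =
        (\<integral>\<omega>. complex_of_real (indicator S (symbol \<omega>) * (cmod (inverse_coeff u \<omega>))\<^sup>2) \<partial>P)"
      unfolding inner_model_resolution[OF S u u]
      by (intro Bochner_Integration.integral_cong refl)
        (simp only: cmod_sq_eq of_real_mult, simp add: indicator_def)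
    then have "ennreal (Re (ell2_inner (carrier N) u (model_resolution S u))) =
        ennreal (\<integral>\<omega>. indicator S (symbol \<omega>) * (cmod (inverse_coeff u \<omega>))\<^sup>2 \<partial>P)"
      by (simp only: integral_complex_of_real Re_complex_of_real)
    also have "\<dots> = (\<integral>\<^sup>+\<omega>. ennreal (indicator S (symbol \<omega>) * (cmod (inverse_coeff u \<omega>))\<^sup>2) \<partial>P)"
    proof (rule nn_integral_eq_integral[symmetric])
      show "integrable P (\<lambda>\<omega>. indicator S (symbol \<omega>) * (cmod (inverse_coeff u \<omega>))\<^sup>2)"
        by (rule Bochner_Integration.integrable_bound[OF square_integrable_norm_sq[OF R]]) (auto simp: indicator_def)
    qed auto
    also have "\<dots> = (\<integral>\<^sup>+\<omega>. ennreal ((cmod (inverse_coeff u \<omega>))\<^sup>2) * indicator (symbol -` S \<inter> space P) \<omega> \<partial>P)"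
      by (intro nn_integral_cong) (auto simp: indicator_def)
    also have "\<dots> = emeasure ?M S"
      by (simp add: emeasure_distr emeasure_density)
    finally show ?thesis .
  qed
  then have "diagonal_measure (carrier N) model_resolution u = measure_of UNIV (sets borel) (emeasure ?M)"
    unfolding diagonal_measure_def using sets.sigma_sets_eq[of "borel :: real measure"]
    by (intro measure_of_eq) auto
  also have "\<dots> = ?M" using measure_of_of_measure[of ?M] by simp
  finally show ?thesis .
qed

lemma is_spectral_resolution_model:
  "is_spectral_resolution (carrier N) (conv_op N m) model_resolution"
  unfolding is_spectral_resolution_def projection_valued_measure_def orthogonal_projection_def
proof (intro conjI ballI allI impI)
  fix S :: "real set" assume S: "S \<in> sets borel"
  show "self_adjoint_op (carrier N) (model_resolution S)" by (rule self_adjoint_model_resolution[OF S])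
  fix u assume u: "u \<in> ell2 (carrier N)"
  show "model_resolution S (model_resolution S u) = model_resolution S u"
    using model_resolution_Int[OF S S u] by simp
next
  fix u assume u: "u \<in> ell2 (carrier N)"
  show "model_resolution UNIV u = u" using inverse_coeff(2)[OF u] by (simp add: model_resolution_def)
next
  fix S T :: "real set" and u assume "S \<in> sets borel" "T \<in> sets borel" "u \<in> ell2 (carrier N)"
  then show "model_resolution (S \<inter> T) u = model_resolution S (model_resolution T u)"
    by (rule model_resolution_Int)
next
  fix S :: "nat \<Rightarrow> real set" and u w
  assume S: "range S \<subseteq> sets borel \<and> disjoint_family S" and u: "u \<in> ell2 (carrier N)" and w: "w \<in> ell2 (carrier N)"
  let ?g = "\<lambda>\<omega>. cnj (inverse_coeff u \<omega>) * inverse_coeff w \<omega>"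
  let ?A = "\<lambda>n. symbol -` S n \<inter> space P"
  have g: "integrable P ?g" by (intro square_integrable_inner inverse_coeff u w)
  have S_sets [measurable]: "S n \<in> sets borel" for n using S by auto
  have A: "?A n \<in> sets P" for n by measurable
  have ind: "ell2_inner (carrier N) u (model_resolution T w) = set_lebesgue_integral P (symbol -` T \<inter> space P) ?g"
    if "T \<in> sets borel" for T
    unfolding inner_model_resolution[OF that u w] set_lebesgue_integral_def
    by (intro Bochner_Integration.integral_cong) (auto simp: indicator_def)
  have "(\<lambda>n. set_lebesgue_integral P (?A n) ?g) sums set_lebesgue_integral P (\<Union>n. ?A n) ?g"
  proof -
    have int: "integrable P (\<lambda>\<omega>. indicator (?A n) \<omega> *\<^sub>R ?g \<omega>)" for n
      by (rule integrable_mult_indicator[OF A g])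
    have le: "(\<Sum>k<n. norm (indicator (?A k) \<omega> *\<^sub>R ?g \<omega>)) \<le> norm (?g \<omega>)" for n \<omega>
    proof -
      have "(\<Sum>k<n. indicator (?A k) \<omega> :: real) = indicator (\<Union>k<n. ?A k) \<omega>"
        using S by (intro indicator_UN_disjoint[symmetric]) (auto simp: disjoint_family_on_def)
      moreover have "norm (indicator B \<omega> *\<^sub>R z) = indicator B \<omega> * norm z" for B and z :: complex
        by (simp add: indicator_def)
      ultimately have "(\<Sum>k<n. norm (indicator (?A k) \<omega> *\<^sub>R ?g \<omega>)) = indicator (\<Union>k<n. ?A k) \<omega> * norm (?g \<omega>)"
        by (simp only: sum_distrib_right[symmetric])
      also have "\<dots> \<le> 1 * norm (?g \<omega>)" by (intro mult_right_mono) (auto simp: indicator_def)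
      finally show ?thesis by simp
    qed
    have sums: "(\<lambda>k. indicator (?A k) \<omega> *\<^sub>R ?g \<omega>) sums (indicator (\<Union>k. ?A k) \<omega> *\<^sub>R ?g \<omega>)" for \<omega>
    proof (cases "\<exists>k. \<omega> \<in> ?A k")
      case True
      then obtain k where k: "\<omega> \<in> ?A k" by auto
      have "(\<lambda>j. indicator (?A j) \<omega> *\<^sub>R ?g \<omega>) = (\<lambda>j. if j = k then ?g \<omega> else 0)"
        using k S by (auto simp: fun_eq_iff indicator_def disjoint_family_on_def)
      then show ?thesis using k sums_single[of k "\<lambda>_. ?g \<omega>"] by (auto simp: indicator_def)
    qed (auto simp: indicator_def)
    have "(\<lambda>n. \<integral>\<omega>. (\<Sum>k<n. indicator (?A k) \<omega> *\<^sub>R ?g \<omega>) \<partial>P) \<longlonglongrightarrow> (\<integral>\<omega>. indicator (\<Union>k. ?A k) \<omega> *\<^sub>R ?g \<omega> \<partial>P)"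
    proof (rule integral_dominated_convergence[where w = "\<lambda>\<omega>. norm (?g \<omega>)"])
      show "AE \<omega> in P. (\<lambda>n. \<Sum>k<n. indicator (?A k) \<omega> *\<^sub>R ?g \<omega>) \<longlonglongrightarrow> indicator (\<Union>k. ?A k) \<omega> *\<^sub>R ?g \<omega>"
        using sums unfolding sums_def by (intro AE_I2)
      show "AE \<omega> in P. norm (\<Sum>k<n. indicator (?A k) \<omega> *\<^sub>R ?g \<omega>) \<le> norm (?g \<omega>)" for n
        using order_trans[OF norm_sum le] by (intro AE_I2)
      have "(\<Union>k. ?A k) \<in> sets P" using A by auto
      from integrable_mult_indicator[OF this g]
      show "(\<lambda>\<omega>. indicator (\<Union>k. ?A k) \<omega> *\<^sub>R ?g \<omega>) \<in> borel_measurable P" by auto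
      show "(\<lambda>\<omega>. \<Sum>k<n. indicator (?A k) \<omega> *\<^sub>R ?g \<omega>) \<in> borel_measurable P" for n
        using int by (intro borel_measurable_sum) auto
    qed (use g in auto)
    then show ?thesis
      unfolding sums_def set_lebesgue_integral_def
      by (subst (asm) Bochner_Integration.integral_sum) (use int in auto)
  qed
  moreover have "(\<Union>n. ?A n) = symbol -` (\<Union>n. S n) \<inter> space P" by auto
  moreover have "(\<Union>n. S n) \<in> sets borel" using S_sets by auto
  ultimately show "(\<lambda>n. ell2_inner (carrier N) u (model_resolution (S n) w)) sums
      ell2_inner (carrier N) u (model_resolution (\<Union>n. S n) w)"
    by (simp only: ind S_sets)
next
  show "\<exists>R. \<forall>u\<in>ell2 (carrier N). model_resolution {-R..R} u = u"
  proof (intro exI[of _ m_norm] ballI)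
    fix u assume u: "u \<in> ell2 (carrier N)"
    note R = inverse_coeff[OF u]
    have "model_resolution {- m_norm..m_norm} u = coeff (inverse_coeff u)"
      unfolding model_resolution_def
    proof (rule coeff_cong_AE)
      show "AE \<omega> in P. indicator {- m_norm..m_norm} (symbol \<omega>) * inverse_coeff u \<omega> = inverse_coeff u \<omega>"
      proof (rule AE_I2)
        fix \<omega> assume "\<omega> \<in> space P"
        then have "symbol \<omega> \<in> {- m_norm..m_norm}" using symbol_bound[of \<omega>] by (auto simp: abs_le_iff)
        then show "indicator {- m_norm..m_norm} (symbol \<omega>) * inverse_coeff u \<omega> = inverse_coeff u \<omega>"
          by (simp only: indicator_simps mult_1)
      qed
      show "(\<lambda>\<omega>. indicator {- m_norm..m_norm} (symbol \<omega>) * inverse_coeff u \<omega>) \<in> borel_measurable P"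
        by (rule square_integrable_measurable[OF square_integrable_indicator[OF _ R(1)]]) simp
    qed (rule square_integrable_measurable[OF R(1)])
    then show "model_resolution {- m_norm..m_norm} u = u" by (simp add: R)
  qed
next
  fix u assume u: "u \<in> ell2 (carrier N)"
  note R = inverse_coeff[OF u]
  note [measurable] = square_integrable_measurable[OF R(1)]
  have "square_integrable P (\<lambda>\<omega>. complex_of_real (symbol \<omega>) * inverse_coeff u \<omega>)"
    by (rule square_integrable_mult_bounded[OF R(1), where C = m_norm]) (use symbol_bound in auto)
  then have "ell2_inner (carrier N) u (conv_op N m u) =
      (\<integral>\<omega>. cnj (inverse_coeff u \<omega>) * (complex_of_real (symbol \<omega>) * inverse_coeff u \<omega>) \<partial>P)"
    using conv_op_coeff[OF R(1)] inner_eq_integral[OF u] by (simp add: R(2))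
  also have "\<dots> = (\<integral>\<omega>. complex_of_real ((cmod (inverse_coeff u \<omega>))\<^sup>2 * symbol \<omega>) \<partial>P)"
    by (intro Bochner_Integration.integral_cong refl) (simp only: of_real_mult cmod_sq_eq mult_ac)
  also have "\<dots> = complex_of_real (\<integral>\<omega>. (cmod (inverse_coeff u \<omega>))\<^sup>2 * symbol \<omega> \<partial>P)"
    by (rule integral_complex_of_real)
  also have "(\<integral>\<omega>. (cmod (inverse_coeff u \<omega>))\<^sup>2 * symbol \<omega> \<partial>P) =
      integral\<^sup>L (diagonal_measure (carrier N) model_resolution u) (\<lambda>t. t)"
    unfolding diagonal_model_resolution[OF u]
    by (subst integral_distr) (simp_all add: integral_density)
  finally show "ell2_inner (carrier N) u (conv_op N m u) =
      complex_of_real (integral\<^sup>L (diagonal_measure (carrier N) model_resolution u) (\<lambda>t. t))" .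
qed

lemma conv_op_funpow_delta:
  "(conv_op N m ^^ k) (delta \<one>) = coeff (\<lambda>\<omega>. complex_of_real (symbol \<omega> ^ k))"
proof (induction k)
  case 0
  have "coeff (\<lambda>\<omega>. 1) y = delta \<one> y" for y
  proof (cases "y \<in> carrier N")
    case True
    have "coeff (\<lambda>\<omega>. 1) y = (\<integral>\<omega>. cnj (\<omega> y) * \<omega> \<one> \<partial>P)"
      unfolding coeff_def if_P[OF True]
      by (intro Bochner_Integration.integral_cong) (auto simp: space_P dual_one)
    then show ?thesis using True by (auto simp: orthonormal delta_def)
  qed (auto simp: coeff_def delta_def)
  then show ?case by (simp add: fun_eq_iff)
next
  case (Suc k)
  have "square_integrable P (\<lambda>\<omega>. complex_of_real (symbol \<omega> ^ k) * 1)"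
  proof (rule square_integrable_mult_bounded[where C = "m_norm ^ k"])
    show "square_integrable P (\<lambda>_. 1)" by (simp add: square_integrable_def)
    show "cmod (complex_of_real (symbol \<omega> ^ k)) \<le> m_norm ^ k" if "\<omega> \<in> space P" for \<omega>
      using symbol_bound[OF that] by (simp add: norm_power power_mono)
  qed measurable
  then show ?case using conv_op_coeff by (simp add: Suc)
qed

text \<open>
  The spectral resolution is an unspecified witness.  Its measure at \<open>\<delta>\<close> has bounded support and
  the moments of the symbol, whichever witness it is.
\<close>

proposition spectral_measure_conv_op:
  "spectral_measure (carrier N) (conv_op N m) \<one> = distr P borel symbol"
proof -
  let ?E = "spectral_resolution (carrier N) (conv_op N m)"
  have "is_spectral_resolution (carrier N) (conv_op N m) ?E"
    unfolding spectral_resolution_def using is_spectral_resolution_model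
    by (rule someI[where P = "is_spectral_resolution (carrier N) (conv_op N m)"])
  then interpret resolution "carrier N" "conv_op N m" ?E
    using self_adjoint by unfold_locales
  let ?u = "delta \<one>" and ?M = "diagonal_measure (carrier N) ?E (delta \<one>)"
  have u: "?u \<in> ell2 (carrier N)" by (rule delta_ell2) simp
  obtain K where K: "AE t in ?M. \<bar>t\<bar> \<le> real K" using bounded_support u by blast
  have D: "AE t in distr P borel symbol. \<bar>t\<bar> \<le> m_norm"
    by (subst AE_distr_iff) (auto simp: symbol_bound)
  define R where "R = max (real K) m_norm"
  have "?M = distr P borel symbol"
  proof (rule real_distribution_eqI_moments[where R = R])
    have "ell2_inner (carrier N) ?u ?u = ?u \<one>" by (rule ell2_inner_delta_left) simp
    then have "emeasure ?M (space ?M) = ennreal (Re (?u \<one>))"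
      using u by (simp add: space_diagonal emeasure_diagonal E_UNIV)
    then have "emeasure ?M (space ?M) = 1" by (simp add: delta_def)
    then show "real_distribution ?M"
      by (intro real_distribution.intro prob_spaceI real_distribution_axioms.intro)
        (simp_all add: sets_diagonal space_diagonal)
    show "AE t in ?M. \<bar>t\<bar> \<le> R" using K by eventually_elim (simp add: R_def)
    show "real_distribution (distr P borel symbol)" by simp
    show "AE t in distr P borel symbol. \<bar>t\<bar> \<le> R" using D by eventually_elim (simp add: R_def)
    fix k
    have "complex_of_real (\<integral>t. t ^ k \<partial>?M) = coeff (\<lambda>\<omega>. complex_of_real (symbol \<omega> ^ k)) \<one>"
      by (simp only: diagonal_measure_moments[OF u] conv_op_funpow_delta ell2_inner_delta_left[OF one_closed])
    also have "\<dots> = (\<integral>\<omega>. complex_of_real (symbol \<omega> ^ k) \<partial>P)"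
      unfolding coeff_def if_P[OF one_closed]
      by (intro Bochner_Integration.integral_cong) (auto simp: space_P dual_one)
    also have "\<dots> = complex_of_real (\<integral>\<omega>. symbol \<omega> ^ k \<partial>P)" by (rule integral_complex_of_real)
    finally show "(\<integral>t. t ^ k \<partial>?M) = (\<integral>t. t ^ k \<partial>distr P borel symbol)"
      by (simp add: integral_distr del: of_real_power)
  qed
  then show ?thesis by (simp add: spectral_measure_def)
qed

end

section \<open>The Fourier transform of the wreath product\<close>

text \<open>
  Translation by \<open>\<xi>\<close> multiplies the coefficient at \<open>x\<close> by \<open>\<xi> x\<close>; the only nonzero coefficient of
  the measure is the one at the identity, where \<open>\<xi>\<close> is 1.
\<close>

lemma (in dual_probability) haar_probability: "haar_probability N P"
  unfolding haar_probability_def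
proof (intro conjI ballI)
  show "prob_space P" by (rule prob_space_axioms)
  show "space P = pontryagin_dual N" by (rule space_P)
  show "sets P = sigma_sets (pontryagin_dual N) {U. openin (dual_topology N) U}"
    by (simp add: sets_P sets_char_space_eq_borel[OF countable_carrier])
  fix \<xi> assume \<xi>: "\<xi> \<in> pontryagin_dual N"
  let ?t = "\<lambda>\<omega>. \<lambda>x\<in>carrier N. \<xi> x * \<omega> x"
  have "?t \<in> measurable P (char_space N)"
  proof (rule measurable_char_spaceI)
    show "?t \<omega> \<in> pontryagin_dual N" if "\<omega> \<in> space P" for \<omega>
      using dual_translate[OF _ \<xi> is_group] that by (simp add: space_P)
    show "(\<lambda>\<omega>. ?t \<omega> x) \<in> borel_measurable P" if "x \<in> carrier N" for x
      using that measurable_eval[OF that] by simp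
  qed
  then have t: "?t \<in> measurable P P" by (simp add: measurable_cong_sets[OF refl sets_P])
  show "distr P P ?t = P"
  proof (rule prob_char_space_eqI[OF is_group prob_space_distr[OF t] _ prob_space_axioms sets_P])
    show "sets (distr P P ?t) = sets (char_space N)" by (simp add: sets_P)
    fix x assume x: "x \<in> carrier N"
    have "(\<integral>\<omega>. \<omega> x \<partial>distr P P ?t) = (\<integral>\<omega>. ?t \<omega> x \<partial>P)"
      by (rule integral_distr[OF t measurable_eval[OF x]])
    also have "\<dots> = \<xi> x * (\<integral>\<omega>. \<omega> x \<partial>P)" using x by simp
    also have "\<dots> = (\<integral>\<omega>. \<omega> x \<partial>P)" using x dual_one[OF \<xi>] by (simp add: mean)
    finally show "(\<integral>\<omega>. \<omega> x \<partial>distr P P ?t) = (\<integral>\<omega>. \<omega> x \<partial>P)" .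
  qed
qed

lemma ell2_reindex:
  assumes \<sigma>: "bij_betw \<sigma> Y Z"
  shows "w \<in> ell2 Z \<Longrightarrow> (\<lambda>y. if y \<in> Y then w (\<sigma> y) else 0) \<in> ell2 Y"
    and "ell2_inner Y (\<lambda>y. if y \<in> Y then w (\<sigma> y) else 0) (\<lambda>y. if y \<in> Y then w' (\<sigma> y) else 0) = ell2_inner Z w w'"
    and "u \<in> ell2 Y \<Longrightarrow> \<exists>w\<in>ell2 Z. u = (\<lambda>y. if y \<in> Y then w (\<sigma> y) else 0)"
proof -
  assume w: "w \<in> ell2 Z"
  then have "(\<lambda>y. (cmod (w (\<sigma> y)))\<^sup>2) summable_on Y"
    using summable_on_reindex_bij_betw[OF \<sigma>, of "\<lambda>z. (cmod (w z))\<^sup>2"] by (simp add: ell2_def)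
  then have "(\<lambda>y. (cmod (if y \<in> Y then w (\<sigma> y) else 0))\<^sup>2) summable_on Y"
    by (rule summable_on_cong[THEN iffD1, rotated]) simp
  then show "(\<lambda>y. if y \<in> Y then w (\<sigma> y) else 0) \<in> ell2 Y" by (simp add: ell2_def)
next
  have "ell2_inner Y (\<lambda>y. if y \<in> Y then w (\<sigma> y) else 0) (\<lambda>y. if y \<in> Y then w' (\<sigma> y) else 0) =
      (\<Sum>\<^sub>\<infinity>y\<in>Y. cnj (w (\<sigma> y)) * w' (\<sigma> y))"
    unfolding ell2_inner_def by (rule infsum_cong) simp
  also have "\<dots> = ell2_inner Z w w'"
    unfolding ell2_inner_def by (rule infsum_reindex_bij_betw[OF \<sigma>])
  finally show "ell2_inner Y (\<lambda>y. if y \<in> Y then w (\<sigma> y) else 0) (\<lambda>y. if y \<in> Y then w' (\<sigma> y) else 0) = ell2_inner Z w w'" .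
next
  assume u: "u \<in> ell2 Y"
  let ?\<tau> = "the_inv_into Y \<sigma>"
  define w where "w z = (if z \<in> Z then u (?\<tau> z) else 0)" for z
  have \<tau>: "bij_betw ?\<tau> Z Y" by (rule bij_betw_the_inv_into[OF \<sigma>])
  have "(\<lambda>z. (cmod (u (?\<tau> z)))\<^sup>2) summable_on Z"
    using u summable_on_reindex_bij_betw[OF \<tau>, of "\<lambda>z. (cmod (u z))\<^sup>2"] by (simp add: ell2_def)
  then have "(\<lambda>z. (cmod (w z))\<^sup>2) summable_on Z"
    by (rule summable_on_cong[THEN iffD1, rotated]) (simp add: w_def)
  then have "w \<in> ell2 Z" by (simp add: ell2_def w_def)
  moreover have "u = (\<lambda>y. if y \<in> Y then w (\<sigma> y) else 0)"
    using \<sigma> u by (auto simp: fun_eq_iff bij_betw_def the_inv_into_f_f ell2_def w_def)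
  ultimately show "\<exists>w\<in>ell2 Z. u = (\<lambda>y. if y \<in> Y then w (\<sigma> y) else 0)" by blast
qed

lemma push_forward_sum:
  fixes k :: "'b \<Rightarrow> complex"
  assumes e: "inj_on e X" "e ` X \<subseteq> W" and m: "m \<in> ell1 X" and k: "\<And>w. w \<in> W \<Longrightarrow> cmod (k w) \<le> B"
  shows "(\<lambda>w. push_forward X e m w * k w) summable_on W"
    and "(\<Sum>\<^sub>\<infinity>w\<in>W. push_forward X e m w * k w) = (\<Sum>\<^sub>\<infinity>x\<in>X. m x * k (e x))"
proof -
  have push_e: "push_forward X e m (e x) = m x" if "x \<in> X" for x
  proof -
    have "{x' \<in> X. e x' = e x} = {x}" using e(1) that by (auto dest: inj_onD)
    then show ?thesis by (simp add: push_forward_def)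
  qed
  have push_0: "push_forward X e m w = 0" if "w \<notin> e ` X" for w
  proof -
    have "{x \<in> X. e x = w} = {}" using that by auto
    then show ?thesis unfolding push_forward_def by (simp only: infsum_empty)
  qed
  have bij: "bij_betw e X (e ` X)" using e(1) by (simp add: bij_betw_def)
  have "(\<lambda>x. B * cmod (m x)) summable_on X" using m by (intro summable_on_cmult_right) (simp add: ell1_def)
  then have "(\<lambda>x. cmod (m x * k (e x))) summable_on X"
  proof (rule summable_on_comparison_test)
    fix x assume x: "x \<in> X"
    then have "cmod (k (e x)) \<le> B" using e(2) by (intro k) auto
    then show "cmod (m x * k (e x)) \<le> B * cmod (m x)"
      by (simp add: norm_mult mult.commute[of B] mult_left_mono)
  qed auto
  then have "(\<lambda>x. m x * k (e x)) summable_on X" by (rule abs_summable_summable)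
  then have "(\<lambda>x. push_forward X e m (e x) * k (e x)) summable_on X"
    by (rule summable_on_cong[THEN iffD1, rotated]) (simp add: push_e)
  then have "(\<lambda>w. push_forward X e m w * k w) summable_on e ` X"
    using summable_on_reindex_bij_betw[OF bij, of "\<lambda>w. push_forward X e m w * k w"] by simp
  moreover have "(\<lambda>w. push_forward X e m w * k w) summable_on e ` X \<longleftrightarrow>
      (\<lambda>w. push_forward X e m w * k w) summable_on W"
    using e(2) by (intro summable_on_cong_neutral) (auto simp: push_0)
  ultimately show "(\<lambda>w. push_forward X e m w * k w) summable_on W" by simp
  have "(\<Sum>\<^sub>\<infinity>w\<in>W. push_forward X e m w * k w) = (\<Sum>\<^sub>\<infinity>w\<in>e ` X. push_forward X e m w * k w)"
    using e(2) by (intro infsum_cong_neutral) (auto simp: push_0)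
  also have "\<dots> = (\<Sum>\<^sub>\<infinity>x\<in>X. push_forward X e m (e x) * k (e x))"
    by (rule infsum_reindex_bij_betw[OF bij, symmetric])
  also have "\<dots> = (\<Sum>\<^sub>\<infinity>x\<in>X. m x * k (e x))" by (intro infsum_cong) (simp add: push_e)
  finally show "(\<Sum>\<^sub>\<infinity>w\<in>W. push_forward X e m w * k w) = (\<Sum>\<^sub>\<infinity>x\<in>X. m x * k (e x))" .
qed

context lamp_groups
begin

text \<open>
  The configuration \<open>f\<close> in coordinates centred at the walker's position \<open>g\<close>.
\<close>

definition seen_from :: "'g \<Rightarrow> ('g \<Rightarrow> 'l) \<Rightarrow> 'g \<Rightarrow> 'l" where
  "seen_from g f = (\<lambda>h\<in>carrier \<Gamma>. f (g \<otimes>\<^bsub>\<Gamma>\<^esub> h))"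

lemma seen_from_carrier:
  assumes f: "f \<in> carrier (lamps \<Lambda> \<Gamma>)" and g: "g \<in> carrier \<Gamma>"
  shows "seen_from g f \<in> carrier (lamps \<Lambda> \<Gamma>)"
proof -
  have "{h \<in> carrier \<Gamma>. f (g \<otimes>\<^bsub>\<Gamma>\<^esub> h) \<noteq> \<one>\<^bsub>\<Lambda>\<^esub>} \<subseteq> (\<lambda>x. inv\<^bsub>\<Gamma>\<^esub> g \<otimes>\<^bsub>\<Gamma>\<^esub> x) ` {x \<in> carrier \<Gamma>. f x \<noteq> \<one>\<^bsub>\<Lambda>\<^esub>}"
  proof
    fix h assume "h \<in> {h \<in> carrier \<Gamma>. f (g \<otimes>\<^bsub>\<Gamma>\<^esub> h) \<noteq> \<one>\<^bsub>\<Lambda>\<^esub>}"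
    then show "h \<in> (\<lambda>x. inv\<^bsub>\<Gamma>\<^esub> g \<otimes>\<^bsub>\<Gamma>\<^esub> x) ` {x \<in> carrier \<Gamma>. f x \<noteq> \<one>\<^bsub>\<Lambda>\<^esub>}"
      using g by (intro image_eqI[of _ _ "g \<otimes>\<^bsub>\<Gamma>\<^esub> h"]) (auto simp: \<Gamma>.m_assoc[symmetric])
  qed
  then have "finite {h \<in> carrier \<Gamma>. f (g \<otimes>\<^bsub>\<Gamma>\<^esub> h) \<noteq> \<one>\<^bsub>\<Lambda>\<^esub>}"
    using lampsD(3)[OF f] by (auto intro: finite_subset)
  then have "finite {h \<in> carrier \<Gamma>. seen_from g f h \<noteq> \<one>\<^bsub>\<Lambda>\<^esub>}"
    by (rule rev_finite_subset) (auto simp: seen_from_def)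
  then show ?thesis using f g by (auto simp: lamps_iff seen_from_def)
qed

lemma seen_from_seen_from:
  assumes "g \<in> carrier \<Gamma>" "g' \<in> carrier \<Gamma>"
  shows "seen_from g (seen_from g' f) = seen_from (g' \<otimes>\<^bsub>\<Gamma>\<^esub> g) f"
  using assms by (auto simp: seen_from_def fun_eq_iff \<Gamma>.m_assoc)

lemma seen_from_one:
  assumes "f \<in> carrier (lamps \<Lambda> \<Gamma>)" shows "seen_from \<one>\<^bsub>\<Gamma>\<^esub> f = f"
  using lampsD(2)[OF assms] by (auto simp: seen_from_def fun_eq_iff extensional_def)

lemma wreath_carrier: "carrier (wreath \<Lambda> \<Gamma>) = carrier (lamps \<Lambda> \<Gamma>) \<times> carrier \<Gamma>"
  by (simp add: wreath_def)

lemma wreath_mult: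
  "(f, g) \<otimes>\<^bsub>wreath \<Lambda> \<Gamma>\<^esub> (f', g') = (f \<otimes>\<^bsub>lamps \<Lambda> \<Gamma>\<^esub> seen_from (inv\<^bsub>\<Gamma>\<^esub> g) f', g \<otimes>\<^bsub>\<Gamma>\<^esub> g')"
  by (simp add: wreath_def seen_from_def del: mult_sum_group)

lemma bij_betw_seen_from:
  "bij_betw (\<lambda>(f, g). (g, seen_from g f)) (carrier (wreath \<Lambda> \<Gamma>)) (carrier \<Gamma> \<times> carrier (lamps \<Lambda> \<Gamma>))"
  by (rule bij_betwI[of _ _ _ "\<lambda>(g, f). (seen_from (inv\<^bsub>\<Gamma>\<^esub> g) f, g)"])
    (auto simp: wreath_carrier seen_from_carrier seen_from_seen_from seen_from_one)

lemma lamp_at_inv: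
  assumes l: "l \<in> carrier \<Lambda>"
  shows "lamp_at \<Lambda> \<Gamma> x (inv\<^bsub>\<Lambda>\<^esub> l) = inv\<^bsub>lamps \<Lambda> \<Gamma>\<^esub> (lamp_at \<Lambda> \<Gamma> x l)"
proof -
  interpret N: comm_group "lamps \<Lambda> \<Gamma>" by (rule comm_group_lamps)
  have "lamp_at \<Lambda> \<Gamma> x (inv\<^bsub>\<Lambda>\<^esub> l) \<otimes>\<^bsub>lamps \<Lambda> \<Gamma>\<^esub> lamp_at \<Lambda> \<Gamma> x l = \<one>\<^bsub>lamps \<Lambda> \<Gamma>\<^esub>"
    using l by (simp add: lamp_at_mult del: mult_sum_group) (auto simp: lamp_at_def fun_eq_iff)
  then show ?thesis using l by (intro N.inv_equality[symmetric] lamp_at_carrier) auto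
qed

lemma seen_from_lamp_at:
  assumes "g \<in> carrier \<Gamma>" "x \<in> carrier \<Gamma>"
  shows "seen_from g (lamp_at \<Lambda> \<Gamma> x l) = lamp_at \<Lambda> \<Gamma> (inv\<^bsub>\<Gamma>\<^esub> g \<otimes>\<^bsub>\<Gamma>\<^esub> x) l"
proof -
  have "g \<otimes>\<^bsub>\<Gamma>\<^esub> h = x \<longleftrightarrow> h = inv\<^bsub>\<Gamma>\<^esub> g \<otimes>\<^bsub>\<Gamma>\<^esub> x" if "h \<in> carrier \<Gamma>" for h
    using \<Gamma>.inv_solve_left[of h g x] that assms by auto
  then show ?thesis using assms by (auto simp: seen_from_def lamp_at_def fun_eq_iff)
qed

lemma seen_from_mult:
  "g \<in> carrier \<Gamma> \<Longrightarrow> seen_from g (f \<otimes>\<^bsub>lamps \<Lambda> \<Gamma>\<^esub> f') = seen_from g f \<otimes>\<^bsub>lamps \<Lambda> \<Gamma>\<^esub> seen_from g f'"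
  by (auto simp: seen_from_def fun_eq_iff)

lemma seen_from_lamps_one: "g \<in> carrier \<Gamma> \<Longrightarrow> seen_from g \<one>\<^bsub>lamps \<Lambda> \<Gamma>\<^esub> = \<one>\<^bsub>lamps \<Lambda> \<Gamma>\<^esub>"
  by (auto simp: seen_from_def fun_eq_iff)

lemma inv_embed_base:
  assumes s: "s \<in> carrier \<Gamma>"
  shows "inv\<^bsub>wreath \<Lambda> \<Gamma>\<^esub> (embed_base \<Lambda> \<Gamma> s) = embed_base \<Lambda> \<Gamma> (inv\<^bsub>\<Gamma>\<^esub> s)"
proof -
  interpret W: group "wreath \<Lambda> \<Gamma>" by (rule group_wreath[OF \<Gamma>.is_group \<Lambda>.is_group])
  interpret N: comm_group "lamps \<Lambda> \<Gamma>" by (rule comm_group_lamps)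
  show ?thesis
  proof (rule W.inv_equality)
    show "embed_base \<Lambda> \<Gamma> (inv\<^bsub>\<Gamma>\<^esub> s) \<otimes>\<^bsub>wreath \<Lambda> \<Gamma>\<^esub> embed_base \<Lambda> \<Gamma> s = \<one>\<^bsub>wreath \<Lambda> \<Gamma>\<^esub>"
      using s N.l_one[OF N.one_closed]
      by (simp add: embed_base_def wreath_mult seen_from_lamps_one del: mult_sum_group one_sum_group)
        (simp add: wreath_def)
    show "embed_base \<Lambda> \<Gamma> s \<in> carrier (wreath \<Lambda> \<Gamma>)" "embed_base \<Lambda> \<Gamma> (inv\<^bsub>\<Gamma>\<^esub> s) \<in> carrier (wreath \<Lambda> \<Gamma>)"
      using s N.one_closed by (auto simp: embed_base_def wreath_carrier simp del: one_sum_group)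
  qed
qed

lemma inv_embed_lamp:
  assumes l: "l \<in> carrier \<Lambda>"
  shows "inv\<^bsub>wreath \<Lambda> \<Gamma>\<^esub> (embed_lamp \<Lambda> \<Gamma> l) = embed_lamp \<Lambda> \<Gamma> (inv\<^bsub>\<Lambda>\<^esub> l)"
proof -
  interpret W: group "wreath \<Lambda> \<Gamma>" by (rule group_wreath[OF \<Gamma>.is_group \<Lambda>.is_group])
  interpret N: comm_group "lamps \<Lambda> \<Gamma>" by (rule comm_group_lamps)
  show ?thesis
  proof (rule W.inv_equality)
    have "lamp_at \<Lambda> \<Gamma> \<one>\<^bsub>\<Gamma>\<^esub> (inv\<^bsub>\<Lambda>\<^esub> l) \<otimes>\<^bsub>lamps \<Lambda> \<Gamma>\<^esub> lamp_at \<Lambda> \<Gamma> \<one>\<^bsub>\<Gamma>\<^esub> l = \<one>\<^bsub>lamps \<Lambda> \<Gamma>\<^esub>"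
      unfolding lamp_at_inv[OF l] by (rule N.l_inv[OF lamp_at_carrier[OF l]])
    then show "embed_lamp \<Lambda> \<Gamma> (inv\<^bsub>\<Lambda>\<^esub> l) \<otimes>\<^bsub>wreath \<Lambda> \<Gamma>\<^esub> embed_lamp \<Lambda> \<Gamma> l = \<one>\<^bsub>wreath \<Lambda> \<Gamma>\<^esub>"
      using l by (simp add: embed_lamp_def wreath_mult seen_from_one lamp_at_carrier del: mult_sum_group one_sum_group)
        (simp add: wreath_def)
    show "embed_lamp \<Lambda> \<Gamma> l \<in> carrier (wreath \<Lambda> \<Gamma>)" "embed_lamp \<Lambda> \<Gamma> (inv\<^bsub>\<Lambda>\<^esub> l) \<in> carrier (wreath \<Lambda> \<Gamma>)"
      using l by (auto simp: embed_lamp_def wreath_carrier lamp_at_carrier)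
  qed
qed

text \<open>
  The transform sees a left translation by \<open>\<Gamma>\<close> as a shift of the walker, and a left translation by a
  lamp as a change of the lamp with index \<open>inv g\<close>.
\<close>

lemma translate_base:
  assumes s: "s \<in> carrier \<Gamma>" and f: "f \<in> carrier (lamps \<Lambda> \<Gamma>)" and g: "g \<in> carrier \<Gamma>"
  shows "inv\<^bsub>wreath \<Lambda> \<Gamma>\<^esub> (embed_base \<Lambda> \<Gamma> s) \<otimes>\<^bsub>wreath \<Lambda> \<Gamma>\<^esub> (f, g) = (seen_from s f, inv\<^bsub>\<Gamma>\<^esub> s \<otimes>\<^bsub>\<Gamma>\<^esub> g)"
    and "seen_from (inv\<^bsub>\<Gamma>\<^esub> s \<otimes>\<^bsub>\<Gamma>\<^esub> g) (seen_from s f) = seen_from g f"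
proof -
  interpret N: comm_group "lamps \<Lambda> \<Gamma>" by (rule comm_group_lamps)
  show "inv\<^bsub>wreath \<Lambda> \<Gamma>\<^esub> (embed_base \<Lambda> \<Gamma> s) \<otimes>\<^bsub>wreath \<Lambda> \<Gamma>\<^esub> (f, g) = (seen_from s f, inv\<^bsub>\<Gamma>\<^esub> s \<otimes>\<^bsub>\<Gamma>\<^esub> g)"
    unfolding inv_embed_base[OF s] unfolding embed_base_def wreath_mult
    using s N.l_one[OF seen_from_carrier[OF f s]] by (simp del: mult_sum_group one_sum_group)
  show "seen_from (inv\<^bsub>\<Gamma>\<^esub> s \<otimes>\<^bsub>\<Gamma>\<^esub> g) (seen_from s f) = seen_from g f"
    using s g by (simp add: seen_from_seen_from \<Gamma>.m_assoc[symmetric])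
qed

lemma translate_lamp:
  assumes l: "l \<in> carrier \<Lambda>" and f: "f \<in> carrier (lamps \<Lambda> \<Gamma>)" and g: "g \<in> carrier \<Gamma>"
  shows "inv\<^bsub>wreath \<Lambda> \<Gamma>\<^esub> (embed_lamp \<Lambda> \<Gamma> l) \<otimes>\<^bsub>wreath \<Lambda> \<Gamma>\<^esub> (f, g) =
      (lamp_at \<Lambda> \<Gamma> \<one>\<^bsub>\<Gamma>\<^esub> (inv\<^bsub>\<Lambda>\<^esub> l) \<otimes>\<^bsub>lamps \<Lambda> \<Gamma>\<^esub> f, g)"
    and "seen_from g (lamp_at \<Lambda> \<Gamma> \<one>\<^bsub>\<Gamma>\<^esub> (inv\<^bsub>\<Lambda>\<^esub> l) \<otimes>\<^bsub>lamps \<Lambda> \<Gamma>\<^esub> f) =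
      inv\<^bsub>lamps \<Lambda> \<Gamma>\<^esub> (lamp_at \<Lambda> \<Gamma> (inv\<^bsub>\<Gamma>\<^esub> g) l) \<otimes>\<^bsub>lamps \<Lambda> \<Gamma>\<^esub> seen_from g f"
proof -
  show "inv\<^bsub>wreath \<Lambda> \<Gamma>\<^esub> (embed_lamp \<Lambda> \<Gamma> l) \<otimes>\<^bsub>wreath \<Lambda> \<Gamma>\<^esub> (f, g) =
      (lamp_at \<Lambda> \<Gamma> \<one>\<^bsub>\<Gamma>\<^esub> (inv\<^bsub>\<Lambda>\<^esub> l) \<otimes>\<^bsub>lamps \<Lambda> \<Gamma>\<^esub> f, g)"
    unfolding inv_embed_lamp[OF l] unfolding embed_lamp_def wreath_mult
    using g by (simp add: seen_from_one[OF f] del: mult_sum_group one_sum_group)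
  show "seen_from g (lamp_at \<Lambda> \<Gamma> \<one>\<^bsub>\<Gamma>\<^esub> (inv\<^bsub>\<Lambda>\<^esub> l) \<otimes>\<^bsub>lamps \<Lambda> \<Gamma>\<^esub> f) =
      inv\<^bsub>lamps \<Lambda> \<Gamma>\<^esub> (lamp_at \<Lambda> \<Gamma> (inv\<^bsub>\<Gamma>\<^esub> g) l) \<otimes>\<^bsub>lamps \<Lambda> \<Gamma>\<^esub> seen_from g f"
    unfolding seen_from_mult[OF g] seen_from_lamp_at[OF g \<Gamma>.one_closed]
    using g by (simp add: lamp_at_inv[OF l, symmetric] del: mult_sum_group)
qed

end

locale lamp_dual = lamp_groups \<Gamma> \<Lambda> + P: dual_probability "lamps \<Lambda> \<Gamma>" P
  for \<Gamma> :: "('g, 'c) monoid_scheme" and \<Lambda> :: "('l, 'b) monoid_scheme"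
    and P :: "(('g \<Rightarrow> 'l) \<Rightarrow> complex) measure"
begin

text \<open>
  Up to the relabelling \<open>(f, g) \<mapsto> (g, seen_from g f)\<close> the transform is the Fourier transform in every
  fibre, from which it inherits unitarity.
\<close>

lemma lamp_transform_eq:
  "lamp_transform \<Lambda> \<Gamma> P \<phi> = (\<lambda>y. if y \<in> carrier (wreath \<Lambda> \<Gamma>)
     then P.field_coeff (carrier \<Gamma>) \<phi> (case y of (f, g) \<Rightarrow> (g, seen_from g f)) else 0)"
  by (auto simp: lamp_transform_def fun_eq_iff wreath_carrier P.field_coeff_def P.coeff_def
      seen_from_carrier seen_from_def[symmetric])

lemma lamp_transform_apply:
  assumes "f \<in> carrier (lamps \<Lambda> \<Gamma>)" "g \<in> carrier \<Gamma>"
  shows "lamp_transform \<Lambda> \<Gamma> P \<phi> (f, g) = (\<integral>\<omega>. cnj (\<omega> (seen_from g f)) * \<phi> \<omega> g \<partial>P)"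
  using assms by (simp add: lamp_transform_def wreath_carrier seen_from_def)

proposition unitary_lamp_transform:
  "unitary_transform P (carrier \<Gamma>) (carrier (wreath \<Lambda> \<Gamma>)) (lamp_transform \<Lambda> \<Gamma> P)"
proof -
  note R = ell2_reindex[OF bij_betw_seen_from]
  show ?thesis unfolding unitary_transform_def
  proof (intro conjI ballI allI)
    fix \<phi> assume \<phi>: "\<phi> \<in> L2 P (carrier \<Gamma>)"
    show "lamp_transform \<Lambda> \<Gamma> P (\<lambda>\<omega> x. c * \<phi> \<omega> x) = (\<lambda>y. c * lamp_transform \<Lambda> \<Gamma> P \<phi> y)" for c
      by (auto simp: lamp_transform_eq P.field_coeff_cmult fun_eq_iff)
    fix \<psi> assume \<psi>: "\<psi> \<in> L2 P (carrier \<Gamma>)"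
    show "lamp_transform \<Lambda> \<Gamma> P (\<lambda>\<omega> x. \<phi> \<omega> x + \<psi> \<omega> x) =
        (\<lambda>y. lamp_transform \<Lambda> \<Gamma> P \<phi> y + lamp_transform \<Lambda> \<Gamma> P \<psi> y)"
      by (auto simp: lamp_transform_eq P.field_coeff_add[OF countable_\<Gamma> \<phi> \<psi>] fun_eq_iff)
    show "ell2_inner (carrier (wreath \<Lambda> \<Gamma>)) (lamp_transform \<Lambda> \<Gamma> P \<phi>) (lamp_transform \<Lambda> \<Gamma> P \<psi>) =
        L2_inner P (carrier \<Gamma>) \<phi> \<psi>"
      unfolding lamp_transform_eq R(2) by (rule P.field_coeff_inner[OF countable_\<Gamma> \<phi> \<psi>])
  next
    show "lamp_transform \<Lambda> \<Gamma> P ` L2 P (carrier \<Gamma>) = ell2 (carrier (wreath \<Lambda> \<Gamma>))"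
    proof (intro subset_antisym subsetI)
      fix u assume "u \<in> lamp_transform \<Lambda> \<Gamma> P ` L2 P (carrier \<Gamma>)"
      then show "u \<in> ell2 (carrier (wreath \<Lambda> \<Gamma>))"
        using R(1) P.field_coeff_ell2[OF countable_\<Gamma>] by (auto simp: lamp_transform_eq)
    next
      fix u assume "u \<in> ell2 (carrier (wreath \<Lambda> \<Gamma>))"
      from R(3)[OF this] obtain w where w: "w \<in> ell2 (carrier \<Gamma> \<times> carrier (lamps \<Lambda> \<Gamma>))"
        and u: "u = (\<lambda>y. if y \<in> carrier (wreath \<Lambda> \<Gamma>) then w (case y of (f, g) \<Rightarrow> (g, seen_from g f)) else 0)"
        by blast
      from P.field_coeff_surj[OF countable_\<Gamma> w] obtain \<phi>
        where \<phi>: "\<phi> \<in> L2 P (carrier \<Gamma>)" and w\<phi>: "w = P.field_coeff (carrier \<Gamma>) \<phi>" by blast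
      show "u \<in> lamp_transform \<Lambda> \<Gamma> P ` L2 P (carrier \<Gamma>)"
        unfolding u w\<phi> lamp_transform_eq[symmetric] using \<phi> by (rule imageI)
    qed
  qed
qed

end

section \<open>The random Schroedinger operator as a direct integral\<close>

lemma bounded_op_norm_sq:
  assumes "bounded_op X K L" "u \<in> ell2 X"
  shows "(ell2_norm X (L u))\<^sup>2 \<le> K\<^sup>2 * (ell2_norm X u)\<^sup>2"
proof -
  have "ell2_norm X (L u) \<le> K * ell2_norm X u" using assms by (simp add: bounded_op_def)
  then have "(ell2_norm X (L u))\<^sup>2 \<le> (K * ell2_norm X u)\<^sup>2"
    by (rule power_mono) (rule ell2_norm_nonneg)
  then show ?thesis by (simp add: power_mult_distrib)
qed

lemma bounded_op_add_Diag:
  assumes A: "bounded_op X K A" and d: "\<And>x. x \<in> X \<Longrightarrow> cmod (d x) \<le> C"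
  shows "bounded_op X (sqrt (2 * K\<^sup>2 + 2 * C\<^sup>2)) (\<lambda>u x. A u x + Diag d u x)"
  unfolding bounded_op_def
proof (intro conjI ballI allI)
  fix u assume u: "u \<in> ell2 X"
  have Au: "A u \<in> ell2 X" using A u by (simp add: bounded_op_def)
  have du: "Diag d u \<in> ell2 X"
    using u d square_integrable_mult_bounded[OF ell2D[OF u], of d C] by (simp add: ell2_iff Diag_def)
  show "(\<lambda>x. A u x + Diag d u x) \<in> ell2 X" by (rule ell2_add[OF Au du])
  \<comment> \<open>the constant comes from \<open>\<bar>a + b\<bar>\<^sup>2 \<le> 2 \<bar>a\<bar>\<^sup>2 + 2 \<bar>b\<bar>\<^sup>2\<close>\<close>
  have "(ell2_norm X (\<lambda>x. A u x + Diag d u x))\<^sup>2 \<le>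
      (\<integral>x. 2 * (cmod (A u x))\<^sup>2 + 2 * (C\<^sup>2 * (cmod (u x))\<^sup>2) \<partial>count_space X)"
    unfolding ell2_norm_sq
  proof (rule integral_mono)
    show "integrable (count_space X) (\<lambda>x. (cmod (A u x + Diag d u x))\<^sup>2)"
      by (rule square_integrable_norm_sq[OF ell2D[OF ell2_add[OF Au du]]])
    show "integrable (count_space X) (\<lambda>x. 2 * (cmod (A u x))\<^sup>2 + 2 * (C\<^sup>2 * (cmod (u x))\<^sup>2))"
      using square_integrable_norm_sq[OF ell2D[OF Au]] square_integrable_norm_sq[OF ell2D[OF u]] by simp
    fix x assume "x \<in> space (count_space X)"
    then have "(cmod (Diag d u x))\<^sup>2 \<le> C\<^sup>2 * (cmod (u x))\<^sup>2"
      using d by (auto simp: Diag_def norm_mult power_mult_distrib intro!: mult_right_mono power_mono)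
    then show "(cmod (A u x + Diag d u x))\<^sup>2 \<le> 2 * (cmod (A u x))\<^sup>2 + 2 * (C\<^sup>2 * (cmod (u x))\<^sup>2)"
      using cmod_add_sq_le[of "A u x" "Diag d u x"] by linarith
  qed
  also have "\<dots> = 2 * (ell2_norm X (A u))\<^sup>2 + 2 * (C\<^sup>2 * (ell2_norm X u)\<^sup>2)"
    using square_integrable_norm_sq[OF ell2D[OF Au]] square_integrable_norm_sq[OF ell2D[OF u]]
    by (simp add: ell2_norm_sq)
  also have "\<dots> \<le> 2 * (K\<^sup>2 * (ell2_norm X u)\<^sup>2) + 2 * (C\<^sup>2 * (ell2_norm X u)\<^sup>2)"
    using bounded_op_norm_sq[OF A u] by simp
  also have "\<dots> = (sqrt (2 * K\<^sup>2 + 2 * C\<^sup>2) * ell2_norm X u)\<^sup>2"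
    by (simp add: power_mult_distrib algebra_simps)
  finally show "ell2_norm X (\<lambda>x. A u x + Diag d u x) \<le> sqrt (2 * K\<^sup>2 + 2 * C\<^sup>2) * ell2_norm X u"
    by (rule power2_le_imp_le) (simp add: ell2_norm_nonneg)
  show "(\<lambda>x. A (\<lambda>x. c * u x) x + Diag d (\<lambda>x. c * u x) x) = (\<lambda>x. c * (A u x + Diag d u x))" for c
    using A u by (simp add: bounded_op_def Diag_def distrib_left mult.left_commute)
  fix w assume w: "w \<in> ell2 X"
  show "(\<lambda>x. A (\<lambda>x. u x + w x) x + Diag d (\<lambda>x. u x + w x) x) =
      (\<lambda>x. (A u x + Diag d u x) + (A w x + Diag d w x))"
    using A u w by (simp add: bounded_op_def Diag_def distrib_left add_ac)
qed

lemma direct_integral_L2: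
  assumes X: "countable X" and P: "prob_space P" and K: "\<And>\<omega>. \<omega> \<in> space P \<Longrightarrow> bounded_op X K (H \<omega>)"
    and \<phi>: "\<phi> \<in> L2 P X" and meas: "\<And>x. x \<in> X \<Longrightarrow> (\<lambda>\<omega>. H \<omega> (\<phi> \<omega>) x) \<in> borel_measurable P"
  shows "direct_integral H \<phi> \<in> L2 P X"
  unfolding L2_def direct_integral_def
proof (intro CollectI conjI ballI meas)
  show ell2: "H \<omega> (\<phi> \<omega>) \<in> ell2 X" if "\<omega> \<in> space P" for \<omega>
    using K[OF that] L2D(1)[OF \<phi> that] by (simp add: bounded_op_def)
  show "integrable P (\<lambda>\<omega>. (ell2_norm X (H \<omega> (\<phi> \<omega>)))\<^sup>2)"
  proof (rule Bochner_Integration.integrable_bound)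
    show "integrable P (\<lambda>\<omega>. K\<^sup>2 * (ell2_norm X (\<phi> \<omega>))\<^sup>2)" using L2D(3)[OF \<phi>] by simp
    show "(\<lambda>\<omega>. (ell2_norm X (H \<omega> (\<phi> \<omega>)))\<^sup>2) \<in> borel_measurable P"
      unfolding ell2_norm_sq
    proof (rule borel_measurable_count_space_integral[OF X])
      fix x assume "x \<in> X"
      note [measurable] = meas[OF this]
      show "(\<lambda>\<omega>. (cmod (H \<omega> (\<phi> \<omega>) x))\<^sup>2) \<in> borel_measurable P" by measurable
    qed
    show "AE \<omega> in P. norm ((ell2_norm X (H \<omega> (\<phi> \<omega>)))\<^sup>2) \<le> norm (K\<^sup>2 * (ell2_norm X (\<phi> \<omega>))\<^sup>2)"
      using bounded_op_norm_sq[OF K L2D(1)[OF \<phi>]] by (intro AE_I2) simp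
  qed
qed

text \<open>
  The chosen representative of the adjoint and \<open>\<psi>\<close> have the same inner product with every field, in
  particular with their difference, which therefore has norm zero.
\<close>

lemma adjoint_transform_AE:
  assumes X: "countable X" and P: "prob_space P" and U: "unitary_transform P X Y F"
    and \<psi>: "\<psi> \<in> L2 P X"
  shows "AE \<omega> in P. \<psi> \<omega> = adjoint_transform P X Y F (F \<psi>) \<omega>"
proof -
  have inner: "ell2_inner Y (F \<phi>) (F \<psi>') = L2_inner P X \<phi> \<psi>'" if "\<phi> \<in> L2 P X" "\<psi>' \<in> L2 P X" for \<phi> \<psi>'
    using U that by (simp add: unitary_transform_def)
  define \<psi>' where "\<psi>' = adjoint_transform P X Y F (F \<psi>)"
  have "\<exists>\<psi>'. \<psi>' \<in> L2 P X \<and> (\<forall>\<phi>\<in>L2 P X. L2_inner P X \<phi> \<psi>' = ell2_inner Y (F \<phi>) (F \<psi>))"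
    using \<psi> inner by (intro exI[of _ \<psi>]) simp
  from someI_ex[OF this] have \<psi>': "\<psi>' \<in> L2 P X"
    and eq: "\<And>\<phi>. \<phi> \<in> L2 P X \<Longrightarrow> L2_inner P X \<phi> \<psi>' = L2_inner P X \<phi> \<psi>"
    using inner \<psi> by (auto simp: \<psi>'_def adjoint_transform_def)
  let ?\<delta> = "\<lambda>\<omega> x. \<psi> \<omega> x + (-1) * \<psi>' \<omega> x"
  have neg: "(\<lambda>\<omega> x. (-1) * \<psi>' \<omega> x) \<in> L2 P X" by (rule L2_cmult[OF X P \<psi>'])
  have \<delta>: "?\<delta> \<in> L2 P X" by (rule L2_add[OF X P \<psi> neg])
  have int: "integrable P (\<lambda>\<omega>. ell2_inner X (?\<delta> \<omega>) (\<theta> \<omega>))" if \<theta>: "\<theta> \<in> L2 P X" for \<theta>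
  proof -
    interpret P: prob_space P by fact
    interpret pair_sigma_finite "count_space X" P
      by (intro pair_sigma_finite.intro sigma_finite_measure_count_space_countable X P.sigma_finite_measure_axioms)
    have "integrable (count_space X \<Otimes>\<^sub>M P) (\<lambda>(x, \<omega>). cnj (?\<delta> \<omega> x) * \<theta> \<omega> x)"
      using square_integrable_inner[OF L2_square_integrable[OF X P \<delta>] L2_square_integrable[OF X P \<theta>]]
      by (simp add: split_def)
    from integrable_snd[OF this] show ?thesis by (simp add: ell2_inner_eq_integral)
  qed
  have "L2_inner P X ?\<delta> ?\<delta> = (\<integral>\<omega>. ell2_inner X (?\<delta> \<omega>) (\<psi> \<omega>) + (-1) * ell2_inner X (?\<delta> \<omega>) (\<psi>' \<omega>) \<partial>P)"
    unfolding L2_inner_def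
  proof (rule Bochner_Integration.integral_cong[OF refl])
    fix \<omega> assume \<omega>: "\<omega> \<in> space P"
    note mem = L2D(1)[OF \<delta> \<omega>] L2D(1)[OF \<psi> \<omega>] L2D(1)[OF neg \<omega>]
    show "ell2_inner X (?\<delta> \<omega>) (?\<delta> \<omega>) = ell2_inner X (?\<delta> \<omega>) (\<psi> \<omega>) + (-1) * ell2_inner X (?\<delta> \<omega>) (\<psi>' \<omega>)"
      by (simp only: ell2_inner_add_right[OF mem] ell2_inner_cmult_right)
  qed
  also have "\<dots> = L2_inner P X ?\<delta> \<psi> + (-1) * L2_inner P X ?\<delta> \<psi>'"
    unfolding L2_inner_def using int[OF \<psi>] int[OF \<psi>'] by simp
  also have "\<dots> = 0" using eq[OF \<delta>] by simp
  finally have "L2_inner P X ?\<delta> ?\<delta> = 0" .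
  moreover have "L2_inner P X ?\<delta> ?\<delta> = complex_of_real (\<integral>\<omega>. (ell2_norm X (?\<delta> \<omega>))\<^sup>2 \<partial>P)"
    unfolding L2_inner_def ell2_inner_self by (rule integral_complex_of_real)
  ultimately have "(\<integral>\<omega>. (ell2_norm X (?\<delta> \<omega>))\<^sup>2 \<partial>P) = 0" by simp
  then have "AE \<omega> in P. (ell2_norm X (?\<delta> \<omega>))\<^sup>2 = 0"
    using integral_nonneg_eq_0_iff_AE[OF L2D(3)[OF \<delta>]] by simp
  then have "AE \<omega> in P. \<psi> \<omega> = \<psi>' \<omega>"
    using AE_space
  proof eventually_elim
    case (elim \<omega>)
    then have "?\<delta> \<omega> = (\<lambda>_. 0)" using ell2_norm_eq_0[OF L2D(1)[OF \<delta>]] by simp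
    then show ?case by (simp add: fun_eq_iff)
  qed
  then show ?thesis by (simp add: \<psi>'_def)
qed

locale lamp_schroedinger = lamp_dual \<Gamma> \<Lambda> P
  for \<Gamma> :: "('g, 'c) monoid_scheme" and \<Lambda> :: "('l, 'b) monoid_scheme" and P +
  fixes m\<^sub>\<Gamma> :: "'g \<Rightarrow> complex" and m\<^sub>\<Lambda> :: "'l \<Rightarrow> complex"
  assumes countable_\<Lambda>: "countable (carrier \<Lambda>)"
    and m\<^sub>\<Gamma>: "m\<^sub>\<Gamma> \<in> ell1 (carrier \<Gamma>)" and m\<^sub>\<Lambda>: "m\<^sub>\<Lambda> \<in> ell1 (carrier \<Lambda>)"
    and sa\<^sub>\<Gamma>: "self_adjoint_op (carrier \<Gamma>) (conv_op \<Gamma> m\<^sub>\<Gamma>)"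
    and sa\<^sub>\<Lambda>: "self_adjoint_op (carrier \<Lambda>) (conv_op \<Lambda> m\<^sub>\<Lambda>)"
begin

abbreviation "v \<equiv> lamp_potential \<Lambda> \<Gamma> m\<^sub>\<Lambda>"
abbreviation "H \<equiv> random_schroedinger \<Gamma> m\<^sub>\<Gamma> v"
abbreviation "M \<equiv> conv_op (wreath \<Lambda> \<Gamma>) (wreath_measure \<Lambda> \<Gamma> m\<^sub>\<Lambda> m\<^sub>\<Gamma>)"

definition v_bound :: real where "v_bound = (\<Sum>\<^sub>\<infinity>l\<in>carrier \<Lambda>. cmod (m\<^sub>\<Lambda> l))"

lemma lamp_sum_eq_potential:
  assumes \<omega>: "\<omega> \<in> space P" and x: "x \<in> carrier \<Gamma>"
  shows "(\<Sum>\<^sub>\<infinity>l\<in>carrier \<Lambda>. m\<^sub>\<Lambda> l * \<omega> (lamp_at \<Lambda> \<Gamma> (inv\<^bsub>\<Gamma>\<^esub> x) l)) = complex_of_real (v x \<omega>)"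
proof -
  let ?\<theta> = "lamp_component \<Lambda> \<Gamma> (inv\<^bsub>\<Gamma>\<^esub> x) \<omega>"
  have "?\<theta> \<in> pontryagin_dual \<Lambda>"
    using \<omega> by (intro lamp_component_dual) (simp add: P.space_P)
  from \<Lambda>.character_sum_real[OF sa\<^sub>\<Lambda> this]
  show ?thesis by (simp add: lamp_potential_def lamp_component_def cong: infsum_cong)
qed

lemma v_bounded:
  assumes \<omega>: "\<omega> \<in> space P" and x: "x \<in> carrier \<Gamma>" shows "cmod (complex_of_real (v x \<omega>)) \<le> v_bound"
  unfolding lamp_sum_eq_potential[OF assms, symmetric] v_bound_def
  using \<omega> by (intro ell1_unit_sum_bound[OF m\<^sub>\<Lambda>]) (simp add: P.norm_eval lamp_at_carrier)

lemma v_measurable: "v x \<in> borel_measurable P"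
proof -
  have "(\<lambda>\<omega>. \<integral>l. m\<^sub>\<Lambda> l * \<omega> (lamp_at \<Lambda> \<Gamma> (inv\<^bsub>\<Gamma>\<^esub> x) l) \<partial>count_space (carrier \<Lambda>)) \<in> borel_measurable P"
    by (intro borel_measurable_count_space_integral countable_\<Lambda> borel_measurable_times
        borel_measurable_const P.measurable_eval lamp_at_carrier)
  then show ?thesis unfolding lamp_potential_def[abs_def] infsum_eq_integral_complex by measurable
qed

lemma bounded_H: "\<exists>K. \<forall>\<omega>\<in>space P. bounded_op (carrier \<Gamma>) K (H \<omega>)"
proof -
  obtain K where K: "bounded_op (carrier \<Gamma>) K (conv_op \<Gamma> m\<^sub>\<Gamma>)" using sa\<^sub>\<Gamma> by (auto simp: self_adjoint_op_def)
  have "bounded_op (carrier \<Gamma>) (sqrt (2 * K\<^sup>2 + 2 * v_bound\<^sup>2)) (H \<omega>)" if \<omega>: "\<omega> \<in> space P" for \<omega>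
    unfolding random_schroedinger_def using v_bounded[OF \<omega>] by (intro bounded_op_add_Diag[OF K])
  then show ?thesis by blast
qed

proposition bounded_measurable_field_H: "bounded_measurable_field P (carrier \<Gamma>) H"
  unfolding bounded_measurable_field_def
proof (intro conjI ballI bounded_H)
  fix u w
  show "(\<lambda>\<omega>. ell2_inner (carrier \<Gamma>) u (H \<omega> w)) \<in> borel_measurable P"
    unfolding ell2_inner_eq_integral random_schroedinger_def Diag_def
  proof (rule borel_measurable_count_space_integral[OF countable_\<Gamma>])
    fix x
    note [measurable] = v_measurable[of x]
    show "(\<lambda>\<omega>. cnj (u x) * (conv_op \<Gamma> m\<^sub>\<Gamma> w x + complex_of_real (v x \<omega>) * w x)) \<in> borel_measurable P"
      by measurable
  qed
qed

lemma conv_op_field_measurable: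
  assumes \<phi>: "\<phi> \<in> L2 P (carrier \<Gamma>)" and x: "x \<in> carrier \<Gamma>"
  shows "(\<lambda>\<omega>. conv_op \<Gamma> m\<^sub>\<Gamma> (\<phi> \<omega>) x) \<in> borel_measurable P"
  unfolding conv_op_def infsum_eq_integral_complex
proof (rule borel_measurable_count_space_integral[OF countable_\<Gamma>])
  fix s assume s: "s \<in> carrier \<Gamma>"
  have "(\<lambda>\<omega>. \<phi> \<omega> (inv\<^bsub>\<Gamma>\<^esub> s \<otimes>\<^bsub>\<Gamma>\<^esub> x)) \<in> borel_measurable P" using s x by (intro L2D(2)[OF \<phi>]) auto
  then show "(\<lambda>\<omega>. m\<^sub>\<Gamma> s * left_regular \<Gamma> s (\<phi> \<omega>) x) \<in> borel_measurable P"
    using x by (simp add: left_regular_def)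
qed

lemma direct_integral_H_L2:
  assumes \<phi>: "\<phi> \<in> L2 P (carrier \<Gamma>)"
  shows "direct_integral H \<phi> \<in> L2 P (carrier \<Gamma>)"
proof -
  obtain K where K: "\<And>\<omega>. \<omega> \<in> space P \<Longrightarrow> bounded_op (carrier \<Gamma>) K (H \<omega>)" using bounded_H by blast
  show ?thesis
  proof (rule direct_integral_L2[OF countable_\<Gamma> P.prob_space_axioms K \<phi>])
    fix x assume x: "x \<in> carrier \<Gamma>"
    note [measurable] = v_measurable[of x] conv_op_field_measurable[OF \<phi> x] L2D(2)[OF \<phi> x]
    show "(\<lambda>\<omega>. H \<omega> (\<phi> \<omega>) x) \<in> borel_measurable P"
      unfolding random_schroedinger_def Diag_def by measurable
  qed
qed

lemma transform_base_part:
  assumes \<phi>: "\<phi> \<in> L2 P (carrier \<Gamma>)" and f: "f \<in> carrier (lamps \<Lambda> \<Gamma>)" and g: "g \<in> carrier \<Gamma>"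
  shows "(\<Sum>\<^sub>\<infinity>s\<in>carrier \<Gamma>. m\<^sub>\<Gamma> s * lamp_transform \<Lambda> \<Gamma> P \<phi>
        (inv\<^bsub>wreath \<Lambda> \<Gamma>\<^esub> (embed_base \<Lambda> \<Gamma> s) \<otimes>\<^bsub>wreath \<Lambda> \<Gamma>\<^esub> (f, g))) =
      (\<integral>\<omega>. cnj (\<omega> (seen_from g f)) * conv_op \<Gamma> m\<^sub>\<Gamma> (\<phi> \<omega>) g \<partial>P)"
proof -
  note F = L2_Fubini[OF countable_\<Gamma> P.prob_space_axioms \<phi> \<phi>]
  have fg: "seen_from g f \<in> carrier (lamps \<Lambda> \<Gamma>)" by (rule seen_from_carrier[OF f g])
  have int: "integrable P (\<lambda>\<omega>. cnj (\<omega> (seen_from g f)) * \<phi> \<omega> (inv\<^bsub>\<Gamma>\<^esub> s \<otimes>\<^bsub>\<Gamma>\<^esub> g))" if "s \<in> carrier \<Gamma>" for s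
    using that g by (intro P.integrable_coeff[OF F(4) fg]) auto
  have "(\<Sum>\<^sub>\<infinity>s\<in>carrier \<Gamma>. m\<^sub>\<Gamma> s * lamp_transform \<Lambda> \<Gamma> P \<phi>
        (inv\<^bsub>wreath \<Lambda> \<Gamma>\<^esub> (embed_base \<Lambda> \<Gamma> s) \<otimes>\<^bsub>wreath \<Lambda> \<Gamma>\<^esub> (f, g))) =
      (\<Sum>\<^sub>\<infinity>s\<in>carrier \<Gamma>. m\<^sub>\<Gamma> s * (\<integral>\<omega>. cnj (\<omega> (seen_from g f)) * \<phi> \<omega> (inv\<^bsub>\<Gamma>\<^esub> s \<otimes>\<^bsub>\<Gamma>\<^esub> g) \<partial>P))"
  proof (rule infsum_cong)
    fix s assume s: "s \<in> carrier \<Gamma>"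
    show "m\<^sub>\<Gamma> s * lamp_transform \<Lambda> \<Gamma> P \<phi> (inv\<^bsub>wreath \<Lambda> \<Gamma>\<^esub> (embed_base \<Lambda> \<Gamma> s) \<otimes>\<^bsub>wreath \<Lambda> \<Gamma>\<^esub> (f, g)) =
        m\<^sub>\<Gamma> s * (\<integral>\<omega>. cnj (\<omega> (seen_from g f)) * \<phi> \<omega> (inv\<^bsub>\<Gamma>\<^esub> s \<otimes>\<^bsub>\<Gamma>\<^esub> g) \<partial>P)"
      unfolding translate_base(1)[OF s f g]
      using s g by (subst lamp_transform_apply) (simp_all add: seen_from_carrier f translate_base(2)[OF s f g])
  qed
  also have "\<dots> = (\<integral>\<omega>. (\<Sum>\<^sub>\<infinity>s\<in>carrier \<Gamma>. m\<^sub>\<Gamma> s * (cnj (\<omega> (seen_from g f)) * \<phi> \<omega> (inv\<^bsub>\<Gamma>\<^esub> s \<otimes>\<^bsub>\<Gamma>\<^esub> g))) \<partial>P)"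
  proof (rule infsum_integral_swap[OF countable_\<Gamma> m\<^sub>\<Gamma> P.sigma_finite_measure_axioms int])
    fix s assume s: "s \<in> carrier \<Gamma>"
    show "(\<integral>\<omega>. norm (cnj (\<omega> (seen_from g f)) * \<phi> \<omega> (inv\<^bsub>\<Gamma>\<^esub> s \<otimes>\<^bsub>\<Gamma>\<^esub> g)) \<partial>P) \<le>
        (\<integral>\<omega>. 1 + (ell2_norm (carrier \<Gamma>) (\<phi> \<omega>))\<^sup>2 \<partial>P)"
    proof (rule integral_mono)
      show "integrable P (\<lambda>\<omega>. norm (cnj (\<omega> (seen_from g f)) * \<phi> \<omega> (inv\<^bsub>\<Gamma>\<^esub> s \<otimes>\<^bsub>\<Gamma>\<^esub> g)))"
        using int[OF s] by (rule integrable_norm)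
      show "integrable P (\<lambda>\<omega>. 1 + (ell2_norm (carrier \<Gamma>) (\<phi> \<omega>))\<^sup>2)" using L2D(3)[OF \<phi>] by simp
      fix \<omega> assume \<omega>: "\<omega> \<in> space P"
      \<comment> \<open>all coordinates of \<open>\<phi> \<omega>\<close> are bounded by its norm, so the bound is uniform in \<open>s\<close>\<close>
      let ?n = "ell2_norm (carrier \<Gamma>) (\<phi> \<omega>)"
      have "norm (cnj (\<omega> (seen_from g f)) * \<phi> \<omega> (inv\<^bsub>\<Gamma>\<^esub> s \<otimes>\<^bsub>\<Gamma>\<^esub> g)) \<le> ?n"
        using ell2_pointwise_bound[OF L2D(1)[OF \<phi> \<omega>]] by (simp add: norm_mult P.norm_eval[OF \<omega> fg])
      also have "?n \<le> 1 + ?n\<^sup>2"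
        using sum_squares_bound[of 1 ?n] ell2_norm_nonneg[of "carrier \<Gamma>" "\<phi> \<omega>"] by simp
      finally show "norm (cnj (\<omega> (seen_from g f)) * \<phi> \<omega> (inv\<^bsub>\<Gamma>\<^esub> s \<otimes>\<^bsub>\<Gamma>\<^esub> g)) \<le> 1 + ?n\<^sup>2" .
    qed
  qed
  also have "\<dots> = (\<integral>\<omega>. cnj (\<omega> (seen_from g f)) * conv_op \<Gamma> m\<^sub>\<Gamma> (\<phi> \<omega>) g \<partial>P)"
    using g by (simp add: conv_op_def left_regular_def infsum_cmult_right'[symmetric] mult.left_commute)
  finally show ?thesis .
qed

lemma transform_lamp_part:
  assumes \<phi>: "\<phi> \<in> L2 P (carrier \<Gamma>)" and f: "f \<in> carrier (lamps \<Lambda> \<Gamma>)" and g: "g \<in> carrier \<Gamma>"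
  shows "(\<Sum>\<^sub>\<infinity>l\<in>carrier \<Lambda>. m\<^sub>\<Lambda> l * lamp_transform \<Lambda> \<Gamma> P \<phi>
        (inv\<^bsub>wreath \<Lambda> \<Gamma>\<^esub> (embed_lamp \<Lambda> \<Gamma> l) \<otimes>\<^bsub>wreath \<Lambda> \<Gamma>\<^esub> (f, g))) =
      (\<integral>\<omega>. cnj (\<omega> (seen_from g f)) * (complex_of_real (v g \<omega>) * \<phi> \<omega> g) \<partial>P)"
proof -
  have sq: "square_integrable P (\<lambda>\<omega>. \<phi> \<omega> g)"
    by (rule L2_Fubini(4)[OF countable_\<Gamma> P.prob_space_axioms \<phi> \<phi> g])
  have fg: "seen_from g f \<in> carrier (lamps \<Lambda> \<Gamma>)" by (rule seen_from_carrier[OF f g])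
  let ?a = "\<lambda>l. lamp_at \<Lambda> \<Gamma> (inv\<^bsub>\<Gamma>\<^esub> g) l" and ?F = "\<lambda>\<omega>. cnj (\<omega> (seen_from g f)) * \<phi> \<omega> g"
  have F: "integrable P ?F" by (rule P.integrable_coeff[OF sq fg])
  have a: "?a l \<in> carrier (lamps \<Lambda> \<Gamma>)" if "l \<in> carrier \<Lambda>" for l by (rule lamp_at_carrier[OF that])
  have "(\<Sum>\<^sub>\<infinity>l\<in>carrier \<Lambda>. m\<^sub>\<Lambda> l * lamp_transform \<Lambda> \<Gamma> P \<phi>
        (inv\<^bsub>wreath \<Lambda> \<Gamma>\<^esub> (embed_lamp \<Lambda> \<Gamma> l) \<otimes>\<^bsub>wreath \<Lambda> \<Gamma>\<^esub> (f, g))) =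
      (\<Sum>\<^sub>\<infinity>l\<in>carrier \<Lambda>. m\<^sub>\<Lambda> l * (\<integral>\<omega>. \<omega> (?a l) * ?F \<omega> \<partial>P))"
  proof (rule infsum_cong)
    fix l assume l: "l \<in> carrier \<Lambda>"
    have "lamp_at \<Lambda> \<Gamma> \<one>\<^bsub>\<Gamma>\<^esub> (inv\<^bsub>\<Lambda>\<^esub> l) \<otimes>\<^bsub>lamps \<Lambda> \<Gamma>\<^esub> f \<in> carrier (lamps \<Lambda> \<Gamma>)"
      using l f by (intro P.m_closed lamp_at_carrier) auto
    then have "lamp_transform \<Lambda> \<Gamma> P \<phi> (inv\<^bsub>wreath \<Lambda> \<Gamma>\<^esub> (embed_lamp \<Lambda> \<Gamma> l) \<otimes>\<^bsub>wreath \<Lambda> \<Gamma>\<^esub> (f, g)) =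
        (\<integral>\<omega>. cnj (\<omega> (inv\<^bsub>lamps \<Lambda> \<Gamma>\<^esub> (?a l) \<otimes>\<^bsub>lamps \<Lambda> \<Gamma>\<^esub> seen_from g f)) * \<phi> \<omega> g \<partial>P)"
      unfolding translate_lamp(1)[OF l f g] translate_lamp(2)[OF l f g, symmetric]
      using g by (rule lamp_transform_apply)
    also have "\<dots> = (\<integral>\<omega>. \<omega> (?a l) * ?F \<omega> \<partial>P)"
    proof (rule Bochner_Integration.integral_cong[OF refl])
      fix \<omega> assume "\<omega> \<in> space P"
      then have \<omega>: "\<omega> \<in> pontryagin_dual (lamps \<Lambda> \<Gamma>)" by (simp add: P.space_P)
      show "cnj (\<omega> (inv\<^bsub>lamps \<Lambda> \<Gamma>\<^esub> (?a l) \<otimes>\<^bsub>lamps \<Lambda> \<Gamma>\<^esub> seen_from g f)) * \<phi> \<omega> g = \<omega> (?a l) * ?F \<omega>"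
        unfolding dual_mult[OF \<omega> P.inv_closed[OF a[OF l]] fg] P.dual_inv[OF \<omega> a[OF l]] by simp
    qed
    finally show "m\<^sub>\<Lambda> l * lamp_transform \<Lambda> \<Gamma> P \<phi> (inv\<^bsub>wreath \<Lambda> \<Gamma>\<^esub> (embed_lamp \<Lambda> \<Gamma> l) \<otimes>\<^bsub>wreath \<Lambda> \<Gamma>\<^esub> (f, g)) =
        m\<^sub>\<Lambda> l * (\<integral>\<omega>. \<omega> (?a l) * ?F \<omega> \<partial>P)" by simp
  qed
  also have "\<dots> = (\<integral>\<omega>. (\<Sum>\<^sub>\<infinity>l\<in>carrier \<Lambda>. m\<^sub>\<Lambda> l * (\<omega> (?a l) * ?F \<omega>)) \<partial>P)"
  proof (rule infsum_integral_swap[OF countable_\<Lambda> m\<^sub>\<Lambda> P.sigma_finite_measure_axioms])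
    fix l assume l: "l \<in> carrier \<Lambda>"
    note [measurable] = P.measurable_eval[OF a[OF l]] borel_measurable_integrable[OF F]
    have norm: "norm (\<omega> (?a l) * ?F \<omega>) = norm (?F \<omega>)" if "\<omega> \<in> space P" for \<omega>
      by (simp add: norm_mult P.norm_eval[OF that a[OF l]])
    show "integrable P (\<lambda>\<omega>. \<omega> (?a l) * ?F \<omega>)"
      by (rule Bochner_Integration.integrable_bound[OF F]) (use norm in \<open>auto intro!: AE_I2\<close>)
    show "(\<integral>\<omega>. norm (\<omega> (?a l) * ?F \<omega>) \<partial>P) \<le> (\<integral>\<omega>. norm (?F \<omega>) \<partial>P)"
      by (rule eq_refl, rule Bochner_Integration.integral_cong[OF refl norm])
  qed
  also have "\<dots> = (\<integral>\<omega>. cnj (\<omega> (seen_from g f)) * (complex_of_real (v g \<omega>) * \<phi> \<omega> g) \<partial>P)"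
  proof (rule Bochner_Integration.integral_cong[OF refl])
    fix \<omega> assume \<omega>: "\<omega> \<in> space P"
    have "(\<Sum>\<^sub>\<infinity>l\<in>carrier \<Lambda>. m\<^sub>\<Lambda> l * (\<omega> (?a l) * ?F \<omega>)) = (\<Sum>\<^sub>\<infinity>l\<in>carrier \<Lambda>. m\<^sub>\<Lambda> l * \<omega> (?a l)) * ?F \<omega>"
      by (simp only: mult.assoc[symmetric] infsum_cmult_left')
    then show "(\<Sum>\<^sub>\<infinity>l\<in>carrier \<Lambda>. m\<^sub>\<Lambda> l * (\<omega> (?a l) * ?F \<omega>)) =
        cnj (\<omega> (seen_from g f)) * (complex_of_real (v g \<omega>) * \<phi> \<omega> g)"
      by (simp add: lamp_sum_eq_potential[OF \<omega> g])
  qed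
  finally show ?thesis .
qed

proposition lamp_transform_intertwines:
  assumes \<phi>: "\<phi> \<in> L2 P (carrier \<Gamma>)"
  shows "lamp_transform \<Lambda> \<Gamma> P (direct_integral H \<phi>) = M (lamp_transform \<Lambda> \<Gamma> P \<phi>)"
proof
  fix y
  let ?W = "wreath \<Lambda> \<Gamma>" and ?T = "lamp_transform \<Lambda> \<Gamma> P \<phi>"
  interpret W: group ?W by (rule group_wreath[OF \<Gamma>.is_group \<Lambda>.is_group])
  show "lamp_transform \<Lambda> \<Gamma> P (direct_integral H \<phi>) y = M ?T y"
  proof (cases "y \<in> carrier ?W")
    case False
    then show ?thesis by (simp add: lamp_transform_eq conv_op_def left_regular_def)
  next
    case True
    then obtain f g where y: "y = (f, g)" and f: "f \<in> carrier (lamps \<Lambda> \<Gamma>)" and g: "g \<in> carrier \<Gamma>"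
      by (auto simp: wreath_carrier)
    have T: "?T \<in> ell2 (carrier ?W)"
      using unitary_lamp_transform \<phi> by (auto simp: unitary_transform_def)
    let ?k = "\<lambda>w. ?T (inv\<^bsub>?W\<^esub> w \<otimes>\<^bsub>?W\<^esub> y)"
    have k: "cmod (?k w) \<le> ell2_norm (carrier ?W) ?T" for w by (rule ell2_pointwise_bound[OF T])
    have base: "inj_on (embed_base \<Lambda> \<Gamma>) (carrier \<Gamma>)" "embed_base \<Lambda> \<Gamma> ` carrier \<Gamma> \<subseteq> carrier ?W"
      using P.one_closed by (auto simp: inj_on_def embed_base_def wreath_carrier simp del: one_sum_group)
    have lamp: "inj_on (embed_lamp \<Lambda> \<Gamma>) (carrier \<Lambda>)" "embed_lamp \<Lambda> \<Gamma> ` carrier \<Lambda> \<subseteq> carrier ?W"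
    proof -
      have "lamp_at \<Lambda> \<Gamma> \<one>\<^bsub>\<Gamma>\<^esub> l \<one>\<^bsub>\<Gamma>\<^esub> = l" for l by (simp add: lamp_at_def)
      then show "inj_on (embed_lamp \<Lambda> \<Gamma>) (carrier \<Lambda>)"
        by (intro inj_on_inverseI[of _ "\<lambda>p. fst p \<one>\<^bsub>\<Gamma>\<^esub>"]) (simp add: embed_lamp_def)
    qed (auto simp: embed_lamp_def wreath_carrier lamp_at_carrier)
    note push = push_forward_sum[OF base m\<^sub>\<Gamma> k] push_forward_sum[OF lamp m\<^sub>\<Lambda> k]
    have "M ?T y = (\<Sum>\<^sub>\<infinity>w\<in>carrier ?W.
        push_forward (carrier \<Gamma>) (embed_base \<Lambda> \<Gamma>) m\<^sub>\<Gamma> w * ?k w + push_forward (carrier \<Lambda>) (embed_lamp \<Lambda> \<Gamma>) m\<^sub>\<Lambda> w * ?k w)"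
      unfolding conv_op_def left_regular_def if_P[OF True] wreath_measure_def distrib_right ..
    also have "\<dots> = (\<Sum>\<^sub>\<infinity>s\<in>carrier \<Gamma>. m\<^sub>\<Gamma> s * ?k (embed_base \<Lambda> \<Gamma> s)) + (\<Sum>\<^sub>\<infinity>l\<in>carrier \<Lambda>. m\<^sub>\<Lambda> l * ?k (embed_lamp \<Lambda> \<Gamma> l))"
      unfolding infsum_add[OF push(1,3)] push(2,4) ..
    also have "\<dots> = (\<integral>\<omega>. cnj (\<omega> (seen_from g f)) * conv_op \<Gamma> m\<^sub>\<Gamma> (\<phi> \<omega>) g \<partial>P) +
        (\<integral>\<omega>. cnj (\<omega> (seen_from g f)) * (complex_of_real (v g \<omega>) * \<phi> \<omega> g) \<partial>P)"
      unfolding y transform_base_part[OF \<phi> f g] transform_lamp_part[OF \<phi> f g] ..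
    also have "\<dots> = (\<integral>\<omega>. cnj (\<omega> (seen_from g f)) * direct_integral H \<phi> \<omega> g \<partial>P)"
    proof -
      have fg: "seen_from g f \<in> carrier (lamps \<Lambda> \<Gamma>)" by (rule seen_from_carrier[OF f g])
      have sq: "square_integrable P (\<lambda>\<omega>. \<psi> \<omega> g)" if "\<psi> \<in> L2 P (carrier \<Gamma>)" for \<psi>
        by (rule L2_Fubini(4)[OF countable_\<Gamma> P.prob_space_axioms that that g])
      have V: "square_integrable P (\<lambda>\<omega>. complex_of_real (v g \<omega>) * \<phi> \<omega> g)"
        using v_measurable[of g] v_bounded g by (intro square_integrable_mult_bounded[OF sq[OF \<phi>], of _ v_bound]) auto
      have "square_integrable P (\<lambda>\<omega>. direct_integral H \<phi> \<omega> g - complex_of_real (v g \<omega>) * \<phi> \<omega> g)"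
        by (intro square_integrable_diff V sq direct_integral_H_L2 \<phi>)
      then have A: "square_integrable P (\<lambda>\<omega>. conv_op \<Gamma> m\<^sub>\<Gamma> (\<phi> \<omega>) g)"
        by (simp add: direct_integral_def random_schroedinger_def Diag_def)
      show ?thesis
        using P.integrable_coeff[OF A fg] P.integrable_coeff[OF V fg]
        by (simp add: direct_integral_def random_schroedinger_def Diag_def distrib_left)
    qed
    also have "\<dots> = lamp_transform \<Lambda> \<Gamma> P (direct_integral H \<phi>) y"
      unfolding y by (rule lamp_transform_apply[OF f g, symmetric])
    finally show ?thesis ..
  qed
qed

end

text \<open>
  The potential at \<open>x\<close> is the symbol of the component at the site \<open>inv x\<close>; since inversion is injective
  on \<open>\<Gamma>\<close>, these components are independent as well.
\<close>

theorem theorem1p2: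
  fixes \<Gamma> :: "('g, 'c) monoid_scheme" and \<Lambda> :: "('l, 'b) monoid_scheme"
    and m\<^sub>\<Gamma> :: "'g \<Rightarrow> complex" and m\<^sub>\<Lambda> :: "'l \<Rightarrow> complex"
  assumes "group \<Gamma>" and "countable (carrier \<Gamma>)"
    and "comm_group \<Lambda>" and "finitely_generated \<Lambda>"
    and "m\<^sub>\<Gamma> \<in> ell1 (carrier \<Gamma>)" and "m\<^sub>\<Lambda> \<in> ell1 (carrier \<Lambda>)"
    and "self_adjoint_op (carrier \<Gamma>) (conv_op \<Gamma> m\<^sub>\<Gamma>)"
    and "self_adjoint_op (carrier \<Lambda>) (conv_op \<Lambda> m\<^sub>\<Lambda>)"
  defines "M \<equiv> conv_op (wreath \<Lambda> \<Gamma>) (wreath_measure \<Lambda> \<Gamma> m\<^sub>\<Lambda> m\<^sub>\<Gamma>)"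
    and "v \<equiv> lamp_potential \<Lambda> \<Gamma> m\<^sub>\<Lambda>"
  defines "H \<equiv> random_schroedinger \<Gamma> m\<^sub>\<Gamma> v"
  shows "\<exists>P. haar_probability (lamps \<Lambda> \<Gamma>) P \<and>
    iid_with_law P (carrier \<Gamma>) v
      (spectral_measure (carrier \<Lambda>) (conv_op \<Lambda> m\<^sub>\<Lambda>) \<one>\<^bsub>\<Lambda>\<^esub>) \<and>
    bounded_measurable_field P (carrier \<Gamma>) H \<and>
    unitary_transform P (carrier \<Gamma>) (carrier (wreath \<Lambda> \<Gamma>)) (lamp_transform \<Lambda> \<Gamma> P) \<and>
    (\<forall>\<phi>\<in>L2 P (carrier \<Gamma>). AE \<omega> in P.
       direct_integral H \<phi> \<omega> =
       adjoint_transform P (carrier \<Gamma>) (carrier (wreath \<Lambda> \<Gamma>)) (lamp_transform \<Lambda> \<Gamma> P)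
         (M (lamp_transform \<Lambda> \<Gamma> P \<phi>)) \<omega>)"
proof -
  interpret lamp_groups \<Gamma> \<Lambda>
    using assms(1-3) by (intro lamp_groups.intro lamp_groups_axioms.intro)
  obtain Q where Q: "dual_probability \<Lambda> Q"
    using \<Lambda>.dual_probability_exists[OF assms(4)] by blast
  interpret Q: dual_probability \<Lambda> Q by (rule Q)
  interpret Q: self_adjoint_convolution \<Lambda> Q m\<^sub>\<Lambda>
    using assms(6,8) by unfold_locales
  define P where "P = lamp_measure Q"
  have "dual_probability (lamps \<Lambda> \<Gamma>) P"
    unfolding P_def by (rule dual_probability_lamp_measure[OF Q])
  then interpret P: dual_probability "lamps \<Lambda> \<Gamma>" P .
  interpret lamp_schroedinger \<Gamma> \<Lambda> P m\<^sub>\<Gamma> m\<^sub>\<Lambda>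
    using Q.countable_carrier assms(5-8) by unfold_locales
  have inv: "inj_on (m_inv \<Gamma>) (carrier \<Gamma>)" "m_inv \<Gamma> \<in> carrier \<Gamma> \<rightarrow> carrier \<Gamma>"
    by (auto intro: inj_on_inverseI[of _ "m_inv \<Gamma>"])
  have v_eq: "v x = (\<lambda>\<omega>. Q.symbol (lamp_component \<Lambda> \<Gamma> (inv\<^bsub>\<Gamma>\<^esub> x) \<omega>))" for x
    by (simp add: v_def lamp_potential_def[abs_def] Q.symbol_def lamp_component_def cong: infsum_cong)
  have "iid_with_law P (carrier \<Gamma>) v (spectral_measure (carrier \<Lambda>) (conv_op \<Lambda> m\<^sub>\<Lambda>) \<one>\<^bsub>\<Lambda>\<^esub>)"
    unfolding iid_with_law_def
  proof (intro conjI ballI)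
    have "P.indep_vars (\<lambda>_. Q) (\<lambda>x. lamp_component \<Lambda> \<Gamma> (inv\<^bsub>\<Gamma>\<^esub> x)) (carrier \<Gamma>)"
      unfolding P_def by (rule indep_lamp_components[OF Q inv])
    then have "P.indep_vars (\<lambda>_. borel) (\<lambda>x \<omega>. Q.symbol (lamp_component \<Lambda> \<Gamma> (inv\<^bsub>\<Gamma>\<^esub> x) \<omega>)) (carrier \<Gamma>)"
      by (rule P.indep_vars_compose2) (rule Q.symbol_measurable)
    then show "P.indep_vars (\<lambda>_. borel) v (carrier \<Gamma>)" by (simp only: v_eq[abs_def])
    fix x assume x: "x \<in> carrier \<Gamma>"
    have "distr P borel (v x) = distr (distr P Q (lamp_component \<Lambda> \<Gamma> (inv\<^bsub>\<Gamma>\<^esub> x))) borel Q.symbol"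
      using x by (simp add: distr_distr Q.symbol_measurable lamp_component_measurable[OF Q] P_def v_eq comp_def)
    also have "distr P Q (lamp_component \<Lambda> \<Gamma> (inv\<^bsub>\<Gamma>\<^esub> x)) = Q"
      unfolding P_def using x by (intro distr_lamp_component[OF Q]) simp
    also have "distr Q borel Q.symbol = spectral_measure (carrier \<Lambda>) (conv_op \<Lambda> m\<^sub>\<Lambda>) \<one>\<^bsub>\<Lambda>\<^esub>"
      by (rule Q.spectral_measure_conv_op[symmetric])
    finally show "distr P borel (v x) = spectral_measure (carrier \<Lambda>) (conv_op \<Lambda> m\<^sub>\<Lambda>) \<one>\<^bsub>\<Lambda>\<^esub>" .
  qed
  moreover have "\<forall>\<phi>\<in>L2 P (carrier \<Gamma>). AE \<omega> in P.
       direct_integral H \<phi> \<omega> =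
       adjoint_transform P (carrier \<Gamma>) (carrier (wreath \<Lambda> \<Gamma>)) (lamp_transform \<Lambda> \<Gamma> P)
         (M (lamp_transform \<Lambda> \<Gamma> P \<phi>)) \<omega>"
    unfolding H_def v_def M_def
    using adjoint_transform_AE[OF countable_\<Gamma> P.prob_space_axioms unitary_lamp_transform direct_integral_H_L2]
      lamp_transform_intertwines by simp
  ultimately show ?thesis
    using P.haar_probability bounded_measurable_field_H unitary_lamp_transform
    unfolding H_def v_def by blast
qed

end
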